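(* Fix a positive integer $m$. Given a hidden shift circuit $C_{(\pi,f_0,s)}$, the path sum $[\![C_{(\pi,f_0,s)}]\!]\circ|00\cdots0\rangle$ can be computed in time, and has size, polynomial in the volume $|C_{(\pi,f_0,s)}|$ of $C_{(\pi,f_0,s)}$. Furthermore, $$[\![C_{(\pi,f_0,s)}]\!]\circ|00\cdots0\rangle\overset{*}{\rightarrow}|s\rangle,$$ where $|s\rangle$ denotes the path sum with scalar $1$, empty variable set, phase $0$, output $s$ and no inputs.
   Context: **Hidden shift circuits.** $m$ is a fixed positive integer. $C^{(k)}Z$ denotes the $Z$ gate with $k$ controls. Let $\pi\in\mathcal{S}_n$, acting on $\mathbb{F}_2^n$ by permuting bits, $f_0:\mathbb{F}_2^n\to\mathbb{F}_2$, and $s=s_1s_2\in\mathbb{F}_2^{2n}$ with $s_1,s_2\in\mathbb{F}_2^n$. A hidden shift circuit $C_{(\pi,f_0,s)}$ is any circuit on $2n$ qubits of the form: $H$ on every qubit, then $O_G$, then $H$ on every qubit, then $O_F$, then $H$ on every qubit, where $O_G:|x,y\rangle\mapsto(-1)^{\langle x+s_1,\pi(y+s_2)\rangle+f_0(y+s_2)}|x,y\rangle$ and $O_F:|x,y\rangle\mapsto(-1)^{\langle x,\pi(y)\rangle+f_0(\pi^{-1}(x))}|x,y\rangle$ ($x,y\in\mathbb{F}_2^n$) are implemented over the gate set $\{X,\mathrm{SWAP},Z,CZ,\dots,C^{(m)}Z\}$ (in particular $\deg f_0\le m+1$). The volume $|C|$ of a circuit is (number of qubits)$\times$(number of gates).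 **Path sums.** For a finite set $V$ of indeterminates, $I_V\subseteq\mathbb{F}_2[V]$ is generated by $v^2-v$, $v\in V$; elements of $\mathbb{F}_2[V]/I_V$ are represented by multilinear polynomials, and $\mathrm{Var}$ is the set of occurring variables. A path sum is an expression $A=s_A\sum_{V_A}(-1)^{P_A}|O_A\rangle\langle I_A|$ with $V_A$ a finite set of indeterminates, $s_A\in\mathbb{C}$, and $P_A$ and the entries of the tuples $O_A=(O_{A,1},\dots,O_{A,p})$, $I_A=(I_{A,1},\dots,I_{A,q})$ in $\mathbb{F}_2[V_A]/I_{V_A}$; its signature is $q\to p$. Its size is the size of this expression with polynomials written as sums of monomials. With variable sets made disjoint: for $A:p\to q$, $B:r\to p$, $A\circ B=\frac{s_As_B}{2^p}\sum_{V_A\cup V_B\cup\{y_1,\dots,y_p\}}(-1)^{P_A+P_B+\sum_iy_i(O_{B,i}+I_{A,i})}|O_A\rangle\langle I_B|$ with fresh $y_i$; $A\otimes B=s_As_B\sum_{V_A\cup V_B}(-1)^{P_A+P_B}|O_AO_B\rangle\langle I_AI_B|$; $I_k=\sum_{\{y_1,\dots,y_k\}}(-1)^0|y_1,\dots,y_k\rangle\langle y_1,\dots,y_k|$. Basis states $|x\rangle$ are path sums with empty variable set. Gates are interpreted by $[\![H]\!]=\frac1{\sqrt2}\sum_{\{x,y\}}(-1)^{xy}|y\rangle\langle x|$, $[\![X]\!]=\sum_{\{x\}}|x+1\rangle\langle x|$, $[\![\mathrm{SWAP}]\!]=\sum_{\{x,y\}}|y,x\rangle\langle x,y|$, $[\![C^{(k)}Z]\!]=\sum_{\{x_1,\dots,x_k,y\}}(-1)^{yx_1\cdots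 x_k}|x_1,\dots,x_k,y\rangle\langle x_1,\dots,x_k,y|$, and $[\![C]\!]$ is obtained by composing and tensoring gate interpretations (with $[\![I_k]\!]=I_k$ for idle wires). **Rewrite system** $\rightarrow$ (union of three rules): (Elim) if $x\in V\setminus\mathrm{Var}(P,O,I)$: $s\sum_V(-1)^P|O\rangle\langle I|\rightarrow2s\sum_{V\setminus\{x\}}(-1)^P|O\rangle\langle I|$. (Z) if $z\in V\setminus\mathrm{Var}(R,O,I)$: $s\sum_V(-1)^{z+R}|O\rangle\langle I|\rightarrow0\sum_\emptyset(-1)^0|0,\dots,0\rangle\langle0,\dots,0|$ (same signature). (HH) if $x,y\in V$ distinct, $x\notin\mathrm{Var}(Q,R,O,I)$, $y\notin\mathrm{Var}(Q)$, $|\mathrm{Var}(Q)|\le1$: $s\sum_V(-1)^{x(y+Q)+R}|O\rangle\langle I|\rightarrow(s\sum_{V\setminus\{x\}}(-1)^R|O\rangle\langle I|)[y\leftarrow Q]$, substituting $Q$ for $y$ in all polynomials. $\overset{*}{\rightarrow}$ is the reflexive-transitive closure. *)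

theory Defs
  imports Complex_Main
    "HOL-Library.FSet"
    "HOL-Library.Poly_Mapping"
    "HOL-Library.Z2"
    "HOL-Combinatorics.Permutations"
    "HOL-Computational_Algebra.Polynomial"
begin

section \<open>Multilinear polynomials over the two-element field\<close>

text \<open>
  The quotient of \<open>\<bbbF>\<^sub>2[V]\<close> by the ideal generated by all \<open>v\<^sup>2 - v\<close> is the monoid algebra over
  \<open>\<bbbF>\<^sub>2\<close> of the monoid of multilinear monomials, i.e. of finite sets of indeterminates with union
  as multiplication. \<^typ>\<open>'a \<Rightarrow>\<^sub>0 'b\<close> writes the monoid of exponents additively, hence the
  instance of \<^class>\<open>comm_monoid_add\<close> below. Indeterminates are natural numbers.
\<close>

datatype monomial = Mon (mon_set: "nat fset")

instantiation monomial :: comm_monoid_add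
begin

definition zero_monomial :: monomial where "0 = Mon {||}"

definition plus_monomial :: "monomial \<Rightarrow> monomial \<Rightarrow> monomial"
  where "m + m' = Mon (mon_set m |\<union>| mon_set m')"

instance
  by standard (auto simp: zero_monomial_def plus_monomial_def)

end

type_synonym bpoly = "monomial \<Rightarrow>\<^sub>0 bit"

definition mon_vars :: "monomial \<Rightarrow> nat set"
  where "mon_vars m = fset (mon_set m)"

definition bconst :: "bit \<Rightarrow> bpoly"
  where "bconst b = Poly_Mapping.single 0 b"

definition var :: "nat \<Rightarrow> bpoly"
  where "var v = Poly_Mapping.single (Mon {|v|}) 1"

lemma var_idem: "var v * var v = var v"
  by (simp add: var_def mult_single plus_monomial_def)

definition Vars :: "bpoly \<Rightarrow> nat set"
  where "Vars p = (\<Union>m\<in>Poly_Mapping.keys p. mon_vars m)"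

text \<open>All nonzero coefficients are \<open>1\<close>, so a polynomial is the sum of the monomials in its support.\<close>

definition bsubst :: "(nat \<Rightarrow> bpoly) \<Rightarrow> bpoly \<Rightarrow> bpoly"
  where "bsubst \<sigma> p = (\<Sum>m\<in>Poly_Mapping.keys p. \<Prod>v\<in>mon_vars m. \<sigma> v)"

definition bpoly_size :: "bpoly \<Rightarrow> nat"
  where "bpoly_size p = (\<Sum>m\<in>Poly_Mapping.keys p. Suc (card (mon_vars m)))"


section \<open>Path sums\<close>

text \<open>\<open>PathSum s V P Os Is\<close> stands for \<open>s \<Sum>\<^sub>V (-1)\<^sup>P |Os\<rangle>\<langle>Is|\<close>.\<close>

datatype path_sum =
  PathSum (scalar: complex) (indets: "nat set") (phase: bpoly)
    (outs: "bpoly list") (ins: "bpoly list")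

definition valid_path_sum :: "path_sum \<Rightarrow> bool" where
  "valid_path_sum A \<longleftrightarrow> finite (indets A) \<and> Vars (phase A) \<subseteq> indets A \<and>
     (\<forall>p\<in>set (outs A) \<union> set (ins A). Vars p \<subseteq> indets A)"

text \<open>
  The scalar counts as one symbol here; a notion of size in which the scalar and the names of
  the indeterminates are written out is the size of the trees used in \<open>represents\<close> below.
\<close>

definition path_sum_size :: "path_sum \<Rightarrow> nat" where
  "path_sum_size A = 1 + card (indets A) + bpoly_size (phase A)
     + (\<Sum>p\<leftarrow>outs A. Suc (bpoly_size p)) + (\<Sum>p\<leftarrow>ins A. Suc (bpoly_size p))"

definition rename :: "(nat \<Rightarrow> nat) \<Rightarrow> path_sum \<Rightarrow> path_sum" where
  "rename f A = PathSum (scalar A) (f ` indets A) (bsubst (var \<circ> f) (phase A))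
     (map (bsubst (var \<circ> f)) (outs A)) (map (bsubst (var \<circ> f)) (ins A))"

definition fresh_from :: "nat set \<Rightarrow> nat"
  where "fresh_from V = (if V = {} then 0 else Suc (Max V))"

text \<open>
  Variable sets are made disjoint by shifting the names of the second argument past those of the
  first one.
\<close>

definition shift_past :: "path_sum \<Rightarrow> path_sum \<Rightarrow> path_sum"
  where "shift_past A B = rename (\<lambda>v. fresh_from (indets A) + v) B"

definition tensor :: "path_sum \<Rightarrow> path_sum \<Rightarrow> path_sum" where
  "tensor A B = (let B' = shift_past A B in
     PathSum (scalar A * scalar B') (indets A \<union> indets B') (phase A + phase B')
       (outs A @ outs B') (ins A @ ins B'))"

definition compose :: "path_sum \<Rightarrow> path_sum \<Rightarrow> path_sum" (infixl \<open>\<circ>\<^sub>P\<close> 55) where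
  "A \<circ>\<^sub>P B = (let B' = shift_past A B; p = length (ins A); y = fresh_from (indets A \<union> indets B') in
     PathSum (scalar A * scalar B' / 2 ^ p) (indets A \<union> indets B' \<union> {y..<y + p})
       (phase A + phase B' + (\<Sum>i<p. var (y + i) * (outs B' ! i + ins A ! i)))
       (outs A) (ins B'))"

definition id_ps :: "nat \<Rightarrow> path_sum"
  where "id_ps k = PathSum 1 {..<k} 0 (map var [0..<k]) (map var [0..<k])"

definition ket :: "bit list \<Rightarrow> path_sum"
  where "ket xs = PathSum 1 {} 0 (map bconst xs) []"


section \<open>The rewrite system\<close>

text \<open>
  Rewriting acts on the expressions themselves: it is not closed under renaming of indeterminates.
\<close>

inductive rewrite :: "path_sum \<Rightarrow> path_sum \<Rightarrow> bool" where
  elim: "rewrite (PathSum s V P Os Is) (PathSum (2 * s) (V - {x}) P Os Is)"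
  if "valid_path_sum (PathSum s V P Os Is)"
    and "x \<in> V" and "\<forall>p\<in>{P} \<union> set Os \<union> set Is. x \<notin> Vars p"
| zero: "rewrite (PathSum s V (var z + R) Os Is)
    (PathSum 0 {} 0 (replicate (length Os) 0) (replicate (length Is) 0))"
  if "valid_path_sum (PathSum s V (var z + R) Os Is)"
    and "z \<in> V" and "\<forall>p\<in>{R} \<union> set Os \<union> set Is. z \<notin> Vars p"
| hh: "rewrite (PathSum s V (var x * (var y + Q) + R) Os Is)
    (PathSum s (V - {x}) (bsubst (var(y := Q)) R)
       (map (bsubst (var(y := Q))) Os) (map (bsubst (var(y := Q))) Is))"
  if "valid_path_sum (PathSum s V (var x * (var y + Q) + R) Os Is)"
    and "x \<in> V" and "y \<in> V" and "x \<noteq> y"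
    and "\<forall>p\<in>{Q, R} \<union> set Os \<union> set Is. x \<notin> Vars p"
    and "y \<notin> Vars Q" and "card (Vars Q) \<le> 1"


section \<open>Circuits\<close>

text \<open>\<open>CtrlZ k\<close> is the \<open>Z\<close> gate with \<open>k\<close> controls, so \<open>CtrlZ 0\<close> is \<open>Z\<close> itself.\<close>

datatype gate = Had | NotX | Swap | CtrlZ nat

fun arity :: "gate \<Rightarrow> nat" where
  "arity Had = 1"
| "arity NotX = 1"
| "arity Swap = 2"
| "arity (CtrlZ k) = Suc k"

text \<open>
  \<open>Seq A B\<close> runs \<open>A\<close> first, then \<open>B\<close>; \<open>Idle k\<close> is a bundle of \<open>k\<close> wires without a gate.
\<close>

datatype circuit = Gate gate | Idle nat | Seq circuit circuit | Par circuit circuit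

fun width :: "circuit \<Rightarrow> nat" where
  "width (Gate g) = arity g"
| "width (Idle k) = k"
| "width (Seq A B) = width A"
| "width (Par A B) = width A + width B"

fun gates :: "circuit \<Rightarrow> gate list" where
  "gates (Gate g) = [g]"
| "gates (Idle k) = []"
| "gates (Seq A B) = gates A @ gates B"
| "gates (Par A B) = gates A @ gates B"

definition volume :: "circuit \<Rightarrow> nat"
  where "volume C = width C * length (gates C)"

text \<open>
  Besides matching widths, idle wires may only fill up space next to gates: composing with a
  gate-free circuit or tensoring with the circuit on no wires is excluded. These would enlarge the
  term (and its path sum) while changing neither the drawn circuit nor its volume.
\<close>

fun well_formed :: "circuit \<Rightarrow> bool" where
  "well_formed (Gate g) \<longleftrightarrow> True"
| "well_formed (Idle k) \<longleftrightarrow> True"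
| "well_formed (Seq A B) \<longleftrightarrow> well_formed A \<and> well_formed B \<and> width A = width B \<and>
     gates A \<noteq> [] \<and> gates B \<noteq> []"
| "well_formed (Par A B) \<longleftrightarrow> well_formed A \<and> well_formed B \<and> width A > 0 \<and> width B > 0"

fun gate_ps :: "gate \<Rightarrow> path_sum" where
  "gate_ps Had = PathSum (1 / complex_of_real (sqrt 2)) {0, 1} (var 0 * var 1) [var 1] [var 0]"
| "gate_ps NotX = PathSum 1 {0} 0 [var 0 + 1] [var 0]"
| "gate_ps Swap = PathSum 1 {0, 1} 0 [var 1, var 0] [var 0, var 1]"
| "gate_ps (CtrlZ k) =
     PathSum 1 {..k} (\<Prod>i\<le>k. var i) (map var [0..<Suc k]) (map var [0..<Suc k])"

fun interp :: "circuit \<Rightarrow> path_sum" where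
  "interp (Gate g) = gate_ps g"
| "interp (Idle k) = id_ps k"
| "interp (Seq A B) = interp B \<circ>\<^sub>P interp A"
| "interp (Par A B) = tensor (interp A) (interp B)"

text \<open>
  The linear operator of a circuit, used to say that a circuit implements an oracle:
  \<open>amp C y x\<close> is the matrix entry \<open>\<langle>y|C|x\<rangle>\<close>.
\<close>

definition signum :: "bit \<Rightarrow> complex"
  where "signum b = (if b = 1 then - 1 else 1)"

fun gate_amp :: "gate \<Rightarrow> bit list \<Rightarrow> bit list \<Rightarrow> complex" where
  "gate_amp Had y x = signum (x ! 0 * y ! 0) / complex_of_real (sqrt 2)"
| "gate_amp NotX y x = (if y = [x ! 0 + 1] then 1 else 0)"
| "gate_amp Swap y x = (if y = [x ! 1, x ! 0] then 1 else 0)"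
| "gate_amp (CtrlZ k) y x = (if y = x then signum (prod_list x) else 0)"

fun amp :: "circuit \<Rightarrow> bit list \<Rightarrow> bit list \<Rightarrow> complex" where
  "amp (Gate g) y x = gate_amp g y x"
| "amp (Idle k) y x = (if y = x then 1 else 0)"
| "amp (Seq A B) y x = (\<Sum>z | length z = width A. amp B y z * amp A z x)"
| "amp (Par A B) y x =
     amp A (take (width A) y) (take (width A) x) * amp B (drop (width A) y) (drop (width A) x)"


section \<open>Hidden shift circuits\<close>

definition vec_add :: "bit list \<Rightarrow> bit list \<Rightarrow> bit list"
  where "vec_add x y = map2 (+) x y"

definition inner_prod :: "bit list \<Rightarrow> bit list \<Rightarrow> bit"
  where "inner_prod x y = sum_list (map2 (*) x y)"

text \<open>
  \<open>C\<close> is a circuit over \<open>X\<close>, \<open>SWAP\<close>, \<open>Z\<close>, \<open>CZ\<close>, \dots, \<open>C\<^sup>(\<^sup>m\<^sup>)Z\<close> whose operator is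
  \<open>|x,y\<rangle> \<mapsto> (-1)\<^sup>g\<^sup>(\<^sup>x\<^sup>,\<^sup>y\<^sup>) |x,y\<rangle>\<close> on \<open>2n\<close> qubits. That \<open>g\<close> has degree at most \<open>m + 1\<close> is a
  consequence of the choice of gates.
\<close>

definition implements_phase_oracle ::
  "nat \<Rightarrow> nat \<Rightarrow> (bit list \<Rightarrow> bit list \<Rightarrow> bit) \<Rightarrow> circuit \<Rightarrow> bool" where
  "implements_phase_oracle m n g C \<longleftrightarrow>
     well_formed C \<and> width C = 2 * n \<and>
     set (gates C) \<subseteq> {NotX, Swap} \<union> CtrlZ ` {..m} \<and>
     (\<forall>x y z. length x = n \<longrightarrow> length y = n \<longrightarrow> length z = 2 * n \<longrightarrow>
        amp C z (x @ y) = (if z = x @ y then signum (g x y) else 0))"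

fun all_Had :: "nat \<Rightarrow> circuit" where
  "all_Had 0 = Idle 0"
| "all_Had (Suc 0) = Gate Had"
| "all_Had (Suc (Suc k)) = Par (Gate Had) (all_Had (Suc k))"

definition hidden_shift_circuit ::
  "nat \<Rightarrow> nat \<Rightarrow> (nat \<Rightarrow> nat) \<Rightarrow> (bit list \<Rightarrow> bit) \<Rightarrow> bit list \<Rightarrow> bit list \<Rightarrow> circuit \<Rightarrow> bool" where
  "hidden_shift_circuit m n \<pi> f\<^sub>0 s\<^sub>1 s\<^sub>2 C \<longleftrightarrow>
     \<pi> permutes {..<n} \<and> length s\<^sub>1 = n \<and> length s\<^sub>2 = n \<and>
     (\<exists>G F.
        implements_phase_oracle m n
          (\<lambda>x y. inner_prod (vec_add x s\<^sub>1) (permute_list \<pi> (vec_add y s\<^sub>2)) + f\<^sub>0 (vec_add y s\<^sub>2)) G \<and>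
        implements_phase_oracle m n
          (\<lambda>x y. inner_prod x (permute_list \<pi> y) + f\<^sub>0 (permute_list (inv \<pi>) x)) F \<and>
        C = Seq (all_Had (2 * n)) (Seq G (Seq (all_Had (2 * n)) (Seq F (all_Had (2 * n))))))"


section \<open>A model of computation\<close>

text \<open>
  Running time is measured in a first-order call-by-value functional language over binary trees
  with unit cost per evaluated subexpression. A program is a list of function bodies. Variables are
  de Bruijn indices: a call evaluates the body in the environment of its arguments, and
  the second branch of \<open>Case\<close> binds the left (index 0) and right (index 1) subtree.
  For a fixed program every step is a bounded number of pointer operations, so polynomial time here
  is polynomial time on a random access or Turing machine (with shared subtrees in memory).
\<close>

datatype tree = Leaf | Node tree tree

datatype expr =
  Var nat | LeafE | NodeE expr expr | Case expr expr expr | Call nat "expr list"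

type_synonym program = "expr list"

inductive evaluates :: "program \<Rightarrow> tree list \<Rightarrow> expr \<Rightarrow> nat \<Rightarrow> tree \<Rightarrow> bool"
  and evaluates_list :: "program \<Rightarrow> tree list \<Rightarrow> expr list \<Rightarrow> nat \<Rightarrow> tree list \<Rightarrow> bool"
  for prog :: program where
  "evaluates prog env (Var i) 1 (env ! i)"
    if "i < length env"
| "evaluates prog env LeafE 1 Leaf"
| "evaluates prog env (NodeE a b) (T + T' + 1) (Node u v)"
    if "evaluates prog env a T u" and "evaluates prog env b T' v"
| "evaluates prog env (Case e a b) (T + T' + 1) v"
    if "evaluates prog env e T Leaf" and "evaluates prog env a T' v"
| "evaluates prog env (Case e a b) (T + T' + 1) v"
    if "evaluates prog env e T (Node l r)" and "evaluates prog (l # r # env) b T' v"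
| "evaluates prog env (Call f es) (T + T' + 1) v"
    if "evaluates_list prog env es T vs" and "f < length prog"
      and "evaluates prog vs (prog ! f) T' v"
| "evaluates_list prog env [] 0 []"
| "evaluates_list prog env (e # es) (T + T') (v # vs)"
    if "evaluates prog env e T v" and "evaluates_list prog env es T' vs"

text \<open>Started on input \<open>t\<close>, the program halts after time \<open>T\<close> with output \<open>u\<close>.\<close>

definition computes :: "program \<Rightarrow> tree \<Rightarrow> nat \<Rightarrow> tree \<Rightarrow> bool"
  where "computes prog t T u \<longleftrightarrow> evaluates prog [t] (Call 0 [Var 0]) T u"

fun enc_nat :: "nat \<Rightarrow> tree" where
  "enc_nat 0 = Leaf"
| "enc_nat (Suc k) = Node Leaf (enc_nat k)"

fun enc_list :: "tree list \<Rightarrow> tree" where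
  "enc_list [] = Leaf"
| "enc_list (t # ts) = Node t (enc_list ts)"

fun enc_gate :: "gate \<Rightarrow> tree" where
  "enc_gate Had = Node (enc_nat 0) Leaf"
| "enc_gate NotX = Node (enc_nat 1) Leaf"
| "enc_gate Swap = Node (enc_nat 2) Leaf"
| "enc_gate (CtrlZ k) = Node (enc_nat 3) (enc_nat k)"

fun enc_circuit :: "circuit \<Rightarrow> tree" where
  "enc_circuit (Gate g) = Node (enc_nat 0) (enc_gate g)"
| "enc_circuit (Idle k) = Node (enc_nat 1) (enc_nat k)"
| "enc_circuit (Seq A B) = Node (enc_nat 2) (Node (enc_circuit A) (enc_circuit B))"
| "enc_circuit (Par A B) = Node (enc_nat 3) (Node (enc_circuit A) (enc_circuit B))"

text \<open>\<open>ms\<close> spells out \<open>p\<close> as a sum of pairwise distinct multilinear monomials, in some order.\<close>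

definition writes_bpoly :: "nat list list \<Rightarrow> bpoly \<Rightarrow> bool" where
  "writes_bpoly ms p \<longleftrightarrow> (\<forall>m\<in>set ms. distinct m) \<and>
     distinct (map (\<lambda>m. Mon (fset_of_list m)) ms) \<and>
     Poly_Mapping.keys p = (\<lambda>m. Mon (fset_of_list m)) ` set ms"

definition enc_monomials :: "nat list list \<Rightarrow> tree"
  where "enc_monomials ms = enc_list (map (\<lambda>m. enc_list (map enc_nat m)) ms)"

text \<open>
  \<open>t\<close> spells out the expression \<open>A\<close>. Scalars arising from circuits are powers of \<open>1/\<surd>2\<close>, and they
  are written by giving the exponent in unary.
\<close>

definition represents :: "tree \<Rightarrow> path_sum \<Rightarrow> bool" where
  "represents t A \<longleftrightarrow> (\<exists>k vs P Os Is.
     t = enc_list [enc_nat k, enc_list (map enc_nat vs), enc_monomials P,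
           enc_list (map enc_monomials Os), enc_list (map enc_monomials Is)] \<and>
     scalar A = (1 / complex_of_real (sqrt 2)) ^ k \<and>
     distinct vs \<and> set vs = indets A \<and> writes_bpoly P (phase A) \<and>
     list_all2 writes_bpoly Os (outs A) \<and> list_all2 writes_bpoly Is (ins A))"

end

theory Submission
  imports Defs
begin

text \<open>
  A multilinear polynomial over \<open>\<bbbF>\<^sub>2\<close> is determined by its Boolean function, so identities between phases
  can be checked by evaluation. The phase of \<open>\<lbrakk>C\<rbrakk> \<circ> |0\<dots>0\<rangle>\<close> is the sum of the gate phases and of one
  term \<open>y (w + p)\<close> per wire between two gates, where \<open>w\<close> is an input variable and \<open>p\<close> has at most one
  variable. Rule (HH) at \<open>y\<close> followed by (Elim) at \<open>w\<close> replaces \<open>w\<close> by \<open>p\<close> and preserves the invariant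
  that the scalar is \<open>(1/\<surd>2)\<^sup>|\<^sup>V\<^sup>|\<close>. Eliminating all wires runs the oracles classically and leaves only the output
  variables of the Hadamard gates, \<open>(x,y)\<close>, \<open>(u,v)\<close>, \<open>(p,q)\<close> for the three layers, with phase
  \<open>\<langle>x + s\<^sub>1, \<pi>(y + s\<^sub>2)\<rangle> + f\<^sub>0(y + s\<^sub>2) + \<langle>x,u\<rangle> + \<langle>y,v\<rangle> + \<langle>u, \<pi>(v)\<rangle> + f\<^sub>0(\<pi>\<^sup>-\<^sup>1(u)) + \<langle>u,p\<rangle> + \<langle>v,q\<rangle>\<close>.
  It has the same shape again: eliminating \<open>x\<close> puts \<open>u = \<pi>(y + s\<^sub>2)\<close>, which cancels \<open>f\<^sub>0\<close>, then \<open>v\<close> puts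
  \<open>q = s\<^sub>2\<close> and \<open>y\<close> puts \<open>p = s\<^sub>1\<close>.

  For the running time, a closed form of the path sum, with consecutively numbered variables, is written down by
  one recursion over the circuit.
\<close>

text \<open>The side conditions of the rules speak of occurring variables, but with an arbitrary
  \<open>f\<^sub>0\<close> the polynomials of the reducts are unmanageable. Hence only their Boolean
  functions are tracked, and independence of a function from a variable is turned back into
  non-occurrence. (HH) demands that the substituted polynomial have at most one variable. No gate
  multiplies its outputs, so each wire carries \<open>v\<close> or \<open>v + 1\<close> and
  nonlinear terms live in the phase only; substituting such polynomials into each other keeps their
  form, and a rank on the variables excludes cycles. The oracles are specified by operators, not by
  path sums. A Hadamard-free circuit is a signed permutation of basis states, so its operator
  determines permutation and sign, which ties the specification to the classical run. Volume does
  not count the nodes of a circuit term. Its comparison with the term size rests on every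
  \<open>Seq\<close> in an oracle splitting the gates, and every \<open>Par\<close> splitting the
  wires, into two nonempty parts.\<close>

section \<open>Multilinear polynomials as Boolean functions\<close>

text \<open>These rules would turn sums and products of bits into \<open>XOR\<close> and \<open>AND\<close>, out of reach of the ring laws.\<close>

declare add_bit_eq_xor [simp del] mult_bit_eq_and [simp del]

lemma bit_add_self [simp]: "(b::bit) + b = 0"
  by (cases b) simp_all

lemma bit_add_self_left [simp]: "(b::bit) + (b + c) = c"
  by (simp flip: add.assoc)

definition mon_eval :: "(nat \<Rightarrow> bit) \<Rightarrow> monomial \<Rightarrow> bit"
  where "mon_eval a m = (\<Prod>v\<in>mon_vars m. a v)"

definition eval :: "(nat \<Rightarrow> bit) \<Rightarrow> bpoly \<Rightarrow> bit"
  where "eval a p = (\<Sum>m\<in>Poly_Mapping.keys p. mon_eval a m)"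

lemma finite_mon_vars [simp]: "finite (mon_vars m)"
  by (simp add: mon_vars_def)

lemma finite_Vars [simp]: "finite (Vars p)"
  by (simp add: Vars_def)

lemma bit_prod: "finite S \<Longrightarrow> (\<Prod>v\<in>S. (a v :: bit)) = (if \<forall>v\<in>S. a v = 1 then 1 else 0)"
  by (induction S rule: finite_induct) auto

lemma mon_eval_if: "mon_eval a m = (if \<forall>v\<in>mon_vars m. a v = 1 then 1 else 0)"
  by (simp add: mon_eval_def bit_prod)

lemma mon_vars_plus [simp]: "mon_vars (m + m') = mon_vars m \<union> mon_vars m'"
  by (simp add: mon_vars_def plus_monomial_def)

lemma mon_vars_zero [simp]: "mon_vars 0 = {}"
  by (simp add: mon_vars_def zero_monomial_def)

lemma mon_vars_Mon [simp]: "mon_vars (Mon S) = fset S"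
  by (simp add: mon_vars_def)

text \<open>A variable shared by both monomials counts once on the left and twice on the right,
  which agrees because bits are idempotent. This is where the relations \<open>v^2 - v\<close>
  enter.\<close>

lemma mon_eval_plus: "mon_eval a (m + m') = mon_eval a m * mon_eval a m'"
  by (auto simp: mon_eval_if)

lemma eval_superset:
  assumes "finite S" "Poly_Mapping.keys p \<subseteq> S"
  shows "eval a p = (\<Sum>m\<in>S. Poly_Mapping.lookup p m * mon_eval a m)"
  unfolding eval_def using assms
  by (intro sum.mono_neutral_cong_left) (auto simp: in_keys_iff)

lemma eval_single [simp]: "eval a (Poly_Mapping.single m b) = b * mon_eval a m"
  by (cases b) (simp_all add: eval_def)

lemma eval_zero [simp]: "eval a 0 = 0"
  by (simp add: eval_def)

lemma eval_one [simp]: "eval a 1 = 1"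
  by (simp add: eval_def mon_eval_def)

lemma eval_add [simp]: "eval a (p + q) = eval a p + eval a q"
proof -
  let ?S = "Poly_Mapping.keys p \<union> Poly_Mapping.keys q"
  have "Poly_Mapping.keys (p + q) \<subseteq> ?S" by (rule keys_add)
  then show ?thesis
    by (subst (1 2 3) eval_superset[where S = ?S])
      (auto simp: lookup_add algebra_simps sum.distrib)
qed

lemma eval_sum [simp]: "eval a (sum f S) = (\<Sum>x\<in>S. eval a (f x))"
  by (induction S rule: infinite_finite_induct) auto

text \<open>Every nonzero coefficient is 1, so a product of polynomials becomes a sum over pairs of
  monomials, as used in \<open>eval_mult\<close>.\<close>

lemma bpoly_expand: "p = (\<Sum>m\<in>Poly_Mapping.keys p. Poly_Mapping.single m 1)" for p :: bpoly
proof (rule poly_mapping_eqI)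
  fix k
  show "Poly_Mapping.lookup p k = Poly_Mapping.lookup (\<Sum>m\<in>Poly_Mapping.keys p. Poly_Mapping.single m (1::bit)) k"
    by (simp add: lookup_sum lookup_single when_def in_keys_iff)
qed

lemma eval_mult [simp]: "eval a (p * q) = eval a p * eval a q"
proof -
  have "p * q = (\<Sum>m\<in>Poly_Mapping.keys p. \<Sum>m'\<in>Poly_Mapping.keys q. Poly_Mapping.single (m + m') 1)"
    by (subst bpoly_expand[of p], subst bpoly_expand[of q])
      (simp add: sum_product mult_single)
  then show ?thesis
    by (simp add: mon_eval_plus) (simp add: eval_def sum_product)
qed

lemma eval_prod [simp]: "eval a (prod f S) = (\<Prod>x\<in>S. eval a (f x))"
  by (induction S rule: infinite_finite_induct) auto

lemma eval_var [simp]: "eval a (var v) = a v"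
  by (simp add: var_def mon_eval_def)

lemma eval_bconst [simp]: "eval a (bconst b) = b"
  by (simp add: bconst_def mon_eval_def)

lemma eval_bsubst [simp]: "eval a (bsubst \<sigma> p) = eval (\<lambda>v. eval a (\<sigma> v)) p"
  by (simp add: bsubst_def) (simp add: eval_def mon_eval_def)

text \<open>A nonzero polynomial does not vanish at the indicator of a monomial of minimal degree.\<close>

lemma eval_eq_0_imp:
  assumes "\<And>a. eval a p = 0"
  shows "p = 0"
proof (rule ccontr)
  assume "p \<noteq> 0"
  then have "Poly_Mapping.keys p \<noteq> {}" by simp
  then obtain m where m: "m \<in> Poly_Mapping.keys p"
    and min: "\<And>m'. m' \<in> Poly_Mapping.keys p \<Longrightarrow> card (mon_vars m) \<le> card (mon_vars m')"
    using ex_has_least_nat[of "\<lambda>m. m \<in> Poly_Mapping.keys p" _ "\<lambda>m. card (mon_vars m)"] by blast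
  define a where "a v = (if v \<in> mon_vars m then 1 else (0::bit))" for v
  have "mon_eval a m' = (if m' = m then 1 else 0)" if "m' \<in> Poly_Mapping.keys p" for m'
  proof -
    have "m' = m" if "mon_vars m' \<subseteq> mon_vars m"
    proof -
      have "mon_vars m' = mon_vars m"
        using that min[OF \<open>m' \<in> _\<close>] by (simp add: card_seteq)
      then show ?thesis
        by (cases m; cases m') (simp add: mon_vars_def fset_inject)
    qed
    then show ?thesis
      by (auto simp: mon_eval_if a_def)
  qed
  then have "eval a p = 1"
    using m by (simp add: eval_def)
  with assms show False by simp
qed

lemma eval_inject:
  assumes "\<And>a. eval a p = eval a q"
  shows "p = q"
proof -
  have "p - q = 0"
  proof (rule eval_eq_0_imp)
    fix a
    have "eval a (p - q) + eval a q = eval a q"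
      using assms[of a] by (simp flip: eval_add)
    then show "eval a (p - q) = 0" by simp
  qed
  then show ?thesis by simp
qed

section \<open>Occurring variables\<close>

lemma Vars_add: "Vars (p + q) \<subseteq> Vars p \<union> Vars q"
  using keys_add[of p q] by (auto simp: Vars_def)

lemma Vars_zero [simp]: "Vars 0 = {}"
  by (simp add: Vars_def)

lemma Vars_one [simp]: "Vars 1 = {}"
  by (simp add: Vars_def)

lemma Vars_bconst [simp]: "Vars (bconst b) = {}"
  by (cases b) (simp_all add: Vars_def bconst_def)

lemma Vars_var [simp]: "Vars (var v) = {v}"
  by (simp add: Vars_def var_def)

lemma Vars_mult: "Vars (p * q) \<subseteq> Vars p \<union> Vars q"
  using keys_mult[of p q] by (fastforce simp: Vars_def)

lemma Vars_sum: "Vars (sum f S) \<subseteq> (\<Union>x\<in>S. Vars (f x))"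
  by (induction S rule: infinite_finite_induct) (use Vars_add in fastforce)+

lemma Vars_prod: "Vars (prod f S) \<subseteq> (\<Union>x\<in>S. Vars (f x))"
  by (induction S rule: infinite_finite_induct) (use Vars_mult in fastforce)+

lemma Vars_bsubst: "Vars (bsubst \<sigma> p) \<subseteq> (\<Union>v\<in>Vars p. Vars (\<sigma> v))"
proof -
  have "Vars (bsubst \<sigma> p) \<subseteq> (\<Union>m\<in>Poly_Mapping.keys p. \<Union>v\<in>mon_vars m. Vars (\<sigma> v))"
    unfolding bsubst_def using Vars_prod[of \<sigma>] by (intro order.trans[OF Vars_sum]) blast
  then show ?thesis by (auto simp: Vars_def)
qed

lemma eval_cong: "(\<And>v. v \<in> Vars p \<Longrightarrow> a v = b v) \<Longrightarrow> eval a p = eval b p"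
  unfolding eval_def mon_eval_def Vars_def by (intro sum.cong prod.cong) auto

text \<open>Setting the variables outside \<open>S\<close> to 0 does not change the function, hence
  not the polynomial. This is the way back from functions to the occurrence conditions of the
  rewrite rules.\<close>

lemma Vars_subset_if_eval_cong:
  assumes "\<And>a b. (\<And>v. v \<in> S \<Longrightarrow> a v = b v) \<Longrightarrow> eval a p = eval b p"
  shows "Vars p \<subseteq> S"
proof -
  let ?\<sigma> = "\<lambda>v. if v \<in> S then var v else 0"
  have "p = bsubst ?\<sigma> p"
    by (rule eval_inject) (auto intro!: assms)
  moreover have "Vars (bsubst ?\<sigma> p) \<subseteq> S"
    using Vars_bsubst[of ?\<sigma> p] by (auto split: if_splits)
  ultimately show ?thesis by simp
qed

section \<open>The path sum of a circuit in closed form\<close>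

text \<open>Polynomials are spelled as lists of monomials, the form that \<open>writes_bpoly\<close>
  asks for and the program produces. Repeated monomials would cancel here; their absence is proved
  separately.\<close>

definition mon_poly :: "nat list \<Rightarrow> bpoly"
  where "mon_poly m = prod_list (map var m)"

definition list_poly :: "nat list list \<Rightarrow> bpoly"
  where "list_poly ms = sum_list (map mon_poly ms)"

lemma mon_poly_simps [simp]: "mon_poly [] = 1" "mon_poly (v # m) = var v * mon_poly m"
  by (simp_all add: mon_poly_def)

lemma list_poly_simps [simp]: "list_poly [] = 0" "list_poly (m # ms) = mon_poly m + list_poly ms"
  "list_poly (ms @ ms') = list_poly ms + list_poly ms'"
  by (simp_all add: list_poly_def)

lemma list_poly_map_Cons [simp]: "list_poly (map ((#) y) ms) = var y * list_poly ms"
  by (induction ms) (simp_all add: algebra_simps)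

lemma eval_mon_poly: "eval a (mon_poly m) = (\<Prod>v\<leftarrow>m. a v)"
  by (induction m) simp_all

lemma bsubst_mon_poly: "bsubst (\<lambda>v. var (f v)) (mon_poly m) = mon_poly (map f m)"
  by (rule eval_inject) (simp add: eval_mon_poly comp_def)

lemma bsubst_add: "bsubst \<sigma> (p + q) = bsubst \<sigma> p + bsubst \<sigma> q"
  by (rule eval_inject) simp

lemma bsubst_zero [simp]: "bsubst \<sigma> 0 = 0"
  by (rule eval_inject) simp

lemma bsubst_var [simp]: "bsubst \<sigma> (var v) = \<sigma> v"
  by (rule eval_inject) simp

lemma bsubst_list_poly: "bsubst (\<lambda>v. var (f v)) (list_poly ms) = list_poly (map (map f) ms)"
  by (induction ms) (simp_all add: bsubst_add bsubst_mon_poly)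

text \<open>The typing part of \<open>well_formed\<close>. A hidden shift circuit satisfies it even
  for \<open>n = 0\<close>, where it is a \<open>Seq\<close> of gate-free circuits and so not
  \<open>well_formed\<close>.\<close>

fun matched :: "circuit \<Rightarrow> bool" where
  "matched (Gate g) \<longleftrightarrow> True"
| "matched (Idle k) \<longleftrightarrow> True"
| "matched (Seq A B) \<longleftrightarrow> matched A \<and> matched B \<and> width A = width B"
| "matched (Par A B) \<longleftrightarrow> matched A \<and> matched B"

text \<open>
  The second argument \<open>d\<close> of the functions below is the first variable of the path sum. In \<open>Seq A B\<close> the
  variables of \<open>B\<close> come first, then those of \<open>A\<close>, then the variables introduced by the composition. The
  scalar is \<open>(1/\<surd>2)\<close> to the power \<open>root_exp\<close>.
\<close>

fun nvars :: "circuit \<Rightarrow> nat" where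
  "nvars (Gate Had) = 2"
| "nvars (Gate NotX) = 1"
| "nvars (Gate Swap) = 2"
| "nvars (Gate (CtrlZ k)) = Suc k"
| "nvars (Idle k) = k"
| "nvars (Seq A B) = nvars B + nvars A + width B"
| "nvars (Par A B) = nvars A + nvars B"

fun root_exp :: "circuit \<Rightarrow> nat" where
  "root_exp (Gate g) = (if g = Had then 1 else 0)"
| "root_exp (Idle k) = 0"
| "root_exp (Seq A B) = root_exp B + root_exp A + 2 * width B"
| "root_exp (Par A B) = root_exp A + root_exp B"

fun in_vars :: "circuit \<Rightarrow> nat \<Rightarrow> nat list" where
  "in_vars (Gate g) d = [d..<d + (if g = Had then 1 else arity g)]"
| "in_vars (Idle k) d = [d..<d + k]"
| "in_vars (Seq A B) d = in_vars A (d + nvars B)"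
| "in_vars (Par A B) d = in_vars A d @ in_vars B (d + nvars A)"

fun out_mons :: "circuit \<Rightarrow> nat \<Rightarrow> nat list list list" where
  "out_mons (Gate Had) d = [[[Suc d]]]"
| "out_mons (Gate NotX) d = [[[d], []]]"
| "out_mons (Gate Swap) d = [[[Suc d]], [[d]]]"
| "out_mons (Gate (CtrlZ k)) d = map (\<lambda>v. [[v]]) [d..<d + Suc k]"
| "out_mons (Idle k) d = map (\<lambda>v. [[v]]) [d..<d + k]"
| "out_mons (Seq A B) d = out_mons B d"
| "out_mons (Par A B) d = out_mons A d @ out_mons B (d + nvars A)"

text \<open>The sum of the \<open>y (w + p)\<close> that a composition adds to the phase, multiplied
  out, with one consecutive \<open>y\<close> per wire.\<close>

fun link_mons :: "nat \<Rightarrow> nat list list list \<Rightarrow> nat list \<Rightarrow> nat list list" where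
  "link_mons y (p # ps) (w # ws) = [y, w] # map ((#) y) p @ link_mons (Suc y) ps ws"
| "link_mons y _ _ = []"

text \<open>The order of the summands is the one in which the program pushes monomials onto its
  accumulator.\<close>

fun phase_mons :: "circuit \<Rightarrow> nat \<Rightarrow> nat list list" where
  "phase_mons (Gate Had) d = [[d, Suc d]]"
| "phase_mons (Gate NotX) d = []"
| "phase_mons (Gate Swap) d = []"
| "phase_mons (Gate (CtrlZ k)) d = [[d..<d + Suc k]]"
| "phase_mons (Idle k) d = []"
| "phase_mons (Seq A B) d =
     link_mons (d + nvars B + nvars A) (out_mons A (d + nvars B)) (in_vars B d)
     @ phase_mons A (d + nvars B) @ phase_mons B d"
| "phase_mons (Par A B) d = phase_mons B (d + nvars A) @ phase_mons A d"

lemma length_in_vars [simp]: "matched C \<Longrightarrow> length (in_vars C d) = width C"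
  by (induction C d rule: in_vars.induct) (auto split: if_splits)

lemma length_out_mons [simp]: "matched C \<Longrightarrow> length (out_mons C d) = width C"
  by (induction C d rule: out_mons.induct) auto

lemma list_poly_link_mons:
  "length ps = length ws \<Longrightarrow>
    list_poly (link_mons y ps ws) = (\<Sum>i<length ws. var (y + i) * (list_poly (ps ! i) + var (ws ! i)))"
proof (induction y ps ws rule: link_mons.induct)
  case (1 y p ps w ws)
  then have "list_poly (link_mons (Suc y) ps ws)
    = (\<Sum>i<length ws. var (Suc y + i) * (list_poly (ps ! i) + var (ws ! i)))"
    by simp
  then show ?case
    by (simp add: sum.lessThan_Suc_shift distrib_left add.commute add.left_commute del: sum.lessThan_Suc)
qed simp_all

lemma map_add_upt': "map ((+) c) [i..<j] = [c + i..<c + j]"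
  by (induction j) auto

lemma map_link_mons:
  "map (map ((+) c)) (link_mons y ps ws) = link_mons (c + y) (map (map (map ((+) c))) ps) (map ((+) c) ws)"
  by (induction y ps ws rule: link_mons.induct) auto

text \<open>The three shift laws turn the renaming done by \<open>shift_past\<close> into a change
  of the first variable, so the closed form needs no renaming.\<close>

lemma in_vars_shift: "in_vars C (c + d) = map ((+) c) (in_vars C d)"
  by (induction C arbitrary: d) (simp_all add: map_add_upt' add.assoc del: upt_Suc)

lemma out_mons_shift: "out_mons C (c + d) = map (map (map ((+) c))) (out_mons C d)"
  by (induction C d rule: out_mons.induct)
    (simp_all add: map_add_upt'[symmetric] add.assoc comp_def del: upt_Suc add_Suc_right)

lemma phase_mons_shift: "phase_mons C (c + d) = map (map ((+) c)) (phase_mons C d)"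
  by (induction C d rule: phase_mons.induct)
    (simp_all add: map_add_upt'[symmetric] map_link_mons in_vars_shift[symmetric] out_mons_shift[symmetric] add.assoc
      del: upt_Suc add_Suc_right)

lemma fresh_from_lessThan [simp]: "fresh_from {..<n} = n"
proof (cases n)
  case (Suc k)
  then have "Max {..<n} = k"
    by (intro Max_eqI) auto
  then show ?thesis using Suc by (auto simp: fresh_from_def)
qed (simp add: fresh_from_def)

lemma lessThan_Un_shift: "{..<a::nat} \<union> (+) a ` {..<b} = {..<a + b}"
proof -
  have "(+) a ` {..<b} = {a..<a + b}"
    using image_add_atLeastLessThan[of a 0 b] by (simp add: atLeast0LessThan add.commute)
  then show ?thesis by auto
qed

lemma lessThan_Un_ivl: "{..<a::nat} \<union> {a..<a + b} = {..<a + b}"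
  by auto

definition root_half :: "nat \<Rightarrow> complex"
  where "root_half k = (1 / complex_of_real (sqrt 2)) ^ k"

lemma root_half_0 [simp]: "root_half 0 = 1"
  by (simp add: root_half_def)

lemma root_half_1: "1 / complex_of_real (sqrt 2) = root_half (Suc 0)"
  by (simp add: root_half_def)

lemma root_half_mult [simp]: "root_half i * root_half j = root_half (i + j)"
  by (simp add: root_half_def power_add)

text \<open>The normalisation of a composition over \<open>p\<close> wires is itself a power of the
  base scalar; hence the summand \<open>2 * width B\<close> in \<open>root_exp\<close>.\<close>

lemma root_half_double: "root_half (2 * p) = 1 / 2 ^ p"
proof -
  have "(1 / complex_of_real (sqrt 2)) ^ 2 = 1 / 2"
    by (simp add: power_divide flip: of_real_power)
  then show ?thesis
    unfolding root_half_def power_mult by (simp add: power_divide)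
qed

lemma root_half_divide [simp]: "root_half i / 2 ^ p = root_half (i + 2 * p)"
  unfolding root_half_mult[symmetric] root_half_double by simp

definition explicit :: "circuit \<Rightarrow> path_sum" where
  "explicit C = PathSum (root_half (root_exp C)) {..<nvars C}
     (list_poly (phase_mons C 0)) (map list_poly (out_mons C 0)) (map var (in_vars C 0))"

lemma shift_past_explicit:
  assumes "indets B = {..<c}"
  shows "shift_past B (explicit C) = PathSum (root_half (root_exp C))
    ((+) c ` {..<nvars C}) (list_poly (phase_mons C c)) (map list_poly (out_mons C c)) (map var (in_vars C c))"
  using assms in_vars_shift[of C c 0] out_mons_shift[of C c 0] phase_mons_shift[of C c 0]
  by (simp add: shift_past_def rename_def explicit_def bsubst_list_poly comp_def)

lemma indets_explicit [simp]: "indets (explicit C) = {..<nvars C}"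
  by (simp add: explicit_def)

text \<open>An equality including the names of the variables is required, as rewriting is not closed
  under renaming.\<close>

lemma interp_explicit: "matched C \<Longrightarrow> interp C = explicit C"
proof (induction C)
  case (Gate g)
  show ?case
  proof (cases g)
    case (CtrlZ k)
    have "(\<Prod>i\<le>k. var i) = mon_poly [0..<Suc k]"
      by (simp add: mon_poly_def prod.list_conv_set_nth atLeast0LessThan lessThan_Suc_atMost del: upt_Suc)
    then show ?thesis
      by (simp add: CtrlZ explicit_def comp_def lessThan_Suc_atMost del: upt_Suc)
  qed (auto simp: explicit_def root_half_1)
next
  case (Idle k)
  show ?case by (simp add: explicit_def id_ps_def comp_def)
next
  case (Seq A B)
  then have IH: "interp A = explicit A" "interp B = explicit B" and w: "width A = width B"
    and m: "matched A" "matched B"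
    by auto
  have "list_poly (link_mons (nvars B + nvars A) (out_mons A (nvars B)) (in_vars B 0))
    = (\<Sum>i<width B. var (nvars B + nvars A + i) * (map list_poly (out_mons A (nvars B)) ! i + map var (in_vars B 0) ! i))"
    by (subst list_poly_link_mons) (auto simp: m w intro!: sum.cong)
  then show ?case
    by (simp only: IH compose_def shift_past_explicit[OF indets_explicit] interp.simps Let_def path_sum.sel
          indets_explicit,
        simp only: lessThan_Un_shift fresh_from_lessThan,
        simp add: explicit_def m w,
        simp only: lessThan_Un_ivl)
next
  case (Par A B)
  then show ?case
    by (simp add: tensor_def shift_past_explicit lessThan_Un_shift)
      (simp add: explicit_def add_ac)
qed

text \<open>Composing with \<open>|0...0>\<close> adds one link per input whose source is the zero
  polynomial, spelled as the empty list.\<close>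

definition start_mons :: "circuit \<Rightarrow> nat list list" where
  "start_mons C = link_mons (nvars C) (replicate (width C) []) (in_vars C 0) @ phase_mons C 0"

lemma bconst_0 [simp]: "bconst 0 = 0"
  by (simp add: bconst_def)

lemma interp_ket_explicit:
  assumes "matched C"
  shows "interp C \<circ>\<^sub>P ket (replicate (width C) 0) =
    PathSum (root_half (root_exp C + 2 * width C)) {..<nvars C + width C}
      (list_poly (start_mons C)) (map list_poly (out_mons C 0)) []"
proof -
  have "list_poly (link_mons (nvars C) (replicate (width C) []) (in_vars C 0))
    = (\<Sum>i<width C. var (nvars C + i) * (map (bsubst (\<lambda>v. var (nvars C + v))) (replicate (width C) 0) ! i + map var (in_vars C 0) ! i))"
    by (subst list_poly_link_mons) (auto simp: assms intro!: sum.cong)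
  then show ?thesis
    by (simp add: interp_explicit assms compose_def shift_past_def ket_def rename_def start_mons_def comp_def
          Let_def del: map_replicate,
        simp add: explicit_def assms,
        simp only: lessThan_Un_ivl)
qed

section \<open>Eliminating links\<close>

lemma two_root_half: "2 * root_half (Suc (Suc k)) = root_half k"
  using root_half_divide[of k 1] by (simp del: root_half_divide flip: numeral_2_eq_2)

lemma eval_var_upd: "(\<lambda>v. eval a ((var(y := Q)) v)) = a(y := eval a Q)"
  by auto

lemma Vars_bsubst_upd:
  "Vars (bsubst (var(y := Q)) p) \<subseteq> (Vars p - {y}) \<union> (if y \<in> Vars p then Vars Q else {})"
  using Vars_bsubst[of "var(y := Q)" p] by (fastforce split: if_splits)

lemma card_Vars_mono: "Vars p \<subseteq> Vars q \<Longrightarrow> card (Vars q) \<le> 1 \<Longrightarrow> card (Vars p) \<le> 1"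
  by (meson card_mono finite_Vars le_trans)

text \<open>(HH) substitutes for \<open>y\<close> but leaves \<open>y\<close> in the variable set;
  as it then occurs nowhere, (Elim) applies. Two variables disappear while the scalar doubles, and
  doubling lowers the exponent of \<open>1/\<surd>2\<close> by two.\<close>

lemma hh_elim:
  assumes valid: "valid_path_sum (PathSum (root_half (card V)) V (var x * (var y + Q) + R) Os Is)"
    and xy: "x \<in> V" "y \<in> V" "x \<noteq> y"
    and x: "\<forall>p\<in>{Q, R} \<union> set Os \<union> set Is. x \<notin> Vars p"
    and Q: "y \<notin> Vars Q" "card (Vars Q) \<le> 1" "Vars Q \<subseteq> V"
    and R: "Vars R \<subseteq> V"
  defines "B \<equiv> PathSum (root_half (card (V - {x, y}))) (V - {x, y}) (bsubst (var(y := Q)) R)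
      (map (bsubst (var(y := Q))) Os) (map (bsubst (var(y := Q))) Is)"
  shows "rewrite\<^sup>*\<^sup>* (PathSum (root_half (card V)) V (var x * (var y + Q) + R) Os Is) B"
    and "valid_path_sum B"
proof -
  have V: "finite V" and OI: "\<forall>p\<in>set Os \<union> set Is. Vars p \<subseteq> V"
    using valid by (auto simp: valid_path_sum_def)
  have sub: "Vars (bsubst (var(y := Q)) p) \<subseteq> V - {x, y}" if "p \<in> {R} \<union> set Os \<union> set Is" for p
  proof -
    have "Vars p \<subseteq> V - {x}" using that x OI R by auto
    moreover have "Vars Q \<subseteq> V - {x, y}" using x Q by auto
    moreover have "Vars (bsubst (var(y := Q)) p) \<subseteq> (Vars p - {y}) \<union> Vars Q"
      using Vars_bsubst_upd[of y Q p] by (auto split: if_splits)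
    ultimately show ?thesis by blast
  qed
  show "valid_path_sum B"
    using V sub by (auto simp: valid_path_sum_def B_def)
  let ?A = "PathSum (root_half (card V)) (V - {x}) (bsubst (var(y := Q)) R)
      (map (bsubst (var(y := Q))) Os) (map (bsubst (var(y := Q))) Is)"
  have "rewrite (PathSum (root_half (card V)) V (var x * (var y + Q) + R) Os Is) ?A"
    using assms by (intro rewrite.hh) auto
  moreover have "rewrite ?A (PathSum (2 * root_half (card V)) (V - {x} - {y}) (bsubst (var(y := Q)) R)
      (map (bsubst (var(y := Q))) Os) (map (bsubst (var(y := Q))) Is))"
  proof (rule rewrite.elim)
    show "valid_path_sum ?A"
      using V sub by (force simp: valid_path_sum_def)
  qed (use sub xy in auto)
  moreover have "card V = Suc (Suc (card (V - {x, y})))"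
  proof -
    have "card {x, y} = 2" using xy by simp
    then show ?thesis using xy V card_Diff_subset[of "{x, y}" V] card_mono[of V "{x, y}"] by simp
  qed
  then have "2 * root_half (card V) = root_half (card (V - {x, y}))"
    by (simp only: two_root_half)
  moreover have "V - {x} - {y} = V - {x, y}" by auto
  ultimately show "rewrite\<^sup>*\<^sup>* (PathSum (root_half (card V)) V (var x * (var y + Q) + R) Os Is) B"
    unfolding B_def by (metis (no_types, lifting) converse_rtranclp_into_rtranclp rtranclp.rtrancl_refl)
qed

text \<open>The link \<open>(y, p, w)\<close> stands for the term \<open>y (w + p)\<close> of a phase.\<close>

type_synonym link = "nat \<times> bpoly \<times> nat"

abbreviation link_dual :: "link \<Rightarrow> nat" where "link_dual l \<equiv> fst l"
abbreviation link_src :: "link \<Rightarrow> bpoly" where "link_src l \<equiv> fst (snd l)"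
abbreviation link_tgt :: "link \<Rightarrow> nat" where "link_tgt l \<equiv> snd (snd l)"

definition links_poly :: "link list \<Rightarrow> bpoly"
  where "links_poly L = (\<Sum>l\<leftarrow>L. var (link_dual l) * (var (link_tgt l) + link_src l))"

lemma links_poly_simps [simp]: "links_poly [] = 0"
  "links_poly ((y, p, w) # L) = var y * (var w + p) + links_poly L"
  "links_poly (L @ L') = links_poly L + links_poly L'"
  by (simp_all add: links_poly_def)

lemma Vars_links_poly:
  "Vars (links_poly L) \<subseteq> (\<Union>l\<in>set L. {link_dual l, link_tgt l} \<union> Vars (link_src l))"
proof (induction L)
  case (Cons l L)
  obtain y p w where l: "l = (y, p, w)" by (cases l)
  have "Vars (var y * (var w + p)) \<subseteq> {y, w} \<union> Vars p"
    using Vars_mult[of "var y" "var w + p"] Vars_add[of "var w" p] by auto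
  then show ?case
    using Cons.IH Vars_add[of "var y * (var w + p)" "links_poly L"] by (auto simp: l)
qed simp

lemma eval_links_poly:
  "eval a (links_poly L) = (\<Sum>l\<leftarrow>L. a (link_dual l) * (a (link_tgt l) + eval a (link_src l)))"
  by (induction L) (auto simp: links_poly_def)

text \<open>The rank \<open>\<rho>\<close> decreases from sources to targets, so substituting a source for its target keeps every source free
  of its own target.\<close>

definition elim_order :: "(nat \<Rightarrow> nat) \<Rightarrow> nat set \<Rightarrow> link list \<Rightarrow> bool" where
  "elim_order \<rho> V L \<longleftrightarrow>
    distinct (map link_dual L @ map link_tgt L) \<and>
    set (map link_dual L @ map link_tgt L) \<subseteq> V \<and>
    (\<forall>l\<in>set L. Vars (link_src l) \<subseteq> V - set (map link_dual L) \<and> card (Vars (link_src l)) \<le> 1 \<and>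
      (\<forall>v\<in>Vars (link_src l). \<rho> (link_tgt l) < \<rho> v))"

text \<open>The assignment \<open>\<sigma> a\<close> extends \<open>a\<close> by the values that the
  links force on their targets. The induction is on the length, because eliminating the first link
  changes the sources of the others, so that the list left over is not the tail.\<close>

lemma elim_links:
  assumes "valid_path_sum (PathSum (root_half (card V)) V (links_poly L + R) Os [])"
    and "elim_order \<rho> V L"
    and "Vars R \<subseteq> V - set (map link_dual L)"
    and "\<forall>p\<in>set Os. Vars p \<inter> set (map link_dual L) = {}"
  shows "\<exists>\<sigma> Q Os'. let V' = V - set (map link_dual L @ map link_tgt L);
        A = PathSum (root_half (card V')) V' Q Os' [] in
      rewrite\<^sup>*\<^sup>* (PathSum (root_half (card V)) V (links_poly L + R) Os []) A \<and> valid_path_sum A \<and>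
      (\<forall>a. eval a Q = eval (\<sigma> a) R \<and> map (eval a) Os' = map (eval (\<sigma> a)) Os \<and>
        (\<forall>l\<in>set L. \<sigma> a (link_tgt l) = eval (\<sigma> a) (link_src l)) \<and>
        (\<forall>v. v \<notin> set (map link_tgt L) \<longrightarrow> \<sigma> a v = a v))"
  using assms
proof (induction L arbitrary: V R Os rule: measure_induct_rule[of length])
  case (less K)
  show ?case
  proof (cases K)
  case Nil
  then show ?thesis
    using less.prems by (intro exI[of _ "\<lambda>a. a"] exI[of _ R] exI[of _ Os]) (simp add: Let_def)
next
  case (Cons l L)
  note prems = less.prems[unfolded Cons]
  obtain y p w where l: "l = (y, p, w)" by (cases l)
  define \<tau> where "\<tau> = var(w := p)"
  \<comment> \<open>Only sources are affected: \<open>w\<close> differs from all duals and from the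
    other targets.\<close>
  define L' where "L' = map (\<lambda>(y', p', w'). (y', bsubst \<tau> p', w')) L"
  define V1 where "V1 = V - {y, w}"
  have dual [simp]: "map link_dual L' = map link_dual L" and tgt [simp]: "map link_tgt L' = map link_tgt L"
    by (auto simp: L'_def)
  have ord: "distinct (map link_dual L @ map link_tgt L)"
    "y \<noteq> w" "{y, w} \<inter> set (map link_dual L @ map link_tgt L) = {}" "{y, w} \<subseteq> V"
    "set (map link_dual L @ map link_tgt L) \<subseteq> V"
    and p: "Vars p \<subseteq> V - insert y (set (map link_dual L))" "card (Vars p) \<le> 1"
    "\<And>v. v \<in> Vars p \<Longrightarrow> \<rho> w < \<rho> v"
    and src: "\<And>l. l \<in> set L \<Longrightarrow> Vars (link_src l) \<subseteq> V - insert y (set (map link_dual L))"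
    "\<And>l. l \<in> set L \<Longrightarrow> card (Vars (link_src l)) \<le> 1"
    "\<And>l v. l \<in> set L \<Longrightarrow> v \<in> Vars (link_src l) \<Longrightarrow> \<rho> (link_tgt l) < \<rho> v"
    using prems(2) by (auto simp: elim_order_def l)
  have w: "w \<notin> Vars p" using p(3) by blast
  have phase: "links_poly (l # L) + R = var y * (var w + p) + (links_poly L + R)"
    by (simp add: l add.assoc)
  have "Vars (links_poly L) \<subseteq> V - {y}"
  proof -
    have "{link_dual k, link_tgt k} \<union> Vars (link_src k) \<subseteq> V - {y}" if "k \<in> set L" for k
    proof -
      have "link_dual k \<in> V - {y}" "link_tgt k \<in> V - {y}"
        using ord(3,5) that by auto
      then show ?thesis using src(1)[OF that] by blast
    qed
    then show ?thesis using Vars_links_poly[of L] by blast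
  qed
  then have R1: "Vars (links_poly L + R) \<subseteq> V - {y}"
    using Vars_add[of "links_poly L" R] prems(3) by (auto simp: l)
  have upd: "(\<lambda>v. eval a (\<tau> v)) = a(w := eval a p)" for a
    unfolding \<tau>_def by (rule eval_var_upd)
  have "eval a (bsubst \<tau> (links_poly L)) = eval a (links_poly L')" for a
    unfolding L'_def eval_bsubst upd eval_links_poly using ord(2,3)
    by (auto simp: comp_def split_beta upd intro!: arg_cong[of _ _ sum_list])
  then have phase': "bsubst \<tau> (links_poly L + R) = links_poly L' + bsubst \<tau> R"
    by (simp add: bsubst_add eval_inject)
  let ?B = "PathSum (root_half (card V1)) V1 (links_poly L' + bsubst \<tau> R) (map (bsubst \<tau>) Os) []"
  have "\<forall>q\<in>{p, links_poly L + R} \<union> set Os \<union> set []. y \<notin> Vars q"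
    using p(1) R1 prems(4) by (auto simp: l)
  moreover have "y \<in> V" "w \<in> V" "Vars p \<subseteq> V" "Vars (links_poly L + R) \<subseteq> V"
    using ord(4) p(1) R1 by blast+
  ultimately have
    step: "rewrite\<^sup>*\<^sup>* (PathSum (root_half (card V)) V (links_poly (l # L) + R) Os []) ?B"
    and valid: "valid_path_sum ?B"
    using hh_elim[OF prems(1)[unfolded phase] _ _ ord(2) _ w p(2)]
    unfolding phase \<tau>_def[symmetric] phase' V1_def[symmetric] list.map by (simp_all only:)
  have sub: "Vars (bsubst \<tau> q) \<subseteq> (Vars q - {w}) \<union> (if w \<in> Vars q then Vars p else {})" for q
    unfolding \<tau>_def by (rule Vars_bsubst_upd)
  have a1: "elim_order \<rho> V1 L'"
  proof -
    have "Vars (bsubst \<tau> q) \<subseteq> V1 - set (map link_dual L) \<and> card (Vars (bsubst \<tau> q)) \<le> 1 \<and>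
        (\<forall>v\<in>Vars (bsubst \<tau> q). \<rho> z < \<rho> v)" if "(x, q, z) \<in> set L" for x q z
    proof (cases "w \<in> Vars q")
      case True
      \<comment> \<open>A source has at most one variable. If that is \<open>w\<close>, the
        substitution replaces all of it, so the bound 1 survives.\<close>
      then have "Vars q = {w}"
        using src(2)[OF that] card_le_Suc0_iff_eq[of "Vars q"] by auto
      then have "Vars (bsubst \<tau> q) \<subseteq> Vars p" using sub[of q] by auto
      moreover from this have "card (Vars (bsubst \<tau> q)) \<le> 1"
        using p(2) card_Vars_mono by blast
      moreover have "\<rho> z < \<rho> w" using src(3)[OF that] True by simp
      moreover have "Vars p \<subseteq> V1 - set (map link_dual L)"
        using p(1) w unfolding V1_def by blast
      moreover have "\<rho> z < \<rho> v" if "v \<in> Vars p" for v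
        using p(3)[OF that] \<open>\<rho> z < \<rho> w\<close> by simp
      ultimately show ?thesis by blast
    next
      case False
      then have "Vars (bsubst \<tau> q) \<subseteq> Vars q" using sub[of q] by auto
      moreover from this have "card (Vars (bsubst \<tau> q)) \<le> 1"
        using src(2)[OF that] card_Vars_mono[of _ q] by simp
      moreover have "Vars q \<subseteq> V1 - set (map link_dual L)"
        using src(1)[OF that] False unfolding V1_def by auto
      moreover have "\<And>v. v \<in> Vars q \<Longrightarrow> \<rho> z < \<rho> v"
        using src(3)[OF that] by simp
      ultimately show ?thesis by blast
    qed
    note src' = this
    have "\<forall>l\<in>set L'. Vars (link_src l) \<subseteq> V1 - set (map link_dual L) \<and> card (Vars (link_src l)) \<le> 1 \<and>
        (\<forall>v\<in>Vars (link_src l). \<rho> (link_tgt l) < \<rho> v)"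
    proof
      fix l' assume "l' \<in> set L'"
      then obtain x q z where "(x, q, z) \<in> set L" "l' = (x, bsubst \<tau> q, z)"
        by (auto simp: L'_def)
      with src'[of x q z] show "Vars (link_src l') \<subseteq> V1 - set (map link_dual L) \<and> card (Vars (link_src l')) \<le> 1 \<and>
          (\<forall>v\<in>Vars (link_src l'). \<rho> (link_tgt l') < \<rho> v)"
        by simp
    qed
    moreover have "set (map link_dual L @ map link_tgt L) \<subseteq> V1"
      using ord(3,5) unfolding V1_def by blast
    ultimately show ?thesis
      using ord(1) unfolding elim_order_def dual tgt by simp
  qed
  have a2: "Vars (bsubst \<tau> R) \<subseteq> V1 - set (map link_dual L')"
    using sub[of R] prems(3) p(1) w by (auto simp: l V1_def split: if_splits)
  have a3: "\<forall>q\<in>set (map (bsubst \<tau>) Os). Vars q \<inter> set (map link_dual L') = {}"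
  proof -
    have "Vars (bsubst \<tau> q) \<inter> set (map link_dual L) = {}" if "q \<in> set Os" for q
    proof -
      have "Vars q \<inter> set (map link_dual L) = {}" "Vars p \<inter> set (map link_dual L) = {}"
        using prems(4) that p(1) by (auto simp: l)
      moreover have "Vars (bsubst \<tau> q) \<subseteq> Vars q \<union> Vars p"
        using sub[of q] by (auto split: if_splits)
      ultimately show ?thesis by blast
    qed
    then show ?thesis by simp
  qed
  have len: "length L' < length K"
    by (simp add: L'_def Cons)
  obtain \<sigma> Q Os' where IH:
    "rewrite\<^sup>*\<^sup>* ?B (PathSum (root_half (card (V1 - set (map link_dual L @ map link_tgt L))))
        (V1 - set (map link_dual L @ map link_tgt L)) Q Os' [])"
    "valid_path_sum (PathSum (root_half (card (V1 - set (map link_dual L @ map link_tgt L))))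
        (V1 - set (map link_dual L @ map link_tgt L)) Q Os' [])"
    and eq: "\<And>a. eval a Q = eval (\<sigma> a) (bsubst \<tau> R)"
    "\<And>a. map (eval a) Os' = map (eval (\<sigma> a)) (map (bsubst \<tau>) Os)"
    "\<And>a l. l \<in> set L' \<Longrightarrow> \<sigma> a (link_tgt l) = eval (\<sigma> a) (link_src l)"
    "\<And>a v. v \<notin> set (map link_tgt L) \<Longrightarrow> \<sigma> a v = a v"
    using less.IH[OF len valid a1 a2 a3] unfolding Let_def dual tgt by blast
  \<comment> \<open>The value of \<open>w\<close> is read off last, since \<open>p\<close> may
    contain targets of the remaining links.\<close>
  define \<sigma>' where "\<sigma>' a = (\<sigma> a)(w := eval (\<sigma> a) p)" for a
  have V': "V1 - set (map link_dual L @ map link_tgt L) = V - set (map link_dual (l # L) @ map link_tgt (l # L))"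
    by (auto simp: V1_def l)
  have "\<sigma>' a (link_tgt k) = eval (\<sigma>' a) (link_src k)" if k: "k \<in> set (l # L)" for a k
  proof (cases "k \<in> set L")
    case True
    then have "(link_dual k, bsubst \<tau> (link_src k), link_tgt k) \<in> set L'"
      unfolding L'_def set_map by (rule rev_image_eqI) (simp add: split_beta)
    from eq(3)[OF this, of a] have "\<sigma> a (link_tgt k) = eval (\<sigma>' a) (link_src k)"
      by (simp add: upd \<sigma>'_def)
    moreover have "link_tgt k \<noteq> w" using ord(3) True by auto
    ultimately show ?thesis by (simp add: \<sigma>'_def)
  next
    case False
    then have "k = (y, p, w)" using k l by simp
    moreover have "eval (\<sigma>' a) p = eval (\<sigma> a) p"
      by (rule eval_cong) (use w in \<open>auto simp: \<sigma>'_def\<close>)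
    ultimately show ?thesis by (simp add: \<sigma>'_def)
  qed
  moreover have "eval a Q = eval (\<sigma>' a) R" "map (eval a) Os' = map (eval (\<sigma>' a)) Os" for a
    using eq(1,2) by (auto simp: upd \<sigma>'_def)
  moreover have "\<sigma>' a v = a v" if "v \<notin> set (map link_tgt (l # L))" for a v
    using eq(4)[of v a] that by (auto simp: \<sigma>'_def l)
  ultimately show ?thesis
    using IH step unfolding V' Let_def Cons
    by (intro exI[of _ \<sigma>'] exI[of _ Q] exI[of _ Os']) (auto intro: rtranclp_trans)
  qed
qed

text \<open>The remainder \<open>r\<close> is only given as a function; the polynomial for it arises by setting the
  duals to zero in the phase.\<close>

lemma elim_links_eval:
  assumes "valid_path_sum (PathSum (root_half (card V)) V P Os [])"
    and "elim_order \<rho> V L"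
    and P: "\<And>a. eval a P = eval a (links_poly L) + r a"
    and r: "\<And>a b. (\<And>v. v \<notin> set (map link_dual L) \<Longrightarrow> a v = b v) \<Longrightarrow> r a = r b"
    and Os: "\<forall>p\<in>set Os. Vars p \<inter> set (map link_dual L) = {}"
    and V': "V' = V - set (map link_dual L @ map link_tgt L)"
  obtains \<sigma> Q Os' where
    "rewrite\<^sup>*\<^sup>* (PathSum (root_half (card V)) V P Os []) (PathSum (root_half (card V')) V' Q Os' [])"
    "valid_path_sum (PathSum (root_half (card V')) V' Q Os' [])"
    "\<And>a. eval a Q = r (\<sigma> a)"
    "\<And>a. map (eval a) Os' = map (eval (\<sigma> a)) Os"
    "\<And>a l. l \<in> set L \<Longrightarrow> \<sigma> a (link_tgt l) = eval (\<sigma> a) (link_src l)"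
    "\<And>a v. v \<notin> set (map link_tgt L) \<Longrightarrow> \<sigma> a v = a v"
proof -
  let ?z = "\<lambda>v. if v \<in> set (map link_dual L) then 0 else var v"
  define R where "R = bsubst ?z P"
  have R: "eval a R = r a" for a
  proof -
    let ?a = "\<lambda>v. eval a (?z v)"
    have "(\<Sum>l\<leftarrow>L. ?a (link_dual l) * (?a (link_tgt l) + eval ?a (link_src l))) = (\<Sum>l\<leftarrow>L. 0)"
      by (intro arg_cong[of _ _ sum_list] map_cong) auto
    then have "eval ?a P = r ?a"
      by (simp add: P eval_links_poly)
    also have "r ?a = r a"
      by (rule r) auto
    finally show ?thesis by (simp add: R_def)
  qed
  then have P': "P = links_poly L + R"
    by (intro eval_inject) (simp add: P)
  have "Vars R \<subseteq> Vars P - set (map link_dual L)"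
    unfolding R_def using Vars_bsubst[of ?z P] by (fastforce split: if_splits)
  moreover have "Vars P \<subseteq> V" using assms(1) by (simp add: valid_path_sum_def)
  ultimately have "Vars R \<subseteq> V - set (map link_dual L)" by blast
  from elim_links[of V L R Os \<rho>, OF _ assms(2) this Os] assms(1)
  show thesis
    unfolding Let_def P'[symmetric] V'[symmetric] R using that by blast
qed

section \<open>Wires and gates\<close>

text \<open>By \<open>mset_vars\<close> these are the variables that are neither inputs nor duals
  nor targets of links, so they survive the elimination. They are listed in the order of
  execution.\<close>

fun had_vars :: "circuit \<Rightarrow> nat \<Rightarrow> nat list" where
  "had_vars (Gate g) d = (if g = Had then [Suc d] else [])"
| "had_vars (Idle k) d = []"
| "had_vars (Seq A B) d = had_vars A (d + nvars B) @ had_vars B d"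
| "had_vars (Par A B) d = had_vars A d @ had_vars B (d + nvars A)"

definition zip_links :: "nat \<Rightarrow> bpoly list \<Rightarrow> nat list \<Rightarrow> link list"
  where "zip_links y ps ws = zip [y..<y + length ws] (zip ps ws)"

text \<open>The part of the phase that stems from compositions, kept apart from the gate phases so
  that \<open>elim_links\<close> can act on it.\<close>

fun links :: "circuit \<Rightarrow> nat \<Rightarrow> link list" where
  "links (Gate g) d = []"
| "links (Idle k) d = []"
| "links (Seq A B) d =
     zip_links (d + nvars B + nvars A) (map list_poly (out_mons A (d + nvars B))) (in_vars B d)
     @ links A (d + nvars B) @ links B d"
| "links (Par A B) d = links A d @ links B (d + nvars A)"

fun gate_phase :: "circuit \<Rightarrow> nat \<Rightarrow> bpoly" where
  "gate_phase (Gate Had) d = var d * var (Suc d)"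
| "gate_phase (Gate (CtrlZ k)) d = mon_poly [d..<d + Suc k]"
| "gate_phase (Seq A B) d = gate_phase A (d + nvars B) + gate_phase B d"
| "gate_phase (Par A B) d = gate_phase A d + gate_phase B (d + nvars A)"
| "gate_phase _ d = 0"

lemma zip_links_simps [simp]:
  "zip_links y [] ws = []" "zip_links y ps [] = []"
  "zip_links y (p # ps) (w # ws) = (y, p, w) # zip_links (Suc y) ps ws"
  by (simp_all add: zip_links_def upt_conv_Cons del: upt_Suc)

lemma list_poly_link_mons_links:
  "list_poly (link_mons y ps ws) = links_poly (zip_links y (map list_poly ps) ws)"
  by (induction y ps ws rule: link_mons.induct) (simp_all add: distrib_left)

lemma phase_mons_links: "list_poly (phase_mons C d) = links_poly (links C d) + gate_phase C d"
proof (induction C d rule: phase_mons.induct)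
  case (6 A B d)
  then show ?case by (simp add: list_poly_link_mons_links add_ac)
next
  case (7 A B d)
  then show ?case by (simp add: add_ac)
qed simp_all

lemma zip_links_dual: "length ps = length ws \<Longrightarrow> map link_dual (zip_links y ps ws) = [y..<y + length ws]"
  and zip_links_tgt: "length ps = length ws \<Longrightarrow> map link_tgt (zip_links y ps ws) = ws"
proof (induction ps ws arbitrary: y rule: list_induct2)
  case (Cons p ps w ws)
  { case 1 show ?case using Cons(2)[of "Suc y"] by (simp add: upt_conv_Cons del: upt_Suc) }
  { case 2 show ?case using Cons(3)[of "Suc y"] by simp }
qed simp_all

lemma set_zip_linksD: "l \<in> set (zip_links y ps ws) \<Longrightarrow> link_src l \<in> set ps \<and> link_tgt l \<in> set ws"
  by (auto simp: zip_links_def set_zip)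

section \<open>Disjointness and order of the variables of a circuit\<close>

lemma mset_set_ivl_add:
  "mset_set {i..<i + (j + k)} = mset_set {i..<i + j} + mset_set {i + j..<i + (j + k)}" for i :: nat
proof -
  have "{i..<i + (j + k)} = {i..<i + j} \<union> {i + j..<i + (j + k)}" by auto
  then show ?thesis by (simp add: mset_set_Union)
qed

text \<open>One multiset equation yields both disjointness and exhaustion. In a composition the
  inputs of the later circuit turn into targets, and the duals form a fresh interval at the
  end.\<close>

lemma mset_vars:
  "matched C \<Longrightarrow> mset (map link_dual (links C d)) + mset (map link_tgt (links C d)) +
     mset (in_vars C d) + mset (had_vars C d) = mset_set {d..<d + nvars C}"
proof (induction C arbitrary: d)
  case (Gate g)
  show ?case
    unfolding mset_upt[symmetric] by (cases g) (auto simp del: mset_upt simp: add_mset_commute)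
next
  case (Seq A B)
  have "mset_set {d..<d + nvars (Seq A B)} = mset_set {d..<d + nvars B}
     + mset_set {d + nvars B..<d + nvars B + nvars A}
     + mset_set {d + nvars B + nvars A..<d + nvars B + nvars A + width B}"
    using mset_set_ivl_add[of d "nvars B + nvars A" "width B"] mset_set_ivl_add[of d "nvars B" "nvars A"]
    by (simp add: add.assoc)
  moreover have "mset_set {d + nvars B..<d + nvars B + nvars A} = mset (map link_dual (links A (d + nvars B))) + mset (map link_tgt (links A (d + nvars B))) +
     mset (in_vars A (d + nvars B)) + mset (had_vars A (d + nvars B))"
    "mset_set {d..<d + nvars B} = mset (map link_dual (links B d)) + mset (map link_tgt (links B d)) +
     mset (in_vars B d) + mset (had_vars B d)"
    using Seq.prems by (simp_all only: Seq.IH matched.simps simp_thms)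
  ultimately show ?case
    using Seq.prems
    by (simp only: links.simps map_append mset_append zip_links_dual zip_links_tgt in_vars.simps had_vars.simps
        length_map length_in_vars length_out_mons mset_upt matched.simps union_assoc) (simp only: union_ac)
next
  case (Par A B)
  have "mset_set {d..<d + nvars (Par A B)} = mset_set {d..<d + nvars A}
     + mset_set {d + nvars A..<d + nvars A + nvars B}"
    using mset_set_ivl_add[of d "nvars A" "nvars B"] by (simp add: add.assoc)
  moreover have "mset_set {d..<d + nvars A} = mset (map link_dual (links A d)) + mset (map link_tgt (links A d)) +
     mset (in_vars A d) + mset (had_vars A d)"
    "mset_set {d + nvars A..<d + nvars A + nvars B} = mset (map link_dual (links B (d + nvars A))) + mset (map link_tgt (links B (d + nvars A))) +
     mset (in_vars B (d + nvars A)) + mset (had_vars B (d + nvars A))"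
    using Par.prems by (simp_all only: Par.IH matched.simps simp_thms)
  ultimately show ?case
    by (simp only: links.simps map_append mset_append in_vars.simps had_vars.simps) (simp only: union_ac)
qed simp_all

lemma distinct_vars:
  assumes "matched C"
  shows "distinct (map link_dual (links C d) @ map link_tgt (links C d) @ in_vars C d @ had_vars C d)"
    and "set (map link_dual (links C d)) \<union> set (map link_tgt (links C d)) \<union>
      set (in_vars C d) \<union> set (had_vars C d) = {d..<d + nvars C}"
proof -
  let ?xs = "map link_dual (links C d) @ map link_tgt (links C d) @ in_vars C d @ had_vars C d"
  have *: "mset ?xs = mset [d..<d + nvars C]"
    using mset_vars[OF assms, of d] by (simp add: add_ac)
  then show "distinct ?xs"
    using mset_eq_imp_distinct_iff[OF *] by (simp only: distinct_upt)
  show "set (map link_dual (links C d)) \<union> set (map link_tgt (links C d)) \<union>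
      set (in_vars C d) \<union> set (had_vars C d) = {d..<d + nvars C}"
    using mset_eq_setD[OF *] by (simp add: Un_assoc)
qed

lemma notin_if_subset_ivl: "X \<subseteq> {i..<j} \<Longrightarrow> v < i \<or> j \<le> v \<Longrightarrow> v \<notin> X" for v :: nat
  by auto

text \<open>The only shapes of a gate output: a fresh variable or its complement. This bounds the
  number of variables for (HH).\<close>

definition affine :: "nat list list \<Rightarrow> nat \<Rightarrow> bool"
  where "affine p v \<longleftrightarrow> p = [[v]] \<or> p = [[v], []]"

lemma Vars_affine: "affine p v \<Longrightarrow> Vars (list_poly p) = {v}"
proof -
  have "Vars (var v + 1) = {v}"
  proof
    show "Vars (var v + 1) \<subseteq> {v}" using Vars_add[of "var v" 1] by simp
    show "{v} \<subseteq> Vars (var v + 1)"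
    proof (rule ccontr)
      assume "\<not> {v} \<subseteq> Vars (var v + 1)"
      then have "eval ((\<lambda>_. 0)(v := 1)) (var v + 1) = eval (\<lambda>_. 0) (var v + 1)"
        by (intro eval_cong) auto
      then show False by simp
    qed
  qed
  moreover assume "affine p v"
  ultimately show ?thesis
    unfolding affine_def by (elim disjE) simp_all
qed

lemma out_mons_affine:
  "matched C \<Longrightarrow> p \<in> set (out_mons C d) \<Longrightarrow>
    \<exists>v. affine p v \<and> v \<in> {d..<d + nvars C} - link_dual ` set (links C d)"
proof (induction C arbitrary: d)
  case (Gate g)
  then show ?case by (cases g) (auto simp: affine_def)
next
  case (Idle k)
  then show ?case by (auto simp: affine_def)
next
  case (Seq A B)
  then have "matched A" "matched B" "width A = width B" "p \<in> set (out_mons B d)" by auto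
  then obtain v where v: "affine p v" "v \<in> {d..<d + nvars B} - link_dual ` set (links B d)"
    using Seq.IH(2)[of d] by blast
  have duals: "link_dual ` set (links A (d + nvars B)) \<subseteq> {d + nvars B..<d + nvars B + nvars A}"
    "link_dual ` set (zip_links (d + nvars B + nvars A) (map list_poly (out_mons A (d + nvars B))) (in_vars B d))
     \<subseteq> {d + nvars B + nvars A..<d + nvars B + nvars A + width B}"
    using distinct_vars(2)[of A "d + nvars B"] Seq.prems
      zip_links_dual[of "map list_poly (out_mons A (d + nvars B))" "in_vars B d" "d + nvars B + nvars A"]
    unfolding set_map[symmetric] by (simp_all del: set_map) blast
  have "v \<notin> link_dual ` set (links (Seq A B) d)"
    using notin_if_subset_ivl[OF duals(1), of v] notin_if_subset_ivl[OF duals(2), of v] v(2)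
    by (simp add: image_Un)
  then show ?case using v by (intro exI[of _ v]) simp
next
  case (Par A B)
  have duals: "link_dual ` set (links A d) \<subseteq> {d..<d + nvars A}"
    "link_dual ` set (links B (d + nvars A)) \<subseteq> {d + nvars A..<d + nvars A + nvars B}"
    using distinct_vars(2)[of A d] distinct_vars(2)[of B "d + nvars A"] Par.prems by auto
  from Par.prems consider "p \<in> set (out_mons A d)" | "p \<in> set (out_mons B (d + nvars A))" by auto
  then show ?case
  proof cases
    case 1
    with Par.IH(1)[of d] Par.prems obtain v where v: "affine p v" "v \<in> {d..<d + nvars A} - link_dual ` set (links A d)"
      by auto
    have "v \<notin> link_dual ` set (links (Par A B) d)"
      using notin_if_subset_ivl[OF duals(2), of v] v(2) by (simp add: image_Un)
    then show ?thesis using v by (intro exI[of _ v]) simp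
  next
    case 2
    with Par.IH(2)[of "d + nvars A"] Par.prems obtain v where v: "affine p v"
      "v \<in> {d + nvars A..<d + nvars A + nvars B} - link_dual ` set (links B (d + nvars A))"
      by auto
    have "v \<notin> link_dual ` set (links (Par A B) d)"
      using notin_if_subset_ivl[OF duals(1), of v] v(2) by (simp add: image_Un)
    then show ?thesis using v by (intro exI[of _ v]) simp
  qed
qed

text \<open>In \<open>Seq A B\<close> the variables of \<open>B\<close> are numbered before those of
  \<open>A\<close>, so a new link leads from a source in the upper interval to a target in the lower
  one. Thus the number of a variable can serve as its rank.\<close>

lemma links_ordered:
  "matched C \<Longrightarrow> l \<in> set (links C d) \<Longrightarrow>
    \<exists>v. Vars (link_src l) = {v} \<and> v \<in> {d..<d + nvars C} - link_dual ` set (links C d) \<and> link_tgt l < v"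
proof (induction C arbitrary: d)
  case (Seq A B)
  let ?new = "zip_links (d + nvars B + nvars A) (map list_poly (out_mons A (d + nvars B))) (in_vars B d)"
  have m: "matched A" "matched B" "width A = width B" using Seq.prems by auto
  have duals: "link_dual ` set (links A (d + nvars B)) \<subseteq> {d + nvars B..<d + nvars B + nvars A}"
    "link_dual ` set (links B d) \<subseteq> {d..<d + nvars B}"
    "link_dual ` set ?new \<subseteq> {d + nvars B + nvars A..<d + nvars B + nvars A + width B}"
    and ins: "set (in_vars B d) \<subseteq> {d..<d + nvars B}"
    using distinct_vars(2)[of A "d + nvars B"] distinct_vars(2)[of B d] m
      zip_links_dual[of "map list_poly (out_mons A (d + nvars B))" "in_vars B d" "d + nvars B + nvars A"]
    unfolding set_map[symmetric] by (simp_all del: set_map) blast+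
  from Seq.prems consider "l \<in> set ?new" | "l \<in> set (links A (d + nvars B))" | "l \<in> set (links B d)"
    by auto
  then show ?case
  proof cases
    case 1
    then have "link_src l \<in> set (map list_poly (out_mons A (d + nvars B))) \<and> link_tgt l \<in> set (in_vars B d)"
      by (rule set_zip_linksD)
    then obtain p where p: "p \<in> set (out_mons A (d + nvars B))" "link_src l = list_poly p"
      and t: "link_tgt l \<in> set (in_vars B d)"
      by auto
    from out_mons_affine[OF m(1) p(1)] obtain v where v: "affine p v"
      "v \<in> {d + nvars B..<d + nvars B + nvars A} - link_dual ` set (links A (d + nvars B))" by blast
    have "v \<notin> link_dual ` set (links (Seq A B) d)"
      using notin_if_subset_ivl[OF duals(2), of v] notin_if_subset_ivl[OF duals(3), of v] v(2)
      by (simp add: image_Un)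
    moreover have "link_tgt l < d + nvars B" using ins t by auto
    ultimately show ?thesis using v p(2) by (intro exI[of _ v]) (simp add: Vars_affine)
  next
    case 2
    with Seq.IH(1)[OF m(1)] obtain v where v: "Vars (link_src l) = {v}" "link_tgt l < v"
      "v \<in> {d + nvars B..<d + nvars B + nvars A} - link_dual ` set (links A (d + nvars B))" by blast
    have "v \<notin> link_dual ` set (links (Seq A B) d)"
      using notin_if_subset_ivl[OF duals(2), of v] notin_if_subset_ivl[OF duals(3), of v] v(3)
      by (simp add: image_Un)
    then show ?thesis using v by (intro exI[of _ v]) simp
  next
    case 3
    with Seq.IH(2)[OF m(2)] obtain v where v: "Vars (link_src l) = {v}" "link_tgt l < v"
      "v \<in> {d..<d + nvars B} - link_dual ` set (links B d)" by blast
    have "v \<notin> link_dual ` set (links (Seq A B) d)"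
      using notin_if_subset_ivl[OF duals(1), of v] notin_if_subset_ivl[OF duals(3), of v] v(3)
      by (simp add: image_Un)
    then show ?thesis using v by (intro exI[of _ v]) simp
  qed
next
  case (Par A B)
  have m: "matched A" "matched B" using Par.prems by auto
  have duals: "link_dual ` set (links A d) \<subseteq> {d..<d + nvars A}"
    "link_dual ` set (links B (d + nvars A)) \<subseteq> {d + nvars A..<d + nvars A + nvars B}"
    using distinct_vars(2)[of A d] distinct_vars(2)[of B "d + nvars A"] m by auto
  from Par.prems consider "l \<in> set (links A d)" | "l \<in> set (links B (d + nvars A))" by auto
  then show ?case
  proof cases
    case 1
    with Par.IH(1)[OF m(1)] obtain v where v: "Vars (link_src l) = {v}" "link_tgt l < v"
      "v \<in> {d..<d + nvars A} - link_dual ` set (links A d)" by blast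
    have "v \<notin> link_dual ` set (links (Par A B) d)"
      using notin_if_subset_ivl[OF duals(2), of v] v(3)
      by (simp add: image_Un)
    then show ?thesis using v by (intro exI[of _ v]) simp
  next
    case 2
    with Par.IH(2)[OF m(2)] obtain v where v: "Vars (link_src l) = {v}" "link_tgt l < v"
      "v \<in> {d + nvars A..<d + nvars A + nvars B} - link_dual ` set (links B (d + nvars A))" by blast
    have "v \<notin> link_dual ` set (links (Par A B) d)"
      using notin_if_subset_ivl[OF duals(1), of v] v(3)
      by (simp add: image_Un)
    then show ?thesis using v by (intro exI[of _ v]) simp
  qed
qed simp_all

section \<open>Classical execution of Hadamard-free circuits\<close>

definition consistent :: "(nat \<Rightarrow> bit) \<Rightarrow> link list \<Rightarrow> bool"
  where "consistent a L \<longleftrightarrow> (\<forall>l\<in>set L. a (link_tgt l) = eval a (link_src l))"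

lemma consistent_append [simp]: "consistent a (L @ L') \<longleftrightarrow> consistent a L \<and> consistent a L'"
  by (auto simp: consistent_def)

lemma consistent_Nil [simp]: "consistent a []"
  by (simp add: consistent_def)

lemma consistent_zip_links:
  "length ps = length ws \<Longrightarrow> consistent a (zip_links y ps ws) \<longleftrightarrow> map a ws = map (eval a) ps"
proof (induction ps ws arbitrary: y rule: list_induct2)
  case (Cons p ps w ws)
  then show ?case by (simp add: consistent_def)
qed simp

text \<open>The last clause is meant for diagonal gates and idle wires; on \<open>Had\<close> its
  value is a dummy.\<close>

fun act :: "circuit \<Rightarrow> bit list \<Rightarrow> bit list" where
  "act (Gate NotX) x = [x ! 0 + 1]"
| "act (Gate Swap) x = [x ! 1, x ! 0]"
| "act (Seq A B) x = act B (act A x)"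
| "act (Par A B) x = act A (take (width A) x) @ act B (drop (width A) x)"
| "act _ x = x"

fun act_phase :: "circuit \<Rightarrow> bit list \<Rightarrow> bit" where
  "act_phase (Gate (CtrlZ k)) x = prod_list x"
| "act_phase (Seq A B) x = act_phase A x + act_phase B (act A x)"
| "act_phase (Par A B) x = act_phase A (take (width A) x) + act_phase B (drop (width A) x)"
| "act_phase _ x = 0"

lemma length_act [simp]: "matched C \<Longrightarrow> length x = width C \<Longrightarrow> length (act C x) = width C"
  by (induction C x rule: act.induct) auto

lemma matched_if_well_formed: "well_formed C \<Longrightarrow> matched C"
  by (induction C) auto

text \<open>A consistent assignment is the trace of a classical run: every link equates an input of
  the later circuit with an output of the earlier one.\<close>

lemma consistent_outs:
  "matched C \<Longrightarrow> Had \<notin> set (gates C) \<Longrightarrow> consistent a (links C d) \<Longrightarrow>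
    map (\<lambda>p. eval a (list_poly p)) (out_mons C d) = act C (map a (in_vars C d)) \<and>
    eval a (gate_phase C d) = act_phase C (map a (in_vars C d))"
proof (induction C arbitrary: d)
  case (Gate g)
  then show ?case
    by (cases g) (auto simp: eval_mon_poly comp_def eval_nat_numeral simp del: upt_Suc)
next
  case (Idle k)
  then show ?case by (simp add: comp_def)
next
  case (Seq A B)
  then have "map a (in_vars B d) = map (eval a) (map list_poly (out_mons A (d + nvars B)))"
    by (simp add: consistent_zip_links)
  then have "map a (in_vars B d) = map (\<lambda>p. eval a (list_poly p)) (out_mons A (d + nvars B))"
    by (simp add: comp_def)
  with Seq show ?case by simp
next
  case (Par A B)
  then show ?case by simp
qed

lemma signum_simps [simp]: "signum 0 = 1" "signum 1 = -1"
  by (simp_all add: signum_def)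

lemma signum_add: "signum (a + b) = signum a * signum b"
  by (cases a; cases b) simp_all

lemma signum_neq_0 [simp]: "signum b \<noteq> 0"
  by (cases b) simp_all

lemma signum_inject: "signum a = signum b \<longleftrightarrow> a = b"
  by (cases a; cases b) simp_all

lemma finite_bit_lists: "finite {z :: bit list. length z = k}"
proof -
  have "(UNIV :: bit set) = {0, 1}" by (auto intro: bit.exhaust)
  then have "finite (UNIV :: bit set)" by (metis finite.emptyI finite.insertI)
  then show ?thesis using finite_lists_length_eq[of UNIV k] by simp
qed

text \<open>Each gate maps a basis state to a signed basis state, so the sum over intermediate
  states in a composition has a single nonzero term.\<close>

lemma amp_act:
  "matched C \<Longrightarrow> Had \<notin> set (gates C) \<Longrightarrow> length x = width C \<Longrightarrow>
    amp C z x = (if z = act C x then signum (act_phase C x) else 0)"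
proof (induction C arbitrary: z x)
  case (Gate g)
  then show ?case by (cases g) auto
next
  case (Seq A B)
  have "amp (Seq A B) z x = (\<Sum>u | length u = width A.
      if u = act A x then amp B z u * signum (act_phase A x) else 0)"
    using Seq by (auto intro!: sum.cong)
  also have "\<dots> = amp B z (act A x) * signum (act_phase A x)"
    using Seq.prems by (simp add: finite_bit_lists)
  also have "\<dots> = (if z = act (Seq A B) x then signum (act_phase (Seq A B) x) else 0)"
    using Seq by (simp add: signum_add)
  finally show ?case .
next
  case (Par A B)
  have "z = act A (take (width A) x) @ act B (drop (width A) x) \<longleftrightarrow>
      take (width A) z = act A (take (width A) x) \<and> drop (width A) z = act B (drop (width A) x)"
    using Par.prems by (metis append_eq_conv_conj append_take_drop_id length_act length_take matched.simps(4)
        min.absorb2 trans_le_add1 width.simps(4) le_add1)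
  then show ?case
    using Par by (simp add: signum_add)
qed simp_all

text \<open>In the row \<open>act C (x @ y)\<close> the matrix entry is a sign, hence nonzero. The
  specification allows this only in the row \<open>x @ y\<close>, and comparing the two signs gives
  the phase.\<close>

lemma phase_oracle_act:
  assumes "implements_phase_oracle m n g C" "length x = n" "length y = n"
  shows "act C (x @ y) = x @ y" "act_phase C (x @ y) = g x y"
proof -
  have C: "matched C" "Had \<notin> set (gates C)" "width C = 2 * n"
    using assms(1) matched_if_well_formed by (auto simp: implements_phase_oracle_def)
  then have "(if act C (x @ y) = x @ y then signum (g x y) else 0) = amp C (act C (x @ y)) (x @ y)"
    using assms by (simp add: implements_phase_oracle_def)
  also have "\<dots> = signum (act_phase C (x @ y))"
    using C assms(2,3) by (simp add: amp_act)
  finally show "act C (x @ y) = x @ y" "act_phase C (x @ y) = g x y"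
    by (auto simp: signum_inject split: if_splits)
qed

section \<open>Hadamard layers\<close>

lemma inner_prod_Cons [simp]: "inner_prod (x # xs) (y # ys) = x * y + inner_prod xs ys"
  and inner_prod_Nil [simp]: "inner_prod [] ys = 0"
  by (simp_all add: inner_prod_def)

lemma matched_all_Had [simp]: "matched (all_Had k)"
  and width_all_Had [simp]: "width (all_Had k) = k"
  and gates_all_Had: "gates (all_Had k) = replicate k Had"
  by (induction k rule: all_Had.induct) auto

lemma links_all_Had [simp]: "links (all_Had k) d = []"
  by (induction k arbitrary: d rule: all_Had.induct) auto

lemma out_mons_all_Had: "out_mons (all_Had k) d = map (\<lambda>v. [[v]]) (had_vars (all_Had k) d)"
  by (induction k arbitrary: d rule: all_Had.induct) auto

lemma length_had_vars_all_Had [simp]: "length (had_vars (all_Had k) d) = k"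
  by (induction k arbitrary: d rule: all_Had.induct) auto

lemma eval_gate_phase_all_Had:
  "eval a (gate_phase (all_Had k) d) = inner_prod (map a (in_vars (all_Had k) d)) (map a (had_vars (all_Had k) d))"
  by (induction k arbitrary: d rule: all_Had.induct) auto

lemma had_vars_classical: "Had \<notin> set (gates C) \<Longrightarrow> had_vars C d = []"
  by (induction C arbitrary: d) auto

section \<open>Rewriting hidden shift circuits\<close>

text \<open>The start of the scalar invariant: composing with \<open>|0...0>\<close> adds
  \<open>width C\<close> variables but \<open>2 * width C\<close> to the exponent, which makes up
  for this difference.\<close>

lemma nvars_root_exp: "matched C \<Longrightarrow> nvars C = root_exp C + width C"
proof (induction C)
  case (Gate g)
  then show ?case by (cases g) auto
qed auto

text \<open>Phase and outputs of the reduct are only recorded as functions, which determine the polynomials.\<close>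

definition reduces ::
  "path_sum \<Rightarrow> nat set \<Rightarrow> ((nat \<Rightarrow> bit) \<Rightarrow> bit) \<Rightarrow> ((nat \<Rightarrow> bit) \<Rightarrow> bit list) \<Rightarrow> bool" where
  "reduces S V \<phi> \<omega> \<longleftrightarrow> (\<exists>Q Os. rewrite\<^sup>*\<^sup>* S (PathSum (root_half (card V)) V Q Os []) \<and>
     valid_path_sum (PathSum (root_half (card V)) V Q Os []) \<and>
     (\<forall>a. eval a Q = \<phi> a \<and> map (eval a) Os = \<omega> a))"

lemma reduces_refl:
  assumes "valid_path_sum (PathSum (root_half (card V)) V Q Os [])"
  shows "reduces (PathSum (root_half (card V)) V Q Os []) V (\<lambda>a. eval a Q) (\<lambda>a. map (eval a) Os)"
  unfolding reduces_def using assms by blast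

text \<open>With no variables left the scalar is 1, and the functions determine phase and outputs as
  polynomials, so the reduct is literally the ket.\<close>

lemma reduces_ket:
  assumes "reduces S {} (\<lambda>_. 0) (\<lambda>_. bs)"
  shows "rewrite\<^sup>*\<^sup>* S (ket bs)"
proof -
  obtain Q Os where red: "rewrite\<^sup>*\<^sup>* S (PathSum (root_half (card {})) {} Q Os [])"
    and Q: "\<And>a. eval a Q = 0" and Os: "\<And>a. map (eval a) Os = bs"
    using assms unfolding reduces_def by auto
  have "Q = 0" using Q by (rule eval_eq_0_imp)
  moreover have "Os = map bconst bs"
  proof (rule nth_equalityI)
    show "length Os = length (map bconst bs)" using Os by (metis length_map)
    fix i assume "i < length Os"
    then have "eval a (Os ! i) = bs ! i" for a using Os[of a] by (metis nth_map)
    then show "Os ! i = map bconst bs ! i"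
      using \<open>i < length Os\<close> \<open>length Os = length (map bconst bs)\<close> by (intro eval_inject) simp
  qed
  ultimately show ?thesis
    using red by (simp add: ket_def)
qed

lemma Vars_disjoint_if_eval_cong:
  assumes "\<And>a b. (\<And>v. v \<notin> X \<Longrightarrow> a v = b v) \<Longrightarrow> map (eval a) Os = map (eval b) Os"
  shows "\<forall>p\<in>set Os. Vars p \<inter> X = {}"
proof
  fix p assume p: "p \<in> set Os"
  have "Vars p \<subseteq> - X"
  proof (rule Vars_subset_if_eval_cong)
    fix a b :: "nat \<Rightarrow> bit" assume "\<And>v. v \<in> - X \<Longrightarrow> a v = b v"
    then have "map (eval a) Os = map (eval b) Os" by (intro assms) simp
    with p show "eval a p = eval b p" by (simp only: map_eq_conv)
  qed
  then show "Vars p \<inter> X = {}" by blast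
qed

text \<open>Only the values of the polynomials are known. So non-occurrence of the duals enters as
  independence of values (\<open>indep\<close>), and the new functions have to be right only at
  assignments that satisfy the links (\<open>res\<close>).\<close>

lemma reduces_links:
  assumes red: "reduces S V \<phi> \<omega>"
    and ord: "elim_order \<rho> V L"
    and \<phi>: "\<And>a. \<phi> a = eval a (links_poly L) + r a"
    and indep: "\<And>a b. (\<And>v. v \<notin> set (map link_dual L) \<Longrightarrow> a v = b v) \<Longrightarrow> r a = r b \<and> \<omega> a = \<omega> b"
    and res: "\<And>a b. (\<And>v. v \<notin> set (map link_tgt L) \<Longrightarrow> b v = a v) \<Longrightarrow> consistent b L \<Longrightarrow>
      r b = \<phi>' a \<and> \<omega> b = \<omega>' a"
    and V': "V' = V - set (map link_dual L @ map link_tgt L)"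
  shows "reduces S V' \<phi>' \<omega>'"
proof -
  obtain Q Os where S: "rewrite\<^sup>*\<^sup>* S (PathSum (root_half (card V)) V Q Os [])"
    and valid: "valid_path_sum (PathSum (root_half (card V)) V Q Os [])"
    and Q: "\<And>a. eval a Q = \<phi> a" and Os: "\<And>a. map (eval a) Os = \<omega> a"
    using red unfolding reduces_def by blast
  have disj: "\<forall>p\<in>set Os. Vars p \<inter> set (map link_dual L) = {}"
  proof (rule Vars_disjoint_if_eval_cong)
    fix a b :: "nat \<Rightarrow> bit" assume "\<And>v. v \<notin> set (map link_dual L) \<Longrightarrow> a v = b v"
    then have "\<omega> a = \<omega> b" using indep by blast
    then show "map (eval a) Os = map (eval b) Os" unfolding Os .
  qed
  have Q\<phi>: "eval a Q = eval a (links_poly L) + r a" for a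
    by (simp add: Q \<phi>)
  have r: "r a = r b" if "\<And>v. v \<notin> set (map link_dual L) \<Longrightarrow> a v = b v" for a b
    using indep[of a b] that by blast
  show ?thesis
  proof (rule elim_links_eval[OF valid ord Q\<phi> r disj V'])
    fix \<sigma> Q' Os'
    assume step: "rewrite\<^sup>*\<^sup>* (PathSum (root_half (card V)) V Q Os []) (PathSum (root_half (card V')) V' Q' Os' [])"
      and valid': "valid_path_sum (PathSum (root_half (card V')) V' Q' Os' [])"
      and Q': "\<And>a. eval a Q' = r (\<sigma> a)"
      and Os': "\<And>a. map (eval a) Os' = map (eval (\<sigma> a)) Os"
      and \<sigma>: "\<And>a l. l \<in> set L \<Longrightarrow> \<sigma> a (link_tgt l) = eval (\<sigma> a) (link_src l)"
        "\<And>a v. v \<notin> set (map link_tgt L) \<Longrightarrow> \<sigma> a v = a v"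
    have "r (\<sigma> a) = \<phi>' a \<and> \<omega> (\<sigma> a) = \<omega>' a" for a
    proof (rule res)
      show "consistent (\<sigma> a) L" unfolding consistent_def using \<sigma>(1) by blast
    qed (rule \<sigma>(2))
    then have "\<forall>a. eval a Q' = \<phi>' a \<and> map (eval a) Os' = \<omega>' a"
      unfolding Q' Os' Os by blast
    then show ?thesis
      unfolding reduces_def using rtranclp_trans[OF S step] valid' by blast
  qed
qed

section \<open>From a circuit to a phase in its Hadamard outputs\<close>

lemma Vars_mon_poly: "Vars (mon_poly m) \<subseteq> set m"
proof (induction m)
  case (Cons v m)
  then show ?case using Vars_mult[of "var v" "mon_poly m"] by auto
qed simp

text \<open>Duals are created by compositions only, in intervals disjoint from the variables of the
  gates.\<close>

lemma Vars_gate_phase: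
  "matched C \<Longrightarrow> Vars (gate_phase C d) \<subseteq> {d..<d + nvars C} - link_dual ` set (links C d)"
proof (induction C arbitrary: d)
  case (Gate g)
  show ?case
  proof (cases g)
    case Had
    then show ?thesis using Vars_mult[of "var d" "var (Suc d)"] by auto
  next
    case (CtrlZ k)
    then show ?thesis using Vars_mon_poly[of "[d..<d + Suc k]"] by (auto simp del: upt_Suc)
  qed auto
next
  case (Seq A B)
  have m: "matched A" "matched B" "width A = width B" using Seq.prems by auto
  have duals: "link_dual ` set (links A (d + nvars B)) \<subseteq> {d + nvars B..<d + nvars B + nvars A}"
    "link_dual ` set (links B d) \<subseteq> {d..<d + nvars B}"
    "link_dual ` set (zip_links (d + nvars B + nvars A) (map list_poly (out_mons A (d + nvars B))) (in_vars B d))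
     \<subseteq> {d + nvars B + nvars A..<d + nvars B + nvars A + width B}"
    using distinct_vars(2)[of A "d + nvars B"] distinct_vars(2)[of B d] m
      zip_links_dual[of "map list_poly (out_mons A (d + nvars B))" "in_vars B d" "d + nvars B + nvars A"]
    unfolding set_map[symmetric] by (simp_all del: set_map) blast+
  have "v \<in> {d..<d + nvars (Seq A B)} - link_dual ` set (links (Seq A B) d)"
    if "v \<in> Vars (gate_phase A (d + nvars B))" for v
  proof -
    have v: "v \<in> {d + nvars B..<d + nvars B + nvars A} - link_dual ` set (links A (d + nvars B))"
      using Seq.IH(1)[OF m(1), of "d + nvars B"] that by blast
    then show ?thesis
      using notin_if_subset_ivl[OF duals(2), of v] notin_if_subset_ivl[OF duals(3), of v]
      by (simp add: image_Un)
  qed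
  moreover have "v \<in> {d..<d + nvars (Seq A B)} - link_dual ` set (links (Seq A B) d)"
    if "v \<in> Vars (gate_phase B d)" for v
  proof -
    have v: "v \<in> {d..<d + nvars B} - link_dual ` set (links B d)"
      using Seq.IH(2)[OF m(2), of d] that by blast
    then show ?thesis
      using notin_if_subset_ivl[OF duals(1), of v] notin_if_subset_ivl[OF duals(3), of v]
      by (simp add: image_Un)
  qed
  ultimately show ?case
    using Vars_add[of "gate_phase A (d + nvars B)" "gate_phase B d"] by (simp only: gate_phase.simps) blast
next
  case (Par A B)
  have m: "matched A" "matched B" using Par.prems by auto
  have duals: "link_dual ` set (links A d) \<subseteq> {d..<d + nvars A}"
    "link_dual ` set (links B (d + nvars A)) \<subseteq> {d + nvars A..<d + nvars A + nvars B}"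
    using distinct_vars(2)[of A d] distinct_vars(2)[of B "d + nvars A"] m by auto
  have "v \<in> {d..<d + nvars (Par A B)} - link_dual ` set (links (Par A B) d)"
    if "v \<in> Vars (gate_phase A d)" for v
  proof -
    have v: "v \<in> {d..<d + nvars A} - link_dual ` set (links A d)"
      using Par.IH(1)[OF m(1), of d] that by blast
    then show ?thesis
      using notin_if_subset_ivl[OF duals(2), of v] by (simp add: image_Un)
  qed
  moreover have "v \<in> {d..<d + nvars (Par A B)} - link_dual ` set (links (Par A B) d)"
    if "v \<in> Vars (gate_phase B (d + nvars A))" for v
  proof -
    have v: "v \<in> {d + nvars A..<d + nvars A + nvars B} - link_dual ` set (links B (d + nvars A))"
      using Par.IH(2)[OF m(2), of "d + nvars A"] that by blast
    then show ?thesis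
      using notin_if_subset_ivl[OF duals(1), of v] by (simp add: image_Un)
  qed
  ultimately show ?case
    using Vars_add[of "gate_phase A d" "gate_phase B (d + nvars A)"] by (simp only: gate_phase.simps) blast
qed simp_all

definition start_links :: "circuit \<Rightarrow> link list" where
  "start_links C = zip_links (nvars C) (replicate (width C) 0) (in_vars C 0) @ links C 0"

lemma start_mons_links: "list_poly (start_mons C) = links_poly (start_links C) + gate_phase C 0"
  by (simp add: start_mons_def start_links_def list_poly_link_mons_links phase_mons_links)

lemma vars_lessThan:
  assumes "matched C"
  shows "link_dual ` set (links C 0) \<subseteq> {..<nvars C}" "link_tgt ` set (links C 0) \<subseteq> {..<nvars C}"
    "set (in_vars C 0) \<subseteq> {..<nvars C}" "set (had_vars C 0) \<subseteq> {..<nvars C}"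
    "{..<nvars C} \<subseteq> link_dual ` set (links C 0) \<union> link_tgt ` set (links C 0) \<union>
      set (in_vars C 0) \<union> set (had_vars C 0)"
proof -
  have "link_dual ` set (links C 0) \<union> link_tgt ` set (links C 0) \<union>
      set (in_vars C 0) \<union> set (had_vars C 0) = {..<nvars C}"
    using distinct_vars(2)[OF assms, of 0] unfolding set_map by (simp only: add_0 lessThan_atLeast0)
  then show "link_dual ` set (links C 0) \<subseteq> {..<nvars C}" "link_tgt ` set (links C 0) \<subseteq> {..<nvars C}"
    "set (in_vars C 0) \<subseteq> {..<nvars C}" "set (had_vars C 0) \<subseteq> {..<nvars C}"
    "{..<nvars C} \<subseteq> link_dual ` set (links C 0) \<union> link_tgt ` set (links C 0) \<union>
      set (in_vars C 0) \<union> set (had_vars C 0)"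
    by blast+
qed

lemma start_links_vars:
  assumes "matched C"
  shows "set (map link_dual (start_links C)) = {nvars C..<nvars C + width C} \<union> link_dual ` set (links C 0)"
    and "set (map link_tgt (start_links C)) = set (in_vars C 0) \<union> link_tgt ` set (links C 0)"
    and "distinct (map link_dual (start_links C) @ map link_tgt (start_links C))"
proof -
  have d: "map link_dual (start_links C) = [nvars C..<nvars C + width C] @ map link_dual (links C 0)"
    and t: "map link_tgt (start_links C) = in_vars C 0 @ map link_tgt (links C 0)"
    unfolding start_links_def map_append using assms by (simp_all add: zip_links_dual zip_links_tgt)
  show "set (map link_dual (start_links C)) = {nvars C..<nvars C + width C} \<union> link_dual ` set (links C 0)"
    "set (map link_tgt (start_links C)) = set (in_vars C 0) \<union> link_tgt ` set (links C 0)"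
    unfolding d t by simp_all
  have "set (in_vars C 0) \<union> link_dual ` set (links C 0) \<union> link_tgt ` set (links C 0) \<subseteq> {..<nvars C}"
    using vars_lessThan[OF assms] by blast
  then have "{nvars C..<nvars C + width C} \<inter>
    (set (in_vars C 0) \<union> link_dual ` set (links C 0) \<union> link_tgt ` set (links C 0)) = {}"
    by fastforce
  then show "distinct (map link_dual (start_links C) @ map link_tgt (start_links C))"
    unfolding d t using distinct_vars(1)[OF assms, of 0] by (auto simp del: map_append)
qed

lemma interp_ket_reduces:
  assumes m: "matched C"
    and res: "\<And>a b. (\<And>v. v \<in> set (had_vars C 0) \<Longrightarrow> b v = a v) \<Longrightarrow> consistent b (links C 0) \<Longrightarrow>
      map b (in_vars C 0) = replicate (width C) 0 \<Longrightarrow>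
      eval b (gate_phase C 0) = \<phi> a \<and> map (\<lambda>p. eval b (list_poly p)) (out_mons C 0) = \<omega> a"
  shows "reduces (interp C \<circ>\<^sub>P ket (replicate (width C) 0)) (set (had_vars C 0)) \<phi> \<omega>"
proof -
  let ?V = "{..<nvars C + width C}" and ?L = "start_links C"
  have duals: "link_dual ` set (links C 0) \<subseteq> {..<nvars C}" and tgts: "set (map link_tgt ?L) \<subseteq> {..<nvars C}"
    and hads: "set (had_vars C 0) \<subseteq> {..<nvars C}"
    unfolding start_links_vars(2)[OF m] using vars_lessThan[OF m] by blast+
  have notin: "v \<notin> set (map link_dual ?L)" if "v < nvars C" "v \<notin> link_dual ` set (links C 0)" for v
    using that by (simp add: start_links_vars(1)[OF m, unfolded set_map])
  have src: "Vars (link_src l) \<subseteq> {..<nvars C} - set (map link_dual ?L) \<and> card (Vars (link_src l)) \<le> 1 \<and>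
      (\<forall>v\<in>Vars (link_src l). link_tgt l < v)" if "l \<in> set ?L" for l
  proof -
    from that consider "l \<in> set (zip_links (nvars C) (replicate (width C) 0) (in_vars C 0))" | "l \<in> set (links C 0)"
      by (auto simp: start_links_def)
    then show ?thesis
    proof cases
      case 1
      then have "link_src l = 0" by (auto dest: set_zip_linksD)
      then show ?thesis by simp
    next
      case 2
      from links_ordered[OF m this] obtain v where "Vars (link_src l) = {v}"
        "v \<in> {0..<0 + nvars C} - link_dual ` set (links C 0)" "link_tgt l < v" by blast
      then show ?thesis using notin[of v] by simp
    qed
  qed
  have gp: "Vars (gate_phase C 0) \<subseteq> {..<nvars C} - set (map link_dual ?L)"
  proof -
    have "Vars (gate_phase C 0) \<subseteq> {..<nvars C} - link_dual ` set (links C 0)"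
      using Vars_gate_phase[OF m, of 0] unfolding lessThan_atLeast0 by (simp only: add_0)
    then show ?thesis using notin by (blast intro: lessThan_iff[THEN iffD1])
  qed
  have outs: "Vars (list_poly p) \<subseteq> {..<nvars C} - set (map link_dual ?L)" if "p \<in> set (out_mons C 0)" for p
  proof -
    from out_mons_affine[OF m that] obtain v where "affine p v"
      "v \<in> {0..<0 + nvars C} - link_dual ` set (links C 0)" by blast
    then show ?thesis using notin[of v] by (simp add: Vars_affine)
  qed
  have dV: "set (map link_dual ?L) \<subseteq> ?V"
    unfolding start_links_vars(1)[OF m] using duals by auto
  \<comment> \<open>The rank is the variable number, by \<open>links_ordered\<close>; the sources of
    the input links are 0 and impose nothing.\<close>
  have ord: "elim_order (\<lambda>v. v) ?V ?L"
  proof -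
    have sub: "{..<nvars C} \<subseteq> ?V" by simp
    have "\<forall>l\<in>set ?L. Vars (link_src l) \<subseteq> ?V - set (map link_dual ?L) \<and> card (Vars (link_src l)) \<le> 1 \<and>
        (\<forall>v\<in>Vars (link_src l). link_tgt l < v)"
    proof
      fix l assume "l \<in> set ?L"
      note src = src[OF this]
      have "{..<nvars C} - set (map link_dual ?L) \<subseteq> ?V - set (map link_dual ?L)"
        using sub by (rule Diff_mono) simp
      with src show "Vars (link_src l) \<subseteq> ?V - set (map link_dual ?L) \<and> card (Vars (link_src l)) \<le> 1 \<and>
          (\<forall>v\<in>Vars (link_src l). link_tgt l < v)"
        by (intro conjI) (elim conjE, erule (1) subset_trans, simp, simp)
    qed
    moreover have "set (map link_tgt ?L) \<subseteq> ?V" using tgts sub by (rule subset_trans)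
    ultimately show ?thesis
      unfolding elim_order_def set_append using start_links_vars(3)[OF m] dV by blast
  qed
  have "Vars (list_poly (start_mons C)) \<subseteq> ?V"
  proof -
    have "Vars (links_poly ?L) \<subseteq> ?V"
    proof -
      have "{link_dual l, link_tgt l} \<union> Vars (link_src l) \<subseteq> ?V" if "l \<in> set ?L" for l
      proof -
        have "link_dual l \<in> ?V" using dV that by auto
        moreover have "link_tgt l < nvars C" using tgts that by auto
        moreover have "Vars (link_src l) \<subseteq> {..<nvars C}" using src[OF that] by blast
        ultimately show ?thesis by auto
      qed
      then show ?thesis using Vars_links_poly[of ?L] by blast
    qed
    moreover have "Vars (gate_phase C 0) \<subseteq> ?V" using gp by auto
    ultimately show ?thesis
      using Vars_add[of "links_poly ?L" "gate_phase C 0"] unfolding start_mons_links by blast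
  qed
  moreover have "\<forall>p\<in>set (map list_poly (out_mons C 0)). Vars p \<subseteq> ?V"
    using outs by fastforce
  ultimately have valid: "valid_path_sum (PathSum (root_half (card ?V)) ?V (list_poly (start_mons C))
      (map list_poly (out_mons C 0)) [])"
    by (simp add: valid_path_sum_def)
  have "root_exp C + 2 * width C = card ?V"
    using nvars_root_exp[OF m] by simp
  then have S: "interp C \<circ>\<^sub>P ket (replicate (width C) 0) = PathSum (root_half (card ?V)) ?V (list_poly (start_mons C))
      (map list_poly (out_mons C 0)) []"
    unfolding interp_ket_explicit[OF m] by (simp only:)
  show ?thesis
    unfolding S
  proof (rule reduces_links[OF reduces_refl[OF valid] ord])
    show "eval a (list_poly (start_mons C)) = eval a (links_poly ?L) + eval a (gate_phase C 0)" for a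
      by (simp add: start_mons_links)
    show "eval a (gate_phase C 0) = eval b (gate_phase C 0) \<and>
        map (eval a) (map list_poly (out_mons C 0)) = map (eval b) (map list_poly (out_mons C 0))"
      if "\<And>v. v \<notin> set (map link_dual ?L) \<Longrightarrow> a v = b v" for a b
    proof
      show "eval a (gate_phase C 0) = eval b (gate_phase C 0)"
        using that gp by (intro eval_cong) blast
      have "eval a (list_poly p) = eval b (list_poly p)" if "p \<in> set (out_mons C 0)" for p
        by (rule eval_cong, rule \<open>\<And>v. v \<notin> set (map link_dual ?L) \<Longrightarrow> a v = b v\<close>) (use outs[OF that] in blast)
      then show "map (eval a) (map list_poly (out_mons C 0)) = map (eval b) (map list_poly (out_mons C 0))"
        by simp
    qed
    have hV: "set (had_vars C 0) \<inter> (set (map link_dual ?L) \<union> set (map link_tgt ?L)) = {}"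
    proof -
      have "set (had_vars C 0) \<inter> (set (in_vars C 0) \<union> link_dual ` set (links C 0) \<union> link_tgt ` set (links C 0)) = {}"
        using distinct_vars(1)[OF m, of 0] by auto
      moreover have "set (had_vars C 0) \<inter> {nvars C..<nvars C + width C} = {}"
        using hads by fastforce
      ultimately show ?thesis
        unfolding start_links_vars(1,2)[OF m] by blast
    qed
    show "eval b (gate_phase C 0) = \<phi> a \<and> map (eval b) (map list_poly (out_mons C 0)) = \<omega> a"
      if "\<And>v. v \<notin> set (map link_tgt ?L) \<Longrightarrow> b v = a v" "consistent b ?L" for a b
    proof -
      have "map b (in_vars C 0) = replicate (width C) 0" "consistent b (links C 0)"
        using that(2) m by (auto simp: start_links_def consistent_zip_links)
      moreover have "b v = a v" if "v \<in> set (had_vars C 0)" for v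
        using \<open>\<And>v. v \<notin> set (map link_tgt ?L) \<Longrightarrow> b v = a v\<close> hV that by blast
      ultimately show ?thesis
        using res[of b a] by (simp add: comp_def)
    qed
    have "{..<nvars C} \<subseteq> link_dual ` set (links C 0) \<union> link_tgt ` set (links C 0) \<union>
        set (in_vars C 0) \<union> set (had_vars C 0)"
      by (rule vars_lessThan(5)[OF m])
    then have "?V \<subseteq> set (map link_dual ?L) \<union> set (map link_tgt ?L) \<union> set (had_vars C 0)"
      unfolding start_links_vars(1,2)[OF m] lessThan_Un_ivl[symmetric] by blast
    moreover have "set (had_vars C 0) \<subseteq> ?V"
      using hads unfolding lessThan_Un_ivl[symmetric] by blast
    ultimately show "set (had_vars C 0) = ?V - set (map link_dual ?L @ map link_tgt ?L)"
      using hV unfolding set_append by blast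
  qed
qed

text \<open>Here no source contains a target, so a rank with two values suffices. This form serves
  the three blocks of eliminations among the Hadamard outputs.\<close>

lemma reduces_elim:
  fixes x w :: "nat \<Rightarrow> nat" and q :: "nat \<Rightarrow> bpoly"
  assumes red: "reduces S V \<phi> \<omega>"
    and inj: "inj_on x {..<n}" "inj_on w {..<n}" "x ` {..<n} \<inter> w ` {..<n} = {}"
    and sub: "x ` {..<n} \<subseteq> V" "w ` {..<n} \<subseteq> V"
    and q: "\<And>i. i < n \<Longrightarrow> Vars (q i) \<subseteq> V - x ` {..<n} - w ` {..<n} \<and> card (Vars (q i)) \<le> 1"
    and \<phi>: "\<And>a. \<phi> a = (\<Sum>i<n. a (x i) * (a (w i) + eval a (q i))) + r a"
    and indep: "\<And>a b. (\<And>v. v \<notin> x ` {..<n} \<Longrightarrow> a v = b v) \<Longrightarrow> r a = r b \<and> \<omega> a = \<omega> b"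
    and res: "\<And>a b. (\<And>v. v \<notin> w ` {..<n} \<Longrightarrow> b v = a v) \<Longrightarrow> (\<And>i. i < n \<Longrightarrow> b (w i) = eval b (q i)) \<Longrightarrow>
      r b = \<phi>' a \<and> \<omega> b = \<omega>' a"
    and V': "V' = V - x ` {..<n} - w ` {..<n}"
  shows "reduces S V' \<phi>' \<omega>'"
proof -
  define L where "L = map (\<lambda>i. (x i, q i, w i)) [0..<n]"
  have dual: "map link_dual L = map x [0..<n]" and tgt: "map link_tgt L = map w [0..<n]"
    by (simp_all add: L_def)
  have sets: "set (map link_dual L) = x ` {..<n}" "set (map link_tgt L) = w ` {..<n}"
    unfolding dual tgt by (simp_all add: lessThan_atLeast0)
  show ?thesis
  proof (rule reduces_links[OF red])
    show "elim_order (\<lambda>v. if v \<in> w ` {..<n} then 0 else 1) V L"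
    proof -
      have "distinct (map link_dual L @ map link_tgt L)"
        unfolding dual tgt using inj by (simp add: distinct_map lessThan_atLeast0)
      moreover have "Vars (link_src l) \<subseteq> V - x ` {..<n} \<and> card (Vars (link_src l)) \<le> 1 \<and>
          (\<forall>v\<in>Vars (link_src l). (if link_tgt l \<in> w ` {..<n} then 0 else 1 :: nat) < (if v \<in> w ` {..<n} then 0 else 1))"
        if "l \<in> set L" for l
      proof -
        from that obtain i where i: "i < n" and l: "l = (x i, q i, w i)" by (auto simp: L_def)
        have "v \<notin> w ` {..<n}" if "v \<in> Vars (q i)" for v using q[OF i] that by blast
        then show ?thesis using q[OF i] i by (auto simp: l)
      qed
      ultimately show ?thesis
        unfolding elim_order_def set_append sets using sub by blast
    qed
    have "(\<Sum>l\<leftarrow>L. a (link_dual l) * (a (link_tgt l) + eval a (link_src l))) =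
        (\<Sum>i<n. a (x i) * (a (w i) + eval a (q i)))" for a
      by (simp add: L_def comp_def sum_list_distinct_conv_sum_set atLeast0LessThan)
    then show "\<phi> a = eval a (links_poly L) + r a" for a
      by (simp add: \<phi> eval_links_poly)
    show "r a = r b \<and> \<omega> a = \<omega> b" if "\<And>v. v \<notin> set (map link_dual L) \<Longrightarrow> a v = b v" for a b
      using that unfolding sets by (rule indep)
    show "r b = \<phi>' a \<and> \<omega> b = \<omega>' a"
      if "\<And>v. v \<notin> set (map link_tgt L) \<Longrightarrow> b v = a v" "consistent b L" for a b
    proof (rule res)
      show "b v = a v" if "v \<notin> w ` {..<n}" for v
        using \<open>\<And>v. v \<notin> set (map link_tgt L) \<Longrightarrow> b v = a v\<close> that unfolding sets .
      show "b (w i) = eval b (q i)" if "i < n" for i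
        using \<open>consistent b L\<close> that by (simp add: consistent_def L_def)
    qed
    show "V' = V - set (map link_dual L @ map link_tgt L)"
      unfolding V' set_append sets by blast
  qed
qed

section \<open>Inner products and permutations of bit vectors\<close>

lemma inner_prod_sum: "length x = n \<Longrightarrow> length y = n \<Longrightarrow> inner_prod x y = (\<Sum>i<n. x ! i * y ! i)"
  by (simp add: inner_prod_def sum_list_sum_nth atLeast0LessThan)

lemma inner_prod_append: "length x = length y \<Longrightarrow> inner_prod (x @ x') (y @ y') = inner_prod x y + inner_prod x' y'"
  by (simp add: inner_prod_def)

lemma inner_prod_replicate_0: "inner_prod (replicate k 0) y = 0"
proof (induction k arbitrary: y)
  case (Suc k)
  then show ?case by (cases y) (simp_all add: inner_prod_def)
qed (simp add: inner_prod_def)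

lemma length_vec_add [simp]: "length (vec_add x y) = min (length x) (length y)"
  by (simp add: vec_add_def)

lemma nth_vec_add [simp]: "i < length x \<Longrightarrow> i < length y \<Longrightarrow> vec_add x y ! i = x ! i + y ! i"
  by (simp add: vec_add_def)

lemma inner_prod_permute:
  assumes "\<pi> permutes {..<n}" "length x = n" "length y = n"
  shows "inner_prod (permute_list \<pi> x) (permute_list \<pi> y) = inner_prod x y"
  using assms sum.reindex_bij_betw[OF permutes_imp_bij[OF assms(1)], of "\<lambda>i. x ! i * y ! i"]
  by (simp add: inner_prod_sum permute_list_nth)

lemma permute_list_inv:
  assumes "\<pi> permutes {..<length x}"
  shows "permute_list (inv \<pi>) (permute_list \<pi> x) = x"
  using permute_list_compose[OF permutes_inv[OF assms], of \<pi>] permutes_inv_o(1)[OF assms] by simp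

text \<open>Eliminating the inner Hadamard layer substitutes \<open>\<pi>(y + s\<^sub>2)\<close> for the variables \<open>u\<close>; the two copies
  of \<open>f\<^sub>0\<close> then cancel and the remaining phase is bilinear.\<close>

lemma hidden_shift_phase_reduces:
  fixes xs ys us vs ps qs :: "nat list" and \<pi> :: "nat \<Rightarrow> nat"
  assumes \<pi>: "\<pi> permutes {..<n}" and s: "length s\<^sub>1 = n" "length s\<^sub>2 = n"
    and len: "length xs = n" "length ys = n" "length us = n" "length vs = n" "length ps = n" "length qs = n"
    and dist: "distinct (xs @ ys @ us @ vs @ ps @ qs)"
    and red: "reduces S (set (xs @ ys @ us @ vs @ ps @ qs))
      (\<lambda>a. inner_prod (vec_add (map a xs) s\<^sub>1) (permute_list \<pi> (vec_add (map a ys) s\<^sub>2))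
         + f\<^sub>0 (vec_add (map a ys) s\<^sub>2)
         + (inner_prod (map a xs) (map a us) + inner_prod (map a ys) (map a vs))
         + (inner_prod (map a us) (permute_list \<pi> (map a vs)) + f\<^sub>0 (permute_list (inv \<pi>) (map a us)))
         + (inner_prod (map a us) (map a ps) + inner_prod (map a vs) (map a qs)))
      (\<lambda>a. map a ps @ map a qs)"
  shows "reduces S {} (\<lambda>_. 0) (\<lambda>_. s\<^sub>1 @ s\<^sub>2)"
proof -
  have img: "(!) zs ` {..<n} = set zs" if "length zs = n" for zs :: "nat list"
    using that by (auto simp: set_conv_nth)
  have inj: "inj_on ((!) zs) {..<n}" if "length zs = n" "distinct zs" for zs :: "nat list"
    using that by (auto simp: inj_on_def nth_eq_iff_index_eq)
  have \<pi>n: "\<pi> i < n" if "i < n" for i using permutes_in_image[OF \<pi>] that by auto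
  have agree: "map b zs = map a zs" if "\<forall>v. v \<notin> set ws \<longrightarrow> b v = a v" "set ws \<inter> set zs = {}"
    for a b :: "nat \<Rightarrow> bit" and zs ws :: "nat list"
    using that unfolding map_eq_conv by blast
  define z where "z a = permute_list \<pi> (vec_add (map a ys) s\<^sub>2)" for a :: "nat \<Rightarrow> bit"
  have lz: "length (z a) = n" for a by (simp add: z_def s len)
  have zi: "z a ! i = a (ys ! \<pi> i) + s\<^sub>2 ! \<pi> i" if "i < n" for a i
    using that \<pi>n \<pi> s len by (simp add: z_def permute_list_nth)

  have dx: "set xs \<inter> set ys = {}" "set xs \<inter> set us = {}" "set xs \<inter> set vs = {}" "set xs \<inter> set ps = {}" "set xs \<inter> set qs = {}"
    and du: "set us \<inter> set ys = {}" "set us \<inter> set vs = {}" "set us \<inter> set ps = {}" "set us \<inter> set qs = {}"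
    and dv: "set vs \<inter> set ys = {}" "set vs \<inter> set ps = {}" "set vs \<inter> set qs = {}"
    and dq: "set qs \<inter> set ys = {}" "set qs \<inter> set ps = {}"
    and dy: "set ys \<inter> set ps = {}"
    and dd: "distinct xs" "distinct ys" "distinct us" "distinct vs" "distinct ps" "distinct qs"
    using dist by auto

  \<comment> \<open>The phase is linear in \<open>xs ! i\<close>, with coefficient
    \<open>us ! i + ys ! \<pi> i + s\<^sub>2 ! \<pi> i\<close>. So \<open>xs\<close> are the duals
    and \<open>us\<close> the targets.\<close>
  have red1: "reduces S (set (ys @ vs @ ps @ qs))
      (\<lambda>a. (\<Sum>i<n. a (vs ! i) * (a (qs ! i) + s\<^sub>2 ! i)) + (\<Sum>i<n. z a ! i * (map a ps ! i + s\<^sub>1 ! i)))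
      (\<lambda>a. map a ps @ map a qs)"
  proof (rule reduces_elim[OF red, where n = n and x = "(!) xs" and w = "(!) us"
        and q = "\<lambda>i. var (ys ! \<pi> i) + bconst (s\<^sub>2 ! \<pi> i)"
        and r = "\<lambda>a. inner_prod s\<^sub>1 (z a) + f\<^sub>0 (vec_add (map a ys) s\<^sub>2) + inner_prod (map a ys) (map a vs)
          + (inner_prod (map a us) (permute_list \<pi> (map a vs)) + f\<^sub>0 (permute_list (inv \<pi>) (map a us)))
          + (inner_prod (map a us) (map a ps) + inner_prod (map a vs) (map a qs))"], goal_cases)
    case (6 i)
    have "Vars (var (ys ! \<pi> i) + bconst (s\<^sub>2 ! \<pi> i)) \<subseteq> {ys ! \<pi> i}"
      using Vars_add[of "var (ys ! \<pi> i)" "bconst (s\<^sub>2 ! \<pi> i)"] by simp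
    moreover from this have "card (Vars (var (ys ! \<pi> i) + bconst (s\<^sub>2 ! \<pi> i))) \<le> 1"
      using card_mono[of "{ys ! \<pi> i}"] by fastforce
    moreover have "ys ! \<pi> i \<in> set ys" using \<pi>n[OF 6] len by simp
    ultimately show ?case using dx(1) du(1) unfolding img[OF len(1)] img[OF len(3)] by auto
  next
    case (7 a)
    have "inner_prod (vec_add (map a xs) s\<^sub>1) (z a) + inner_prod (map a xs) (map a us)
      = (\<Sum>i<n. a (xs ! i) * (a (us ! i) + (a (ys ! \<pi> i) + s\<^sub>2 ! \<pi> i))) + inner_prod s\<^sub>1 (z a)"
      using s len by (simp add: inner_prod_sum[where n = n] lz zi algebra_simps sum.distrib)
    then show ?case by (simp add: z_def algebra_simps)
  next
    case (8 a b)
    have H: "\<forall>v. v \<notin> set xs \<longrightarrow> a v = b v" using 8 unfolding img[OF len(1)] by blast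
    have "map a ys = map b ys" "map a us = map b us" "map a vs = map b vs" "map a ps = map b ps" "map a qs = map b qs"
      by (simp_all only: agree[OF H dx(1)] agree[OF H dx(2)] agree[OF H dx(3)] agree[OF H dx(4)] agree[OF H dx(5)])
    then show ?case by (simp only: z_def simp_thms)
  next
    case (9 a b)
    have H: "\<forall>v. v \<notin> set us \<longrightarrow> b v = a v" using 9(1) unfolding img[OF len(3)] by blast
    have e: "map b ys = map a ys" "map b vs = map a vs" "map b ps = map a ps" "map b qs = map a qs"
      by (simp_all only: agree[OF H du(1)] agree[OF H du(2)] agree[OF H du(3)] agree[OF H du(4)])
    then have zb: "z b = z a" by (simp only: z_def)
    have u: "map b us = z a"
    proof (rule nth_equalityI)
      fix i assume "i < length (map b us)"
      then have i: "i < n" by (simp add: len)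
      then have "b (us ! i) = b (ys ! \<pi> i) + s\<^sub>2 ! \<pi> i" using 9(2)[OF i] by simp
      also have "\<dots> = z a ! i" using zi[OF i, of b] by (simp add: zb)
      finally show "map b us ! i = z a ! i" using i len by simp
    qed (simp add: lz len)
    have A1: "permute_list (inv \<pi>) (z a) = vec_add (map a ys) s\<^sub>2"
      unfolding z_def using \<pi> s len by (intro permute_list_inv) simp
    \<comment> \<open>Permuting both arguments preserves the inner product. With \<open>A3\<close>,
      the part \<open><y,v>\<close> then cancels against the one from the Hadamard layer.\<close>
    have A2: "inner_prod (z a) (permute_list \<pi> (map a vs)) = inner_prod (vec_add (map a ys) s\<^sub>2) (map a vs)"
      unfolding z_def using \<pi> s len by (intro inner_prod_permute[where n = n]) simp_all
    have A3: "inner_prod (vec_add (map a ys) s\<^sub>2) (map a vs) = inner_prod (map a ys) (map a vs) + inner_prod s\<^sub>2 (map a vs)"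
      using s len by (simp add: inner_prod_sum[where n = n] algebra_simps sum.distrib)
    have A4: "inner_prod s\<^sub>2 (map a vs) + inner_prod (map a vs) (map a qs) = (\<Sum>i<n. a (vs ! i) * (a (qs ! i) + s\<^sub>2 ! i))"
      using s len by (simp add: inner_prod_sum[where n = n] algebra_simps sum.distrib)
    have A5: "inner_prod s\<^sub>1 (z a) + inner_prod (z a) (map a ps) = (\<Sum>i<n. z a ! i * (map a ps ! i + s\<^sub>1 ! i))"
      using s len by (simp add: inner_prod_sum[where n = n] lz algebra_simps sum.distrib)
    show ?case
      unfolding e u zb A1 A2 A3 A4[symmetric] A5[symmetric] by (simp add: add_ac)
  next
    case 10
    show ?case using dist unfolding img[OF len(1)] img[OF len(3)] by auto
  qed (use dx dd len in \<open>auto simp: img inj\<close>)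

  \<comment> \<open>What is left is linear in \<open>vs ! i\<close> with coefficient
    \<open>qs ! i + s\<^sub>2 ! i\<close>.\<close>
  have red2: "reduces S (set (ys @ ps)) (\<lambda>a. \<Sum>i<n. z a ! i * (map a ps ! i + s\<^sub>1 ! i)) (\<lambda>a. map a ps @ s\<^sub>2)"
  proof (rule reduces_elim[OF red1, where n = n and x = "(!) vs" and w = "(!) qs" and q = "\<lambda>i. bconst (s\<^sub>2 ! i)"
        and r = "\<lambda>a. \<Sum>i<n. z a ! i * (map a ps ! i + s\<^sub>1 ! i)"], goal_cases)
    case (8 a b)
    have H: "\<forall>v. v \<notin> set vs \<longrightarrow> a v = b v" using 8 unfolding img[OF len(4)] by blast
    have "map a ys = map b ys" "map a ps = map b ps" "map a qs = map b qs"
      by (simp_all only: agree[OF H dv(1)] agree[OF H dv(2)] agree[OF H dv(3)])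
    then show ?case by (simp only: z_def simp_thms)
  next
    case (9 a b)
    have H: "\<forall>v. v \<notin> set qs \<longrightarrow> b v = a v" using 9(1) unfolding img[OF len(6)] by blast
    have e: "map b ys = map a ys" "map b ps = map a ps"
      by (simp_all only: agree[OF H dq(1)] agree[OF H dq(2)])
    moreover have "map b qs = s\<^sub>2"
      using 9(2) s len by (intro nth_equalityI) simp_all
    ultimately show ?case by (simp only: z_def simp_thms)
  next
    case 10
    show ?case using dist unfolding img[OF len(4)] img[OF len(6)] by auto
  qed (use dv dd len in \<open>auto simp: img inj\<close>)

  \<comment> \<open>The duals are \<open>ys\<close> in the order given by \<open>\<pi>\<close>,
    since the \<open>i\<close>-th entry of \<open>z a\<close> contains \<open>ys ! \<pi> i\<close>
    and multiplies \<open>ps ! i + s\<^sub>1 ! i\<close>. The constant part of \<open>z a\<close>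
    goes into the remainder, which vanishes once \<open>ps\<close> carries
    \<open>s\<^sub>1\<close>.\<close>
  show ?thesis
  proof (rule reduces_elim[OF red2, where n = n and x = "\<lambda>i. ys ! \<pi> i" and w = "(!) ps" and q = "\<lambda>i. bconst (s\<^sub>1 ! i)"
        and r = "\<lambda>a. \<Sum>i<n. s\<^sub>2 ! \<pi> i * (map a ps ! i + s\<^sub>1 ! i)"])
    have img\<pi>: "(\<lambda>i. ys ! \<pi> i) ` {..<n} = set ys"
      using permutes_image[OF \<pi>] img[OF len(2)] by (metis image_image)
    show "inj_on (\<lambda>i. ys ! \<pi> i) {..<n}"
      using comp_inj_on[OF permutes_inj_on[OF \<pi>, of "{..<n}"], of "(!) ys"] inj[OF len(2) dd(2)]
      by (simp add: permutes_image[OF \<pi>] comp_def)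
    show "(\<lambda>i. ys ! \<pi> i) ` {..<n} \<inter> (!) ps ` {..<n} = {}" "(\<lambda>i. ys ! \<pi> i) ` {..<n} \<subseteq> set (ys @ ps)"
      "{} = set (ys @ ps) - (\<lambda>i. ys ! \<pi> i) ` {..<n} - (!) ps ` {..<n}"
      using dy unfolding img\<pi> img[OF len(5)] by auto
    show "(\<Sum>i<n. z a ! i * (map a ps ! i + s\<^sub>1 ! i)) = (\<Sum>i<n. a (ys ! \<pi> i) * (a (ps ! i) + eval a (bconst (s\<^sub>1 ! i))))
        + (\<Sum>i<n. s\<^sub>2 ! \<pi> i * (map a ps ! i + s\<^sub>1 ! i))" for a
      unfolding sum.distrib[symmetric] by (rule sum.cong) (simp_all add: zi distrib_right len)
    show "(\<Sum>i<n. s\<^sub>2 ! \<pi> i * (map a ps ! i + s\<^sub>1 ! i)) = (\<Sum>i<n. s\<^sub>2 ! \<pi> i * (map b ps ! i + s\<^sub>1 ! i)) \<and>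
        map a ps @ s\<^sub>2 = map b ps @ s\<^sub>2"
      if "\<And>v. v \<notin> (\<lambda>i. ys ! \<pi> i) ` {..<n} \<Longrightarrow> a v = b v" for a b
    proof -
      have "\<forall>v. v \<notin> set ys \<longrightarrow> a v = b v" using that unfolding img\<pi> by blast
      from agree[OF this dy] show ?thesis by (simp only: simp_thms)
    qed
    show "(\<Sum>i<n. s\<^sub>2 ! \<pi> i * (map b ps ! i + s\<^sub>1 ! i)) = 0 \<and> map b ps @ s\<^sub>2 = s\<^sub>1 @ s\<^sub>2"
      if "\<And>i. i < n \<Longrightarrow> b (ps ! i) = eval b (bconst (s\<^sub>1 ! i))" for b
    proof -
      have "map b ps = s\<^sub>1"
        using that s len by (intro nth_equalityI) simp_all
      then show ?thesis by simp
    qed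
  qed (use len dd in \<open>auto simp: img inj\<close>)
qed

theorem hidden_shift_rewrites:
  assumes "hidden_shift_circuit m n \<pi> f\<^sub>0 s\<^sub>1 s\<^sub>2 C"
  shows "rewrite\<^sup>*\<^sup>* (interp C \<circ>\<^sub>P ket (replicate (2 * n) 0)) (ket (s\<^sub>1 @ s\<^sub>2))"
proof -
  let ?H = "all_Had (2 * n)"
  let ?g = "\<lambda>x y. inner_prod (vec_add x s\<^sub>1) (permute_list \<pi> (vec_add y s\<^sub>2)) + f\<^sub>0 (vec_add y s\<^sub>2)"
  let ?f = "\<lambda>x y. inner_prod x (permute_list \<pi> y) + f\<^sub>0 (permute_list (inv \<pi>) x)"
  obtain G F where \<pi>: "\<pi> permutes {..<n}" and s: "length s\<^sub>1 = n" "length s\<^sub>2 = n"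
    and G: "implements_phase_oracle m n ?g G" and F: "implements_phase_oracle m n ?f F"
    and C: "C = Seq ?H (Seq G (Seq ?H (Seq F ?H)))"
    using assms unfolding hidden_shift_circuit_def by blast
  have GF: "matched G" "width G = 2 * n" "Had \<notin> set (gates G)" "matched F" "width F = 2 * n" "Had \<notin> set (gates F)"
    using G F matched_if_well_formed by (auto simp: implements_phase_oracle_def)
  then have m: "matched C" and w: "width C = 2 * n" by (simp_all add: C)
  \<comment> \<open>Later layers are numbered first, so the last Hadamard layer starts at 0, and
    these numbers are the first variables of \<open>F\<close>, the middle layer, \<open>G\<close>
    and the first layer.\<close>
  define d3 where "d3 = nvars ?H"
  define d2 where "d2 = nvars (Seq F ?H)"
  define d2' where "d2' = nvars (Seq ?H (Seq F ?H))"
  define d1 where "d1 = nvars (Seq G (Seq ?H (Seq F ?H)))"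
  define h1 h2 h3 where "h1 = had_vars ?H d1" and "h2 = had_vars ?H d2" and "h3 = had_vars ?H 0"
  note ds = d1_def[symmetric] d2'_def[symmetric] d2_def[symmetric] d3_def[symmetric]
  have had: "had_vars C 0 = h1 @ h2 @ h3"
    by (simp only: C had_vars.simps had_vars_classical[OF GF(3)] had_vars_classical[OF GF(6)]
        append_Nil add_0 ds h1_def h2_def h3_def)
  have lh: "length h1 = 2 * n" "length h2 = 2 * n" "length h3 = 2 * n"
    by (simp_all add: h1_def h2_def h3_def)
  define xs ys us vs ps qs where "xs = take n h1" and "ys = drop n h1" and "us = take n h2" and "vs = drop n h2"
    and "ps = take n h3" and "qs = drop n h3"
  have hs: "h1 = xs @ ys" "h2 = us @ vs" "h3 = ps @ qs"
    by (simp_all add: xs_def ys_def us_def vs_def ps_def qs_def)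
  have len: "length xs = n" "length ys = n" "length us = n" "length vs = n" "length ps = n" "length qs = n"
    using lh by (simp_all add: xs_def ys_def us_def vs_def ps_def qs_def)
  have dist: "distinct (xs @ ys @ us @ vs @ ps @ qs)"
    using distinct_vars(1)[OF m, of 0] unfolding had hs by simp
  have "reduces (interp C \<circ>\<^sub>P ket (replicate (width C) 0)) (set (had_vars C 0))
      (\<lambda>a. ?g (map a xs) (map a ys) + (inner_prod (map a xs) (map a us) + inner_prod (map a ys) (map a vs))
         + ?f (map a us) (map a vs)
         + (inner_prod (map a us) (map a ps) + inner_prod (map a vs) (map a qs)))
      (\<lambda>a. map a ps @ map a qs)"
  proof (rule interp_ket_reduces[OF m])
    fix a b :: "nat \<Rightarrow> bit"
    assume ab: "\<And>v. v \<in> set (had_vars C 0) \<Longrightarrow> b v = a v" and cons: "consistent b (links C 0)"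
      and ins: "map b (in_vars C 0) = replicate (width C) 0"
    have H: "map (\<lambda>p. eval b (list_poly p)) (out_mons ?H d) = map b (had_vars ?H d)" for d
      by (simp add: out_mons_all_Had comp_def)
    have h: "map b h1 = map a xs @ map a ys" "map b h2 = map a us @ map a vs" "map b h3 = map a ps @ map a qs"
      using ab unfolding had hs by (auto simp: map_eq_conv)
    have c: "map b (in_vars G d2') = map b h1"
      "map b (in_vars ?H d2) = map (\<lambda>p. eval b (list_poly p)) (out_mons G d2')"
      "map b (in_vars F d3) = map b h2"
      "map b (in_vars ?H 0) = map (\<lambda>p. eval b (list_poly p)) (out_mons F d3)"
      "consistent b (links G d2')" "consistent b (links F d3)"
      using cons GF unfolding C links.simps in_vars.simps out_mons.simps add_0 ds consistent_append
      by (simp_all add: consistent_zip_links H[unfolded comp_def] h1_def h2_def comp_def)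
    have outG: "map (\<lambda>p. eval b (list_poly p)) (out_mons G d2') = map b h1"
      and phG: "eval b (gate_phase G d2') = ?g (map a xs) (map a ys)"
      using consistent_outs[OF GF(1,3) c(5)] phase_oracle_act[OF G, of "map a xs" "map a ys"]
      unfolding c(1) h using len by simp_all
    have outF: "map (\<lambda>p. eval b (list_poly p)) (out_mons F d3) = map b h2"
      and phF: "eval b (gate_phase F d3) = ?f (map a us) (map a vs)"
      using consistent_outs[OF GF(4,6) c(6)] phase_oracle_act[OF F, of "map a us" "map a vs"]
      unfolding c(3) h using len by simp_all
    have "eval b (gate_phase C 0) = inner_prod (map b (in_vars ?H d1)) (map b h1) + (eval b (gate_phase G d2')
        + (inner_prod (map b (in_vars ?H d2)) (map b h2) + (eval b (gate_phase F d3)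
        + inner_prod (map b (in_vars ?H 0)) (map b h3))))"
      unfolding C gate_phase.simps add_0 ds eval_add eval_gate_phase_all_Had h1_def h2_def h3_def by (rule refl)
    \<comment> \<open>The first layer reads \<open>|0...0>\<close>, so its own phase
      vanishes.\<close>
    moreover have "map b (in_vars ?H d1) = replicate (2 * n) 0"
      using ins unfolding w unfolding C in_vars.simps add_0 ds .
    ultimately have "eval b (gate_phase C 0) = ?g (map a xs) (map a ys)
        + (inner_prod (map a xs) (map a us) + inner_prod (map a ys) (map a vs)) + ?f (map a us) (map a vs)
        + (inner_prod (map a us) (map a ps) + inner_prod (map a vs) (map a qs))"
      unfolding c(2,4) outG outF phG phF h using len
      by (simp only: inner_prod_replicate_0 inner_prod_append length_map add_0 add.assoc)
    moreover have "map (\<lambda>p. eval b (list_poly p)) (out_mons C 0) = map a ps @ map a qs"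
      using H[of 0] h(3) unfolding C out_mons.simps h3_def by simp
    ultimately show "eval b (gate_phase C 0) = ?g (map a xs) (map a ys)
        + (inner_prod (map a xs) (map a us) + inner_prod (map a ys) (map a vs)) + ?f (map a us) (map a vs)
        + (inner_prod (map a us) (map a ps) + inner_prod (map a vs) (map a qs)) \<and>
        map (\<lambda>p. eval b (list_poly p)) (out_mons C 0) = map a ps @ map a qs"
      by blast
  qed
  then have "reduces (interp C \<circ>\<^sub>P ket (replicate (2 * n) 0)) {} (\<lambda>_. 0) (\<lambda>_. s\<^sub>1 @ s\<^sub>2)"
    unfolding w had hs append_assoc by (intro hidden_shift_phase_reduces[OF \<pi> s len dist])
  then show ?thesis by (rule reduces_ket)
qed

section \<open>A program computing the path sum\<close>

text \<open>Upper bounds in place of exact times can be weakened, so the arithmetic is done once, at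
  the end of each run.\<close>

definition runs :: "program \<Rightarrow> tree list \<Rightarrow> expr \<Rightarrow> tree \<Rightarrow> nat \<Rightarrow> bool"
  where "runs prog env e v B \<longleftrightarrow> (\<exists>T\<le>B. evaluates prog env e T v)"

definition runs_list :: "program \<Rightarrow> tree list \<Rightarrow> expr list \<Rightarrow> tree list \<Rightarrow> nat \<Rightarrow> bool"
  where "runs_list prog env es vs B \<longleftrightarrow> (\<exists>T\<le>B. evaluates_list prog env es T vs)"

lemma runs_Var: "i < length env \<Longrightarrow> env ! i = v \<Longrightarrow> runs prog env (Var i) v 1"
  unfolding runs_def using evaluates_evaluates_list.intros(1) by blast

lemma runs_LeafE: "runs prog env LeafE Leaf 1"
  unfolding runs_def using evaluates_evaluates_list.intros(2) by blast

lemma runs_NodeE: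
  "runs prog env a u B \<Longrightarrow> runs prog env b v B' \<Longrightarrow> runs prog env (NodeE a b) (Node u v) (B + B' + 1)"
  unfolding runs_def using evaluates_evaluates_list.intros(3) by (meson add_le_mono le_refl)

text \<open>The programs inspect variables only, so an inspection costs 2: one for the variable and
  one for the \<open>Case\<close>.\<close>

lemma runs_Case:
  assumes "i < length env"
    and "case env ! i of Leaf \<Rightarrow> runs prog env a v B | Node l r \<Rightarrow> runs prog (l # r # env) b v B"
  shows "runs prog env (Case (Var i) a b) v (B + 2)"
proof (cases "env ! i")
  case Leaf
  then obtain T where T: "T \<le> B" "evaluates prog env a T v"
    using assms(2) by (auto simp: runs_def)
  have "evaluates prog env (Var i) 1 Leaf"
    using evaluates_evaluates_list.intros(1)[OF assms(1)] by (simp add: Leaf)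
  from evaluates_evaluates_list.intros(4)[OF this T(2)] show ?thesis
    unfolding runs_def using T(1) by (intro exI[of _ "1 + T + 1"]) auto
next
  case (Node l r)
  then obtain T where T: "T \<le> B" "evaluates prog (l # r # env) b T v"
    using assms(2) by (auto simp: runs_def)
  have "evaluates prog env (Var i) 1 (Node l r)"
    using evaluates_evaluates_list.intros(1)[OF assms(1)] by (simp add: Node)
  from evaluates_evaluates_list.intros(5)[OF this T(2)] show ?thesis
    unfolding runs_def using T(1) by (intro exI[of _ "1 + T + 1"]) auto
qed

lemma runs_Call:
  "f < length prog \<Longrightarrow> runs_list prog env es vs B \<Longrightarrow> runs prog vs (prog ! f) v B' \<Longrightarrow>
    runs prog env (Call f es) v (B + B' + 1)"
  unfolding runs_def runs_list_def
  using evaluates_evaluates_list.intros(6) by (meson add_le_mono le_refl)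

lemma runs_list_Nil: "runs_list prog env [] [] 0"
  unfolding runs_list_def using evaluates_evaluates_list.intros(7) by blast

lemma runs_list_Cons:
  "runs prog env e v B \<Longrightarrow> runs_list prog env es vs B' \<Longrightarrow> runs_list prog env (e # es) (v # vs) (B + B')"
  unfolding runs_def runs_list_def using evaluates_evaluates_list.intros(8) by (meson add_le_mono)

lemma runs_weaken: "runs prog env e v B \<Longrightarrow> v = v' \<Longrightarrow> B \<le> B' \<Longrightarrow> runs prog env e v' B'"
  unfolding runs_def by (meson le_trans)

lemmas runs_intros = runs_LeafE runs_NodeE runs_Case runs_Call runs_list_Nil runs_list_Cons

section \<open>The program\<close>

definition "f_add = (1::nat)"
definition "f_app = (2::nat)"
definition "f_pre = (3::nat)"
definition "f_link = (4::nat)"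
definition "f_range = (5::nat)"
definition "f_single = (6::nat)"
definition "f_vars = (7::nat)"
definition "f_gate = (8::nat)"
definition "f_gen = (9::nat)"
definition "f_seq1 = (10::nat)"
definition "f_seq2 = (11::nat)"
definition "f_par1 = (12::nat)"
definition "f_par2 = (13::nat)"
definition "f_fin = (14::nat)"

abbreviation SucE :: "expr \<Rightarrow> expr" where "SucE e \<equiv> NodeE LeafE e"
abbreviation SingleE :: "expr \<Rightarrow> expr" where "SingleE e \<equiv> NodeE e LeafE"
abbreviation TupE :: "expr \<Rightarrow> expr \<Rightarrow> expr \<Rightarrow> expr \<Rightarrow> expr \<Rightarrow> expr"
  where "TupE y k P Os Is \<equiv> NodeE y (NodeE k (NodeE P (NodeE Os Is)))"

text \<open>In the last argument of \<open>UntupE i\<close> the components \<open>y, k, P, Os, Is\<close> of the tuple in variable \<open>i\<close>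
  have the indices \<open>6, 4, 2, 0, 1\<close>, and all other variables are shifted by \<open>8\<close>.\<close>

abbreviation UntupE :: "nat \<Rightarrow> expr \<Rightarrow> expr"
  where "UntupE i e \<equiv> Case (Var i) LeafE (Case (Var 1) LeafE (Case (Var 1) LeafE (Case (Var 1) LeafE e)))"

text \<open>
  The arguments are, in the order of the de Bruijn indices: a list or unary number and a number for \<open>add\<close>; two lists for
  \<open>app\<close>; a variable, monomials and an accumulator for \<open>pre\<close>; the first dual variable, sources, targets and an
  accumulator for \<open>link\<close>; start and length for \<open>range\<close> and \<open>single\<close>; a gate or circuit, the next fresh variable \<open>y\<close>,
  the exponent \<open>k\<close> and the phase \<open>P\<close> so far for \<open>gate\<close> and \<open>gen\<close>; the other component and the tuple of the
  component already processed for \<open>seq1\<close> and \<open>par1\<close>; outputs and inputs of the component processed first and the tuple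
  of the other one for \<open>seq2\<close> and \<open>par2\<close>.
\<close>

definition "main_body = Call f_fin [Call f_gen [Var 0, LeafE, LeafE, LeafE]]"
definition "add_body = Case (Var 0) (Var 1) (SucE (Call f_add [Var 1, Var 3]))"
definition "app_body = Case (Var 0) (Var 1) (NodeE (Var 0) (Call f_app [Var 1, Var 3]))"
definition "pre_body = Case (Var 1) (Var 2) (NodeE (NodeE (Var 2) (Var 0)) (Call f_pre [Var 2, Var 1, Var 4]))"
definition "link_body = Case (Var 1) (Var 3) (Case (Var 4) (Var 5)
      (NodeE (NodeE (Var 4) (SingleE (Var 0)))
        (Call f_pre [Var 4, Var 2, Call f_link [SucE (Var 4), Var 3, Var 1, Var 7]])))"
definition "range_body = Case (Var 1) LeafE (NodeE (Var 2) (Call f_range [SucE (Var 2), Var 1]))"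
definition "single_body = Case (Var 1) LeafE (NodeE (SingleE (SingleE (Var 2))) (Call f_single [SucE (Var 2), Var 1]))"
definition "vars_body = Case (Var 0) LeafE (NodeE (Var 1) (Call f_vars [Var 1]))"
text \<open>Tags are unary, so each nested \<open>Case\<close> on the tag peels off one
  \<open>Node\<close>. The outermost \<open>LeafE\<close> is a default that no encoding
  reaches.\<close>

definition "gate_body = Case (Var 0) LeafE (Case (Var 0)
      (TupE (SucE (SucE (Var 3))) (SucE (Var 4)) (NodeE (NodeE (Var 3) (SingleE (SucE (Var 3)))) (Var 5))
        (SingleE (SingleE (SingleE (SucE (Var 3))))) (SingleE (Var 3)))
      (Case (Var 1)
        (TupE (SucE (Var 5)) (Var 6) (Var 7)
          (SingleE (NodeE (SingleE (Var 5)) (SingleE LeafE))) (SingleE (Var 5)))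
        (Case (Var 1)
          (TupE (SucE (SucE (Var 7))) (Var 8) (Var 9)
            (NodeE (SingleE (SingleE (SucE (Var 7)))) (SingleE (SingleE (SingleE (Var 7)))))
            (NodeE (Var 7) (SingleE (SucE (Var 7)))))
          (TupE (Call f_add [SucE (Var 7), Var 9]) (Var 10) (NodeE (Call f_range [Var 9, SucE (Var 7)]) (Var 11))
            (Call f_single [Var 9, SucE (Var 7)]) (Call f_range [Var 9, SucE (Var 7)])))))"
definition "gen_body = Case (Var 0) LeafE (Case (Var 0)
      (Call f_gate [Var 1, Var 3, Var 4, Var 5])
      (Case (Var 1)
        (TupE (Call f_add [Var 3, Var 5]) (Var 6) (Var 7)
          (Call f_single [Var 5, Var 3]) (Call f_range [Var 5, Var 3]))
        (Case (Var 1)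
          (Case (Var 5) LeafE (Call f_seq1 [Var 0, Call f_gen [Var 1, Var 9, Var 10, Var 11]]))
          (Case (Var 7) LeafE (Call f_par1 [Var 1, Call f_gen [Var 0, Var 11, Var 12, Var 13]])))))"
text \<open>The language has no local binding. Passing an intermediate result to an auxiliary
  function binds it, so each recursive call is run only once.\<close>

definition "seq1_body = UntupE 1 (Call f_seq2 [Var 0, Var 1, Call f_gen [Var 8, Var 6, Var 4, Var 2]])"
definition "seq2_body = UntupE 2 (TupE (Call f_add [Var 9, Var 6]) (Call f_add [Var 9, Call f_add [Var 9, Var 4]])
      (Call f_link [Var 6, Var 0, Var 9, Var 2]) (Var 8) (Var 1))"
definition "par1_body = UntupE 1 (Call f_par2 [Var 0, Var 1, Call f_gen [Var 8, Var 6, Var 4, Var 2]])"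
definition "par2_body = UntupE 2 (TupE (Var 6) (Var 4) (Var 2) (Call f_app [Var 8, Var 0]) (Call f_app [Var 9, Var 1]))"
text \<open>The unary number of inputs doubles as a list of that many empty polynomials, which are
  the sources of the input links.\<close>

definition "fin_body = UntupE 0 (NodeE (Call f_add [Var 1, Call f_add [Var 1, Var 4]])
      (NodeE (Call f_vars [Call f_add [Var 1, Var 6]])
        (NodeE (Call f_link [Var 6, Call f_add [Var 1, LeafE], Var 1, Var 2])
          (NodeE (Var 0) (SingleE LeafE)))))"

definition circuit_program :: program
  where "circuit_program = [main_body, add_body, app_body, pre_body, link_body, range_body, single_body, vars_body, gate_body, gen_body, seq1_body, seq2_body, par1_body, par2_body, fin_body]"

lemmas f_defs = f_add_def f_app_def f_pre_def f_link_def f_range_def f_single_def f_vars_def f_gate_def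
  f_gen_def f_seq1_def f_seq2_def f_par1_def f_par2_def f_fin_def

lemma f_less_length [simp]: "f_add < length circuit_program" "f_app < length circuit_program"
  "f_pre < length circuit_program" "f_link < length circuit_program" "f_range < length circuit_program"
  "f_single < length circuit_program" "f_vars < length circuit_program" "f_gate < length circuit_program"
  "f_gen < length circuit_program" "f_seq1 < length circuit_program" "f_seq2 < length circuit_program"
  "f_par1 < length circuit_program" "f_par2 < length circuit_program" "f_fin < length circuit_program"
  by (simp_all add: circuit_program_def f_defs)

lemma bodies: "circuit_program ! 0 = main_body"
  "circuit_program ! f_add = add_body"
  "circuit_program ! f_app = app_body"
  "circuit_program ! f_pre = pre_body"
  "circuit_program ! f_link = link_body"
  "circuit_program ! f_range = range_body"
  "circuit_program ! f_single = single_body"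
  "circuit_program ! f_vars = vars_body"
  "circuit_program ! f_gate = gate_body"
  "circuit_program ! f_gen = gen_body"
  "circuit_program ! f_seq1 = seq1_body"
  "circuit_program ! f_seq2 = seq2_body"
  "circuit_program ! f_par1 = par1_body"
  "circuit_program ! f_par2 = par2_body"
  "circuit_program ! f_fin = fin_body"
  by (simp_all add: circuit_program_def f_defs)

section \<open>Correctness and cost of the subroutines\<close>

abbreviation enc_nats :: "nat list \<Rightarrow> tree"
  where "enc_nats ns \<equiv> enc_list (map enc_nat ns)"

abbreviation enc_polys :: "nat list list list \<Rightarrow> tree"
  where "enc_polys ps \<equiv> enc_list (map enc_monomials ps)"

abbreviation enc_result :: "nat \<Rightarrow> nat \<Rightarrow> nat list list \<Rightarrow> nat list list list \<Rightarrow> nat list \<Rightarrow> tree"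
  where "enc_result y k P Os Is \<equiv>
    Node (enc_nat y) (Node (enc_nat k) (Node (enc_monomials P) (Node (enc_polys Os) (enc_nats Is))))"

lemma enc_monomials_simps [simp]: "enc_monomials [] = Leaf"
  "enc_monomials (m # ms) = Node (enc_nats m) (enc_monomials ms)"
  by (simp_all add: enc_monomials_def)

lemma enc_nat_list: "enc_nat k = enc_list (replicate k Leaf)"
  by (induction k) simp_all

text \<open>A unary number is encoded as a list of leaves, so adding a list adds its length.\<close>

lemma run_add:
  "runs circuit_program [enc_list ts, enc_nat y] (circuit_program ! f_add)
    (enc_nat (y + length ts)) (8 * length ts + 3)"
proof (induction ts)
  case Nil
  show ?case
    \<comment> \<open>\<open>runs_weaken\<close> leaves result and bound open; the rules for
      evaluation fill them in, and simplification compares them with the claim. All runs below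
      follow this scheme.\<close>
    by (rule runs_weaken, unfold bodies add_body_def,
        ((rule runs_intros) | (rule runs_Var, simp, simp) | simp)+)
next
  case (Cons t ts)
  show ?case
    by (rule runs_weaken, unfold bodies add_body_def,
        ((rule runs_intros Cons.IH) | (rule runs_Var, simp, simp) | simp)+)
qed

lemma run_add_nat:
  "runs circuit_program [enc_nat k, enc_nat y] (circuit_program ! f_add)
    (enc_nat (y + k)) (8 * k + 3)"
  using run_add[of "replicate k Leaf" y] by (simp add: enc_nat_list[of k])

lemma run_app:
  "runs circuit_program [enc_list xs, enc_list ys] (circuit_program ! f_app)
    (enc_list (xs @ ys)) (8 * length xs + 3)"
proof (induction xs)
  case Nil
  show ?case
    by (rule runs_weaken, unfold bodies app_body_def,
        ((rule runs_intros) | (rule runs_Var, simp, simp) | simp)+)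
next
  case (Cons x xs)
  show ?case
    by (rule runs_weaken, unfold bodies app_body_def,
        ((rule runs_intros Cons.IH) | (rule runs_Var, simp, simp) | simp)+)
qed

lemma run_pre:
  "runs circuit_program [enc_nat y, enc_monomials p, enc_monomials P] (circuit_program ! f_pre)
    (enc_monomials (map ((#) y) p @ P)) (11 * length p + 3)"
proof (induction p)
  case Nil
  show ?case
    by (rule runs_weaken, unfold bodies pre_body_def,
        ((rule runs_intros) | (rule runs_Var, simp, simp) | simp)+)
next
  case (Cons m p)
  show ?case
    by (rule runs_weaken, unfold bodies pre_body_def,
        ((rule runs_intros Cons.IH) | (rule runs_Var, simp, simp) | simp)+)
qed

text \<open>A source of an output wire has at most two monomials, so \<open>pre\<close> takes
  bounded time per wire and the total is linear.\<close>

lemma run_link: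
  "\<forall>p\<in>set ps. length p \<le> 2 \<Longrightarrow> runs circuit_program [enc_nat y, enc_polys ps, enc_nats ws, enc_monomials P] (circuit_program ! f_link)
    (enc_monomials (link_mons y ps ws @ P)) (60 * length ws + 5)"
proof (induction y ps ws rule: link_mons.induct)
  case (1 y p ps w ws)
  then have "length p \<le> 2" and IH: "\<forall>p\<in>set ps. length p \<le> 2" by simp_all
  note IH = 1(1)[OF IH, unfolded enc_nat.simps]
  from \<open>length p \<le> 2\<close> show ?case
    by - (rule runs_weaken, unfold bodies link_body_def,
        ((rule runs_intros IH run_pre) | (rule runs_Var, simp, simp) | simp)+)
next
  case ("2_1" y ws)
  show ?case
    by (rule runs_weaken, unfold bodies link_body_def,
        ((rule runs_intros) | (rule runs_Var, simp, simp) | simp)+)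
next
  case ("2_2" y ps)
  show ?case
  proof (cases ps)
    case Nil
    show ?thesis
      unfolding Nil
      by (rule runs_weaken, unfold bodies link_body_def,
          ((rule runs_intros) | (rule runs_Var, simp, simp) | simp)+)
  next
    case (Cons p ps')
    show ?thesis
      unfolding Cons
      by (rule runs_weaken, unfold bodies link_body_def,
          ((rule runs_intros) | (rule runs_Var, simp, simp) | simp)+)
  qed
qed

lemma run_range:
  "runs circuit_program [enc_nat v, enc_nat k] (circuit_program ! f_range)
    (enc_nats [v..<v + k]) (14 * k + 3)"
proof (induction k arbitrary: v)
  case 0
  show ?case
    by (rule runs_weaken, unfold bodies range_body_def,
        ((rule runs_intros) | (rule runs_Var, simp, simp) | simp)+)
next
  case (Suc k)
  note IH = Suc[of "Suc v", unfolded enc_nat.simps]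
  show ?case
    by (rule runs_weaken, unfold bodies range_body_def,
        ((rule runs_intros IH) | (rule runs_Var, simp, simp) | simp add: upt_conv_Cons del: upt_Suc)+)
qed

lemma run_single:
  "runs circuit_program [enc_nat v, enc_nat k] (circuit_program ! f_single)
    (enc_polys (map (\<lambda>v. [[v]]) [v..<v + k])) (14 * k + 3)"
proof (induction k arbitrary: v)
  case 0
  show ?case
    by (rule runs_weaken, unfold bodies single_body_def,
        ((rule runs_intros) | (rule runs_Var, simp, simp) | simp)+)
next
  case (Suc k)
  note IH = Suc[of "Suc v", unfolded enc_nat.simps]
  show ?case
    by (rule runs_weaken, unfold bodies single_body_def,
        ((rule runs_intros IH) | (rule runs_Var, simp, simp) | simp add: upt_conv_Cons del: upt_Suc)+)
qed

lemma run_vars: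
  "runs circuit_program [enc_nat n] (circuit_program ! f_vars)
    (enc_nats (rev [0..<n])) (8 * n + 3)"
proof (induction n)
  case 0
  show ?case
    by (rule runs_weaken, unfold bodies vars_body_def,
        ((rule runs_intros) | (rule runs_Var, simp, simp) | simp)+)
next
  case (Suc n)
  show ?case
    by (rule runs_weaken, unfold bodies vars_body_def,
        ((rule runs_intros Suc.IH) | (rule runs_Var, simp, simp) | simp)+)
qed

text \<open>Charges each node for the lists processed there: \<open>width B\<close> for the links of
  a \<open>Seq\<close>, \<open>width A\<close> for the lists copied in a \<open>Par\<close>.\<close>

fun gcost :: "circuit \<Rightarrow> nat" where
  "gcost (Gate g) = arity g + 1"
| "gcost (Idle k) = k + 1"
| "gcost (Seq A B) = gcost A + gcost B + width B + 1"
| "gcost (Par A B) = gcost A + gcost B + width A + 1"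

lemma gcost_pos: "1 \<le> gcost C"
  by (cases C) simp_all

lemma run_gate:
  "runs circuit_program [enc_gate g, enc_nat y, enc_nat k, enc_monomials P] (circuit_program ! f_gate)
    (enc_result (y + nvars (Gate g)) (k + root_exp (Gate g)) (phase_mons (Gate g) y @ P)
      (out_mons (Gate g) y) (in_vars (Gate g) y)) (100 * gcost (Gate g))"
proof (cases g)
  case Had
  then show ?thesis
    by - (rule runs_weaken, unfold bodies gate_body_def,
        ((rule runs_intros) | (rule runs_Var, simp, simp) | simp add: numeral_2_eq_2 numeral_3_eq_3)+)
next
  case NotX
  then show ?thesis
    by - (rule runs_weaken, unfold bodies gate_body_def,
        ((rule runs_intros) | (rule runs_Var, simp, simp) | simp add: numeral_2_eq_2 numeral_3_eq_3)+)
next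
  case Swap
  then show ?thesis
    by - (rule runs_weaken, unfold bodies gate_body_def,
        ((rule runs_intros) | (rule runs_Var, simp, simp) | simp add: numeral_2_eq_2 numeral_3_eq_3)+)
next
  case (CtrlZ j)
  note specs = run_range[of y "Suc j", unfolded enc_nat.simps] run_single[of y "Suc j", unfolded enc_nat.simps]
    run_add_nat[of "Suc j" y, unfolded enc_nat.simps]
  from CtrlZ show ?thesis
    by - (rule runs_weaken, unfold bodies gate_body_def,
        ((rule runs_intros specs) | (rule runs_Var, simp, simp) | simp add: numeral_2_eq_2 numeral_3_eq_3 del: upt_Suc)+)
qed

lemma add_twice: "k + l + l = k + 2 * (l :: nat)"
  by simp

lemma run_seq2:
  "\<forall>p\<in>set Os. length p \<le> 2 \<Longrightarrow>
    runs circuit_program [enc_polys Os', enc_nats Is', enc_result y k P Os Is] (circuit_program ! f_seq2)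
    (enc_result (y + length Is') (k + 2 * length Is') (link_mons y Os Is' @ P) Os' Is) (100 * length Is' + 100)"
  by (rule runs_weaken, unfold bodies seq2_body_def,
      ((rule runs_intros run_add[of "map enc_nat Is'"] run_link) | (rule runs_Var, simp, simp) | simp add: add_twice)+)

lemma run_par2:
  "runs circuit_program [enc_polys Os', enc_nats Is', enc_result y k P Os Is] (circuit_program ! f_par2)
    (enc_result y k P (Os' @ Os) (Is' @ Is)) (10 * length Os' + 10 * length Is' + 100)"
  by (rule runs_weaken, unfold bodies par2_body_def,
      ((rule runs_intros run_app[of "map enc_monomials Os'"] run_app[of "map enc_nat Is'"]) | (rule runs_Var, simp, simp) | simp)+)

lemma length_out_mons_le: "matched C \<Longrightarrow> \<forall>p\<in>set (out_mons C d). length p \<le> 2"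
  using out_mons_affine[of C _ d] by (fastforce simp: affine_def)

text \<open>Start variable, exponent and phase are arbitrary because each component continues from
  those left by the other. The \<open>+ 1\<close> of \<open>gcost\<close> at every node pays for the
  constant overhead of the calls.\<close>

lemma run_gen:
  "matched C \<Longrightarrow> runs circuit_program [enc_circuit C, enc_nat y, enc_nat k, enc_monomials P] (circuit_program ! f_gen)
    (enc_result (y + nvars C) (k + root_exp C) (phase_mons C y @ P) (out_mons C y) (in_vars C y)) (300 * gcost C)"
proof (induction C arbitrary: y k P)
  case (Gate g)
  show ?case
    using gcost_pos[of "Gate g"]
    by - (rule runs_weaken, unfold bodies gen_body_def,
        ((rule runs_intros run_gate) | (rule runs_Var, simp, simp) | simp del: gcost.simps phase_mons.simps out_mons.simps in_vars.simps nvars.simps root_exp.simps)+)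
next
  case (Idle j)
  show ?case
    by (rule runs_weaken, unfold bodies gen_body_def,
        ((rule runs_intros run_range run_single run_add_nat) | (rule runs_Var, simp, simp) | simp add: numeral_2_eq_2)+)
next
  case (Seq A B)
  then have m: "matched A" "matched B" "width A = width B" by simp_all
  have seq1: "runs circuit_program [enc_circuit A, enc_result y k P Os Is] (circuit_program ! f_seq1)
      (enc_result (y + nvars A + length Is) (k + root_exp A + 2 * length Is)
        (link_mons (y + nvars A) (out_mons A y) Is @ phase_mons A y @ P) Os (in_vars A y))
      (300 * gcost A + 100 * length Is + 150)" for y k P Os Is
    by (rule runs_weaken, unfold bodies seq1_body_def,
        ((rule runs_intros Seq.IH(1)[OF m(1)] run_seq2[OF length_out_mons_le[OF m(1)]]) | (rule runs_Var, simp, simp) | simp add: add_twice)+)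
  show ?case
    by (rule runs_weaken, unfold bodies gen_body_def,
        ((rule runs_intros Seq.IH(2)[OF m(2)] seq1) | (rule runs_Var, simp, simp) | simp add: m numeral_2_eq_2 numeral_3_eq_3 add.assoc)+)
next
  case (Par A B)
  then have m: "matched A" "matched B" by simp_all
  have par1: "runs circuit_program [enc_circuit B, enc_result y k P Os Is] (circuit_program ! f_par1)
      (enc_result (y + nvars B) (k + root_exp B) (phase_mons B y @ P) (Os @ out_mons B y) (Is @ in_vars B y))
      (300 * gcost B + 10 * length Os + 10 * length Is + 150)" for y k P Os Is
    by (rule runs_weaken, unfold bodies par1_body_def,
        ((rule runs_intros Par.IH(2)[OF m(2)] run_par2) | (rule runs_Var, simp, simp) | simp)+)
  show ?case
    by (rule runs_weaken, unfold bodies gen_body_def,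
        ((rule runs_intros Par.IH(1)[OF m(1)] par1) | (rule runs_Var, simp, simp) | simp add: m numeral_2_eq_2 numeral_3_eq_3 add.assoc)+)
qed

text \<open>The variables are listed downwards because the program counts down;
  \<open>represents\<close> accepts any order.\<close>

definition result_tree :: "circuit \<Rightarrow> tree" where
  "result_tree C = enc_list [enc_nat (root_exp C + 2 * width C), enc_nats (rev [0..<nvars C + width C]),
     enc_monomials (start_mons C), enc_polys (out_mons C 0), enc_list []]"

lemma run_fin:
  "runs circuit_program [enc_result y k P Os Is] (circuit_program ! f_fin)
    (enc_list [enc_nat (k + 2 * length Is), enc_nats (rev [0..<y + length Is]),
      enc_monomials (link_mons y (replicate (length Is) []) Is @ P), enc_polys Os, enc_list []])
    (10 * y + 200 * length Is + 200)"
proof -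
  have link: "runs circuit_program [enc_nat y, enc_nat (length Is), enc_nats Is, enc_monomials P] (circuit_program ! f_link)
      (enc_monomials (link_mons y (replicate (length Is) []) Is @ P)) (60 * length Is + 5)"
    using run_link[of "replicate (length Is) []" y Is P] by (simp add: enc_nat_list)
  have add0: "runs circuit_program [enc_nats Is, Leaf] (circuit_program ! f_add) (enc_nat (length Is)) (8 * length Is + 3)"
    using run_add[of "map enc_nat Is" 0] by simp
  have add: "runs circuit_program [enc_nats Is, enc_nat x] (circuit_program ! f_add) (enc_nat (x + length Is))
      (8 * length Is + 3)" for x
    using run_add[of "map enc_nat Is" x] by simp
  show ?thesis
    by (rule runs_weaken, unfold bodies fin_body_def,
        ((rule runs_intros link add0 add run_vars) | (rule runs_Var, simp, simp) | simp add: add_twice)+)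
qed

lemma nvars_le_gcost: "nvars C \<le> gcost C"
proof (induction C)
  case (Gate g)
  then show ?case by (cases g) auto
qed auto

lemma computes_result_tree:
  assumes "matched C"
  obtains T where "computes circuit_program (enc_circuit C) T (result_tree C)"
    "T \<le> 310 * gcost C + 200 * width C + 300"
proof -
  note gen = run_gen[OF assms, of 0 0 "[]", simplified]
  note fin = run_fin[of "nvars C" "root_exp C" "phase_mons C 0" "out_mons C 0" "in_vars C 0",
      unfolded length_in_vars[OF assms]]
  have "runs circuit_program [enc_circuit C] (circuit_program ! 0) (result_tree C)
      (310 * gcost C + 200 * width C + 250)"
    unfolding result_tree_def start_mons_def using nvars_le_gcost[of C]
    by - (rule runs_weaken, unfold bodies main_body_def,
        ((rule runs_intros gen fin) | (rule runs_Var, simp, simp) | simp)+)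
  then have "runs circuit_program [enc_circuit C] (Call 0 [Var 0]) (result_tree C)
      (310 * gcost C + 200 * width C + 300)"
    by - (rule runs_weaken, rule runs_Call, simp add: circuit_program_def,
        ((rule runs_intros) | (rule runs_Var, simp, simp))+, (assumption | simp)+)
  then obtain T where T: "T \<le> 310 * gcost C + 200 * width C + 300"
    "evaluates circuit_program [enc_circuit C] (Call 0 [Var 0]) T (result_tree C)"
    unfolding runs_def by blast
  show thesis
    by (rule that[OF _ T(1)]) (use T(2) in \<open>simp add: computes_def\<close>)
qed

section \<open>Size and running time\<close>

lemma mon_poly_single: "mon_poly m = Poly_Mapping.single (Mon (fset_of_list m)) 1"
proof (induction m)
  case Nil
  show ?case by (simp flip: zero_monomial_def)
next
  case (Cons v m)
  then show ?case by (simp add: var_def mult_single plus_monomial_def)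
qed

lemma fset_of_list_eq: "fset_of_list m = fset_of_list m' \<longleftrightarrow> set m = set m'"
  by (metis fset_inverse fset_of_list.rep_eq)

lemma distinct_Mon_iff:
  "distinct (map (\<lambda>m. Mon (fset_of_list m)) ms) \<longleftrightarrow> distinct (map set ms)"
  by (simp add: distinct_map inj_on_def fset_of_list_eq)

text \<open>Equal monomials cancel in pairs over the two-element field; distinctness makes the
  support the whole list.\<close>

lemma keys_list_poly:
  "distinct (map set ms) \<Longrightarrow>
    Poly_Mapping.keys (list_poly ms) = (\<lambda>m. Mon (fset_of_list m)) ` set ms"
proof (induction ms)
  case (Cons m ms)
  let ?p = "Poly_Mapping.single (Mon (fset_of_list m)) (1 :: bit)"
  have IH: "Poly_Mapping.keys (list_poly ms) = (\<lambda>m. Mon (fset_of_list m)) ` set ms"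
    using Cons by simp
  have "Mon (fset_of_list m) \<notin> Poly_Mapping.keys (list_poly ms)"
    using Cons.prems by (auto simp: IH fset_of_list_eq)
  then have "Poly_Mapping.keys (?p + list_poly ms) = Poly_Mapping.keys ?p \<union> Poly_Mapping.keys (list_poly ms)"
    by (auto simp: in_keys_iff lookup_add lookup_single when_def split: if_splits)
  then show ?case by (simp add: mon_poly_single IH)
qed simp

lemma writes_list_poly:
  "\<forall>m\<in>set ms. distinct m \<Longrightarrow> distinct (map set ms) \<Longrightarrow> writes_bpoly ms (list_poly ms)"
  by (simp add: writes_bpoly_def distinct_Mon_iff keys_list_poly)

text \<open>The dual of a link lies in all of its monomials and in none of another link. Within a
  link, \<open>[y, w]\<close> and \<open>[y, v]\<close> differ because source and target differ. The
  case \<open>p = []\<close> is that of the input links.\<close>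

lemma link_mons_distinct:
  assumes "list_all2 (\<lambda>p w. w \<in> {a..<b} \<and> (p = [] \<or> (\<exists>v. affine p v \<and> v \<in> {a..<b} \<and> v \<noteq> w))) ps ws"
    and "b \<le> y"
  shows "distinct (map set (link_mons y ps ws)) \<and>
    (\<forall>m\<in>set (link_mons y ps ws). distinct m \<and>
      (\<exists>j\<in>{y..<y + length ws}. j \<in> set m \<and> set m \<subseteq> insert j {a..<b}))"
  using assms
proof (induction ps ws arbitrary: y rule: list_all2_induct)
  case (Cons p ps w ws)
  let ?new = "[y, w] # map ((#) y) p" and ?rest = "link_mons (Suc y) ps ws"
  have IH: "distinct (map set ?rest)"
    "\<And>m. m \<in> set ?rest \<Longrightarrow> distinct m \<and> (\<exists>j\<in>{Suc y..<Suc y + length ws}. j \<in> set m \<and> set m \<subseteq> insert j {a..<b})"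
    using Cons.IH[of "Suc y"] Cons.prems by auto
  have w: "a \<le> w" "w < b" and p: "p = [] \<or> (\<exists>v. affine p v \<and> v \<in> {a..<b} \<and> v \<noteq> w)" using Cons.hyps by auto
  have new: "distinct (map set ?new)" "\<forall>m\<in>set ?new. distinct m \<and> y \<in> set m \<and> set m \<subseteq> insert y {a..<b}"
    using w p Cons.prems by (auto simp: affine_def doubleton_eq_iff)
  have "y \<notin> set m" if "m \<in> set ?rest" for m
    using IH(2)[OF that] Cons.prems by fastforce
  then have "set ` set ?new \<inter> set ` set ?rest = {}"
    using new(2) by blast
  then have "distinct (map set (?new @ ?rest))"
    using new(1) IH(1) by (simp only: map_append distinct_append set_map simp_thms)
  moreover have "distinct m \<and> (\<exists>j\<in>{y..<y + length (w # ws)}. j \<in> set m \<and> set m \<subseteq> insert j {a..<b})"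
    if "m \<in> set (?new @ ?rest)" for m
  proof (cases "m \<in> set ?new")
    case True
    from bspec[OF new(2) this] have "distinct m" "y \<in> set m \<and> set m \<subseteq> insert y {a..<b}" by blast+
    then show ?thesis by (intro conjI bexI[of _ y]) simp_all
  next
    case False
    then have "m \<in> set ?rest" using that by simp
    from IH(2)[OF this] obtain j where "distinct m" "j \<in> {Suc y..<Suc y + length ws}"
      "j \<in> set m \<and> set m \<subseteq> insert j {a..<b}" by blast
    then show ?thesis by (intro conjI bexI[of _ j]) simp_all
  qed
  ultimately show ?case by simp
qed simp

lemma disjoint_images_set:
  assumes "\<forall>m\<in>set ms. m \<noteq> [] \<and> set m \<subseteq> A" "\<forall>m\<in>set ms'. set m \<subseteq> B" "A \<inter> B = {}"
  shows "set ` set ms \<inter> set ` set ms' = {}"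
proof -
  have False if "m \<in> set ms" "m' \<in> set ms'" "set m = set m'" for m m'
  proof -
    have "m \<noteq> [] \<and> set m \<subseteq> A" "set m' \<subseteq> B" using assms(1,2) that(1,2) by blast+
    then have "set m \<noteq> {}" "set m \<subseteq> A" "set m \<subseteq> B" unfolding that(3)[symmetric] by simp_all
    then show False using assms(3) by (metis Int_greatest subset_empty)
  qed
  then show ?thesis by blast
qed

text \<open>Components use disjoint intervals and link monomials contain a fresh dual. Nonemptiness
  is carried along because a constant monomial could occur in both components.\<close>

lemma phase_mons_distinct:
  "matched C \<Longrightarrow> distinct (map set (phase_mons C d)) \<and>
    (\<forall>m\<in>set (phase_mons C d). distinct m \<and> m \<noteq> [] \<and> set m \<subseteq> {d..<d + nvars C})"
proof (induction C arbitrary: d)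
  case (Gate g)
  show ?case by (cases g) auto
next
  case (Seq A B)
  have m: "matched A" "matched B" "width A = width B" using Seq.prems by auto
  let ?a = "d + nvars B" and ?b = "d + nvars B + nvars A"
  let ?L = "link_mons ?b (out_mons A ?a) (in_vars B d)"
  have "list_all2 (\<lambda>p w. w \<in> {d..<?b} \<and> (p = [] \<or> (\<exists>v. affine p v \<and> v \<in> {d..<?b} \<and> v \<noteq> w)))
      (out_mons A ?a) (in_vars B d)"
  proof (rule list_all2I)
    show "length (out_mons A ?a) = length (in_vars B d)" using m by simp
    show "\<forall>x\<in>set (zip (out_mons A ?a) (in_vars B d)).
      case x of (p, w) \<Rightarrow> w \<in> {d..<?b} \<and> (p = [] \<or> (\<exists>v. affine p v \<and> v \<in> {d..<?b} \<and> v \<noteq> w))"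
    proof (intro ballI, clarify)
      fix p w assume pw: "(p, w) \<in> set (zip (out_mons A ?a) (in_vars B d))"
      have "w \<in> set (in_vars B d)" using pw by (rule set_zip_rightD)
      then have "w \<in> {d..<?a}" using distinct_vars(2)[OF m(2), of d] by blast
      moreover obtain v where "affine p v" "v \<in> {?a..<?b}"
        using out_mons_affine[OF m(1) set_zip_leftD[OF pw]] by blast
      ultimately show "w \<in> {d..<?b} \<and> (p = [] \<or> (\<exists>v. affine p v \<and> v \<in> {d..<?b} \<and> v \<noteq> w))"
        by auto
    qed
  qed
  note L = link_mons_distinct[OF this order_refl, unfolded length_in_vars[OF m(2)]]
  then have L: "distinct (map set ?L)"
    "\<And>m. m \<in> set ?L \<Longrightarrow> distinct m"
    "\<And>m. m \<in> set ?L \<Longrightarrow> \<exists>j\<in>{?b..<?b + width B}. j \<in> set m \<and> set m \<subseteq> insert j {d..<?b}"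
    by blast+
  have dA: "distinct (map set (phase_mons A ?a))"
    and IHA: "\<forall>m\<in>set (phase_mons A ?a). distinct m \<and> m \<noteq> [] \<and> set m \<subseteq> {?a..<?b}"
    using Seq.IH(1)[OF m(1), of ?a] by blast+
  have dB: "distinct (map set (phase_mons B d))"
    and IHB: "\<forall>m\<in>set (phase_mons B d). distinct m \<and> m \<noteq> [] \<and> set m \<subseteq> {d..<?a}"
    using Seq.IH(2)[OF m(2), of d] by blast+
  have sub: "{?a..<?b} \<subseteq> {d..<?b}" "{d..<?a} \<subseteq> {d..<?b}" "{d..<?b} \<subseteq> {d..<d + nvars (Seq A B)}"
    by auto
  have "set ` set (phase_mons A ?a) \<inter> set ` set (phase_mons B d) = {}"
  proof (rule disjoint_images_set)
    show "\<forall>m\<in>set (phase_mons A ?a). m \<noteq> [] \<and> set m \<subseteq> {?a..<?b}" using IHA by blast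
    show "\<forall>m\<in>set (phase_mons B d). set m \<subseteq> {d..<?a}" using IHB by blast
  qed auto
  moreover have "set ` set ?L \<inter> set ` set (phase_mons A ?a @ phase_mons B d) = {}"
  proof -
    have "set m \<noteq> set m'" if m: "m \<in> set ?L" and m': "m' \<in> set (phase_mons A ?a @ phase_mons B d)" for m m'
    proof -
      obtain j where "j \<in> {?b..<?b + width B}" and j: "j \<in> set m" using L(3)[OF m] by blast
      then have "?b \<le> j" by simp
      from m' consider "m' \<in> set (phase_mons A ?a)" | "m' \<in> set (phase_mons B d)" by auto
      then have "set m' \<subseteq> {d..<?b}"
      proof cases
        case 1
        then have "set m' \<subseteq> {?a..<?b}" using IHA by blast
        then show ?thesis using sub(1) by (rule subset_trans)
      next
        case 2
        then have "set m' \<subseteq> {d..<?a}" using IHB by blast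
        then show ?thesis using sub(2) by (rule subset_trans)
      qed
      then have "j \<notin> set m'" using \<open>?b \<le> j\<close> by auto
      then show ?thesis using j by blast
    qed
    then show ?thesis by blast
  qed
  ultimately have "distinct (map set (phase_mons (Seq A B) d))"
    using L(1) dA dB by (simp add: image_Un)
  moreover have "distinct m \<and> m \<noteq> [] \<and> set m \<subseteq> {d..<d + nvars (Seq A B)}"
    if "m \<in> set (phase_mons (Seq A B) d)" for m
  proof -
    from that consider "m \<in> set ?L" | "m \<in> set (phase_mons A ?a)" | "m \<in> set (phase_mons B d)" by auto
    then show ?thesis
    proof cases
      case 1
      obtain j where j: "j \<in> {?b..<?b + width B}" "j \<in> set m" "set m \<subseteq> insert j {d..<?b}"
        using L(3)[OF 1] by blast
      have "insert j {d..<?b} \<subseteq> {d..<d + nvars (Seq A B)}" using j(1) by auto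
      then have "set m \<subseteq> {d..<d + nvars (Seq A B)}" using j(3) by (rule subset_trans[rotated])
      then show ?thesis using L(2)[OF 1] j(2) by auto
    next
      case 2
      then have m: "distinct m" "m \<noteq> []" "set m \<subseteq> {?a..<?b}" using IHA by blast+
      have "set m \<subseteq> {d..<d + nvars (Seq A B)}" using m(3) sub(1,3) by (metis subset_trans)
      then show ?thesis using m by blast
    next
      case 3
      then have m: "distinct m" "m \<noteq> []" "set m \<subseteq> {d..<?a}" using IHB by blast+
      have "set m \<subseteq> {d..<d + nvars (Seq A B)}" using m(3) sub(2,3) by (metis subset_trans)
      then show ?thesis using m by blast
    qed
  qed
  ultimately show ?case by blast
next
  case (Par A B)
  have m: "matched A" "matched B" using Par.prems by auto
  let ?a = "d + nvars A"
  have dA: "distinct (map set (phase_mons A d))"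
    and IHA: "\<forall>m\<in>set (phase_mons A d). distinct m \<and> m \<noteq> [] \<and> set m \<subseteq> {d..<?a}"
    using Par.IH(1)[OF m(1), of d] by blast+
  have dB: "distinct (map set (phase_mons B ?a))"
    and IHB: "\<forall>m\<in>set (phase_mons B ?a). distinct m \<and> m \<noteq> [] \<and> set m \<subseteq> {?a..<?a + nvars B}"
    using Par.IH(2)[OF m(2), of ?a] by blast+
  have sub: "{d..<?a} \<subseteq> {d..<d + nvars (Par A B)}" "{?a..<?a + nvars B} \<subseteq> {d..<d + nvars (Par A B)}"
    by auto
  have "set ` set (phase_mons B ?a) \<inter> set ` set (phase_mons A d) = {}"
  proof (rule disjoint_images_set)
    show "\<forall>m\<in>set (phase_mons B ?a). m \<noteq> [] \<and> set m \<subseteq> {?a..<?a + nvars B}" using IHB by blast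
    show "\<forall>m\<in>set (phase_mons A d). set m \<subseteq> {d..<?a}" using IHA by blast
  qed auto
  moreover have "distinct m \<and> m \<noteq> [] \<and> set m \<subseteq> {d..<d + nvars (Par A B)}"
    if "m \<in> set (phase_mons (Par A B) d)" for m
  proof -
    from that consider "m \<in> set (phase_mons A d)" | "m \<in> set (phase_mons B ?a)" by auto
    then show ?thesis
    proof cases
      case 1
      then have m: "distinct m" "m \<noteq> []" "set m \<subseteq> {d..<?a}" using IHA by blast+
      then show ?thesis using subset_trans[OF m(3) sub(1)] by blast
    next
      case 2
      then have m: "distinct m" "m \<noteq> []" "set m \<subseteq> {?a..<?a + nvars B}" using IHB by blast+
      then show ?thesis using subset_trans[OF m(3) sub(2)] by blast
    qed
  qed
  moreover have "distinct (map set (phase_mons (Par A B) d))"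
    using dA dB calculation(1) by simp
  ultimately show ?case by blast
qed simp

lemma start_mons_distinct:
  assumes "matched C"
  shows "distinct (map set (start_mons C))"
    and "\<forall>m\<in>set (start_mons C). distinct m \<and> set m \<subseteq> {..<nvars C + width C}"
proof -
  let ?L = "link_mons (nvars C) (replicate (width C) []) (in_vars C 0)"
  have "list_all2 (\<lambda>p w. w \<in> {0..<nvars C} \<and> (p = [] \<or> (\<exists>v. affine p v \<and> v \<in> {0..<nvars C} \<and> v \<noteq> w)))
      (replicate (width C) []) (in_vars C 0)"
  proof -
    have "in_vars C 0 ! i < nvars C" if "i < width C" for i
    proof -
      have "in_vars C 0 ! i \<in> set (in_vars C 0)" using that assms by (intro nth_mem) simp
      then show ?thesis using vars_lessThan(3)[OF assms] by (rule subsetD[THEN lessThan_iff[THEN iffD1], rotated])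
    qed
    then show ?thesis using assms by (simp add: list_all2_conv_all_nth)
  qed
  note L = link_mons_distinct[OF this order_refl, unfolded length_in_vars[OF assms]]
  then have L: "distinct (map set ?L)"
    "\<And>m. m \<in> set ?L \<Longrightarrow> distinct m"
    "\<And>m. m \<in> set ?L \<Longrightarrow> \<exists>j\<in>{nvars C..<nvars C + width C}. j \<in> set m \<and> set m \<subseteq> insert j {0..<nvars C}"
    by blast+
  note P = phase_mons_distinct[OF assms, of 0]
  have "set ` set ?L \<inter> set ` set (phase_mons C 0) = {}"
  proof -
    have "set m \<noteq> set m'" if m: "m \<in> set ?L" and m': "m' \<in> set (phase_mons C 0)" for m m'
    proof -
      obtain j where "j \<in> {nvars C..<nvars C + width C}" and j: "j \<in> set m" using L(3)[OF m] by blast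
      moreover have "set m' \<subseteq> {0..<nvars C}" using m' P unfolding add_0 by blast
      ultimately have "j \<notin> set m'" by auto
      then show ?thesis using j by blast
    qed
    then show ?thesis by blast
  qed
  then show "distinct (map set (start_mons C))"
    using L(1) P by (simp add: start_mons_def)
  show "\<forall>m\<in>set (start_mons C). distinct m \<and> set m \<subseteq> {..<nvars C + width C}"
  proof
    fix m assume "m \<in> set (start_mons C)"
    then consider "m \<in> set ?L" | "m \<in> set (phase_mons C 0)" by (auto simp: start_mons_def)
    then show "distinct m \<and> set m \<subseteq> {..<nvars C + width C}"
    proof cases
      case 1
      obtain j where j: "j \<in> {nvars C..<nvars C + width C}" "set m \<subseteq> insert j {0..<nvars C}"
        using L(3)[OF 1] by blast
      have "insert j {0..<nvars C} \<subseteq> {..<nvars C + width C}" using j(1) by auto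
      then show ?thesis using L(2)[OF 1] subset_trans[OF j(2)] by blast
    next
      case 2
      then have m: "distinct m" "set m \<subseteq> {0..<nvars C}" using P unfolding add_0 by blast+
      have "{0..<nvars C} \<subseteq> {..<nvars C + width C}" by auto
      then show ?thesis using m(1) subset_trans[OF m(2)] by blast
    qed
  qed
qed

lemma represents_result_tree:
  assumes "matched C"
  shows "represents (result_tree C) (interp C \<circ>\<^sub>P ket (replicate (width C) 0))"
proof -
  have "writes_bpoly p (list_poly p)" if "p \<in> set (out_mons C 0)" for p
  proof -
    obtain v where "affine p v" using out_mons_affine[OF assms \<open>p \<in> _\<close>] by blast
    then show ?thesis by (intro writes_list_poly) (auto simp: affine_def)
  qed
  then have "list_all2 writes_bpoly (out_mons C 0) (map list_poly (out_mons C 0))"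
    by (simp add: list_all2_conv_all_nth)
  moreover have "writes_bpoly (start_mons C) (list_poly (start_mons C))"
    using start_mons_distinct[OF assms] by (intro writes_list_poly) auto
  ultimately show ?thesis
    unfolding represents_def interp_ket_explicit[OF assms] result_tree_def
    by (intro exI[of _ "root_exp C + 2 * width C"] exI[of _ "rev [0..<nvars C + width C]"]
        exI[of _ "start_mons C"] exI[of _ "out_mons C 0"] exI[of _ "[]"])
      (auto simp: root_half_def)
qed

section \<open>Size of the output\<close>

lemma size_enc_nat [simp]: "size (enc_nat k) = k"
  by (induction k) simp_all

lemma size_enc_list: "size (enc_list ts) = (\<Sum>t\<leftarrow>ts. Suc (size t))"
  by (induction ts) simp_all

lemma length_le_size_enc_list: "length ts \<le> size (enc_list ts)"
  by (induction ts) simp_all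

lemma bpoly_size_le_size_tree:
  assumes "writes_bpoly ms p"
  shows "bpoly_size p \<le> size (enc_monomials ms)"
proof -
  have d: "distinct (map (\<lambda>m. Mon (fset_of_list m)) ms)"
    and k: "Poly_Mapping.keys p = set (map (\<lambda>m. Mon (fset_of_list m)) ms)"
    using assms by (auto simp: writes_bpoly_def)
  have "bpoly_size p = (\<Sum>m\<leftarrow>map (\<lambda>m. Mon (fset_of_list m)) ms. Suc (card (mon_vars m)))"
    unfolding bpoly_size_def k using d by (rule sum_list_distinct_conv_sum_set[symmetric])
  also have "\<dots> = (\<Sum>m\<leftarrow>ms. Suc (card (set m)))"
    by (simp add: comp_def fset_of_list.rep_eq)
  also have "\<dots> \<le> (\<Sum>m\<leftarrow>ms. Suc (size (enc_nats m)))"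
  proof (rule sum_list_mono)
    fix m
    have "card (set m) \<le> length (map enc_nat m)" by (simp add: card_length)
    also have "\<dots> \<le> size (enc_nats m)" by (rule length_le_size_enc_list)
    finally show "Suc (card (set m)) \<le> Suc (size (enc_nats m))" by simp
  qed
  also have "\<dots> = size (enc_monomials ms)"
    by (simp add: enc_monomials_def size_enc_list comp_def)
  finally show ?thesis .
qed

lemma bpolys_size_le_size_tree:
  "list_all2 writes_bpoly ps qs \<Longrightarrow> (\<Sum>q\<leftarrow>qs. Suc (bpoly_size q)) \<le> size (enc_polys ps)"
proof (induction rule: list_all2_induct)
  case (Cons p ps q qs)
  then show ?case using bpoly_size_le_size_tree[of p q] by simp
qed simp

text \<open>Every part of the expression counted by \<open>path_sum_size\<close> is spelled out in
  the tree, so the bound on the tree carries over.\<close>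

lemma path_sum_size_le_size_tree:
  assumes "represents t A"
  shows "path_sum_size A \<le> size t"
proof -
  obtain k vs P Os Is where t: "t = enc_list [enc_nat k, enc_nats vs, enc_monomials P, enc_polys Os, enc_polys Is]"
    and vs: "distinct vs" "set vs = indets A" and P: "writes_bpoly P (phase A)"
    and Os: "list_all2 writes_bpoly Os (outs A)" and Is: "list_all2 writes_bpoly Is (ins A)"
    using assms unfolding represents_def by blast
  have "card (indets A) \<le> size (enc_nats vs)"
    using distinct_card[OF vs(1)] vs(2) length_le_size_enc_list[of "map enc_nat vs"] by simp
  then show ?thesis
    using bpoly_size_le_size_tree[OF P] bpolys_size_le_size_tree[OF Os] bpolys_size_le_size_tree[OF Is]
    by (simp add: path_sum_size_def t)
qed

lemma size_enc_nats_le: "(\<And>v. v \<in> set ns \<Longrightarrow> v < N) \<Longrightarrow> size (enc_nats ns) \<le> length ns * N"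
proof (induction ns)
  case (Cons v ns)
  then have "Suc v \<le> N" "size (enc_nats ns) \<le> length ns * N" by (simp_all add: Suc_leI)
  then show ?case by simp
qed simp

lemma size_enc_monomials_le:
  assumes "\<forall>m\<in>set ms. distinct m \<and> set m \<subseteq> {..<N}"
  shows "size (enc_monomials ms) \<le> length ms * (N * N + 1)"
  using assms
proof (induction ms)
  case (Cons m ms)
  then have m: "distinct m" "set m \<subseteq> {..<N}" by simp_all
  have "length m \<le> N"
    using card_mono[OF _ m(2)] distinct_card[OF m(1)] by simp
  then have "length m * N \<le> N * N" by (rule mult_le_mono1)
  moreover have "size (enc_nats m) \<le> length m * N"
    using m(2) by (intro size_enc_nats_le) auto
  ultimately have "size (enc_nats m) \<le> N * N" by (rule le_trans[rotated])
  then show ?case using Cons by simp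
qed simp

lemma width_le_gcost: "matched C \<Longrightarrow> width C \<le> gcost C"
  by (induction C) auto

lemma root_exp_le_gcost: "root_exp C \<le> 2 * gcost C"
  by (induction C) auto

lemma length_link_mons_le: "\<forall>p\<in>set ps. length p \<le> 2 \<Longrightarrow> length (link_mons y ps ws) \<le> 3 * length ws"
  by (induction y ps ws rule: link_mons.induct) auto

lemma length_phase_mons_le: "matched C \<Longrightarrow> length (phase_mons C d) \<le> 3 * gcost C"
proof (induction C arbitrary: d)
  case (Gate g)
  then show ?case by (cases g) auto
next
  case (Seq A B)
  then have m: "matched A" "matched B" by simp_all
  show ?case
    using Seq.IH(1)[OF m(1), of "d + nvars B"] Seq.IH(2)[OF m(2), of d] m
      length_link_mons_le[OF length_out_mons_le[OF m(1)], of "d + nvars B + nvars A" "d + nvars B" "in_vars B d"]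
    by simp
next
  case (Par A B)
  then have m: "matched A" "matched B" by simp_all
  show ?case
    using Par.IH(1)[OF m(1), of d] Par.IH(2)[OF m(2), of "d + nvars A"] by simp
qed simp

text \<open>With \<open>g = gcost C\<close> there are at most \<open>6 * g\<close> monomials in the
  phase, each with at most \<open>2 * g\<close> variables whose unary names are below
  \<open>2 * g\<close>. This cubic term dominates; 50 absorbs the rest.\<close>

lemma size_result_tree_le:
  assumes "matched C"
  shows "size (result_tree C) \<le> 50 * (gcost C + 1) ^ 3"
proof -
  let ?g = "gcost C" and ?N = "nvars C + width C"
  have N: "?N \<le> 2 * ?g" and w: "width C \<le> ?g" and r: "root_exp C \<le> 2 * ?g"
    using nvars_le_gcost[of C] width_le_gcost[OF assms] root_exp_le_gcost[of C] by simp_all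
  have NN: "?N * ?N \<le> 4 * ?g * ?g"
    using mult_le_mono[OF N N] by simp
  have vs: "size (enc_nats (rev [0..<?N])) \<le> ?N * ?N"
    using size_enc_nats_le[of "rev [0..<?N]" ?N] by simp
  have "length (start_mons C) \<le> 6 * ?g"
    using length_phase_mons_le[OF assms, of 0] w assms
      length_link_mons_le[of "replicate (width C) []" "nvars C" "in_vars C 0"] by (simp add: start_mons_def)
  then have "length (start_mons C) * (?N * ?N + 1) \<le> 6 * ?g * (4 * ?g * ?g + 1)"
    using NN by (intro mult_le_mono) simp_all
  then have P: "size (enc_monomials (start_mons C)) \<le> 6 * ?g * (4 * ?g * ?g + 1)"
    using size_enc_monomials_le[OF start_mons_distinct(2)[OF assms]] by linarith
  have "size (enc_polys ps) \<le> length ps * (?N + 3)" if "set ps \<subseteq> set (out_mons C 0)" for ps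
    using that
  proof (induction ps)
    case (Cons p ps)
    then obtain v where "affine p v" "v < nvars C"
      using out_mons_affine[OF assms, of p 0] by auto
    then have "size (enc_monomials p) \<le> ?N + 2" by (auto simp: affine_def)
    then show ?case using Cons by simp
  qed simp
  from this[of "out_mons C 0"] have "size (enc_polys (out_mons C 0)) \<le> width C * (?N + 3)"
    using assms by simp
  also have "\<dots> \<le> ?g * (2 * ?g + 3)" using w N by (intro mult_le_mono) simp_all
  finally have "size (result_tree C) \<le> (4 * ?g + 1) + (4 * ?g * ?g + 1) + (6 * ?g * (4 * ?g * ?g + 1) + 1)
      + (?g * (2 * ?g + 3) + 1) + 1"
    using vs NN P r w by (simp add: result_tree_def)
  also have "\<dots> \<le> 50 * (?g + 1) ^ 3"
    by (simp add: power3_eq_cube algebra_simps)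
  finally show ?thesis .
qed

section \<open>Term size against volume\<close>

fun nodes :: "circuit \<Rightarrow> nat" where
  "nodes (Gate g) = 1"
| "nodes (Idle k) = 1"
| "nodes (Seq A B) = nodes A + nodes B + 1"
| "nodes (Par A B) = nodes A + nodes B + 1"

lemma gcost_le_nodes: "matched C \<Longrightarrow> gcost C \<le> nodes C * (width C + 1)"
proof (induction C)
  case (Seq A B)
  then show ?case by (simp add: algebra_simps)
next
  case (Par A B)
  then have "gcost A \<le> nodes A * (width A + 1)" "gcost B \<le> nodes B * (width B + 1)" by simp_all
  moreover have "nodes A * (width A + 1) \<le> nodes A * (width A + width B + 1)"
    "nodes B * (width B + 1) \<le> nodes B * (width A + width B + 1)"
    by (intro mult_le_mono; simp)+
  ultimately show ?case by (simp add: algebra_simps)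
qed simp_all

lemma arity_pos: "0 < arity g"
  by (cases g) simp_all

text \<open>A \<open>Seq\<close> splits the gates and a \<open>Par\<close> the wires into two
  nonempty parts. A binary tree with \<open>k\<close> leaves has \<open>2 * k - 1\<close> nodes, and
  the bound multiplies this count for wires and for gates. The \<open>max 1\<close> covers gate-free
  circuits.\<close>

lemma nodes_le:
  "well_formed C \<Longrightarrow> 0 < width C \<Longrightarrow> nodes C \<le> (2 * width C - 1) * max 1 (2 * length (gates C) - 1)"
proof (induction C)
  case (Gate g)
  then show ?case using arity_pos[of g] by simp
next
  case (Seq A B)
  define W where "W = 2 * width A - 1"
  obtain a b where a: "length (gates A) = Suc a" and b: "length (gates B) = Suc b"
    using Seq.prems(1) by (auto simp: length_Suc_conv neq_Nil_conv)
  have "1 \<le> W" using Seq.prems by (simp add: W_def)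
  have "nodes A \<le> W * (2 * a + 1)" "nodes B \<le> W * (2 * b + 1)"
    using Seq by (simp_all add: a b W_def)
  then have "nodes (Seq A B) \<le> W * (2 * a + 1) + W * (2 * b + 1) + W" using \<open>1 \<le> W\<close> by simp
  also have "\<dots> = W * (2 * (a + b) + 3)" by (simp add: algebra_simps)
  also have "2 * (a + b) + 3 = max 1 (2 * length (gates (Seq A B)) - 1)" by (simp add: a b)
  finally show ?case by (simp only: W_def width.simps)
next
  case (Par A B)
  let ?F = "\<lambda>C. max 1 (2 * length (gates C) - 1)"
  obtain u v where u: "width A = Suc u" and v: "width B = Suc v"
    using Par.prems(1) by (auto simp: gr0_conv_Suc)
  have "nodes A \<le> (2 * u + 1) * ?F A" "nodes B \<le> (2 * v + 1) * ?F B"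
    using Par by (simp_all add: u v)
  moreover have "(2 * u + 1) * ?F A \<le> (2 * u + 1) * ?F (Par A B)" "(2 * v + 1) * ?F B \<le> (2 * v + 1) * ?F (Par A B)"
    by (intro mult_le_mono; simp)+
  moreover have "1 \<le> ?F (Par A B)" by simp
  ultimately have "nodes (Par A B) \<le> (2 * u + 1) * ?F (Par A B) + (2 * v + 1) * ?F (Par A B) + ?F (Par A B)"
    unfolding nodes.simps by linarith
  also have "\<dots> = (2 * width (Par A B) - 1) * ?F (Par A B)"
    by (simp add: u v algebra_simps)
  finally show ?case .
qed simp

lemma well_formed_width_0: "well_formed C \<Longrightarrow> width C = 0 \<Longrightarrow> C = Idle 0"
proof (induction C)
  case (Gate g)
  then show ?case using arity_pos[of g] by simp
qed auto

lemma nodes_all_Had: "nodes (all_Had k) \<le> 2 * k + 1"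
  by (induction k rule: all_Had.induct) auto

lemma gcost_hidden_shift:
  assumes "hidden_shift_circuit m n \<pi> f\<^sub>0 s\<^sub>1 s\<^sub>2 C"
  shows "matched C" "width C = 2 * n" "gcost C + 1 \<le> 20 * (volume C + 1) ^ 2"
proof -
  let ?H = "all_Had (2 * n)"
  obtain G F where wf: "well_formed G" "well_formed F" and w: "width G = 2 * n" "width F = 2 * n"
    and C: "C = Seq ?H (Seq G (Seq ?H (Seq F ?H)))"
    using assms unfolding hidden_shift_circuit_def implements_phase_oracle_def by blast
  show m: "matched C" and wC: "width C = 2 * n"
    using wf w matched_if_well_formed by (simp_all add: C)
  show "gcost C + 1 \<le> 20 * (volume C + 1) ^ 2"
  proof (cases "n = 0")
    case True
    \<comment> \<open>The volume is 0, so the constant of the bound has to cover the whole circuit,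
      which is forced to be five empty bundles.\<close>
    then have "C = Seq (Idle 0) (Seq (Idle 0) (Seq (Idle 0) (Seq (Idle 0) (Idle 0))))"
      using well_formed_width_0[OF wf(1)] well_formed_width_0[OF wf(2)] w by (simp add: C)
    then show ?thesis by (simp add: volume_def)
  next
    case False
    let ?w = "2 * n" and ?g = "length (gates G)" and ?f = "length (gates F)"
    have vol: "volume C = ?w * (?g + ?f + 3 * ?w)"
      by (simp add: volume_def C gates_all_Had)
    \<comment> \<open>For positive width the Hadamard gates alone make the volume at least the
      width.\<close>
    have "?w * 1 \<le> ?w * (?g + ?f + 3 * ?w)" using False by (intro mult_le_mono) simp_all
    then have wv: "?w \<le> volume C" by (simp add: vol)
    have gv: "?w * ?g \<le> volume C" "?w * ?f \<le> volume C"
      unfolding vol by (intro mult_le_mono; simp)+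
    have "nodes D \<le> 2 * ?w + 4 * (?w * length (gates D))" if "well_formed D" "width D = ?w" for D
    proof -
      have "nodes D \<le> (2 * ?w - 1) * max 1 (2 * length (gates D) - 1)"
        using nodes_le[OF that(1)] that(2) False by simp
      also have "\<dots> \<le> (2 * ?w) * (1 + 2 * length (gates D))"
        by (intro mult_le_mono) simp_all
      finally show ?thesis by (simp add: algebra_simps)
    qed
    from this[OF wf(1) w(1)] this[OF wf(2) w(2)]
    have "nodes G \<le> 6 * volume C" "nodes F \<le> 6 * volume C"
      using wv gv by linarith+
    \<comment> \<open>Six times the volume for each oracle and for the three layers together; the 7
      comes from one extra node per layer and four \<open>Seq\<close> nodes.\<close>
    then have "nodes C \<le> 18 * volume C + 7"
      using nodes_all_Had[of ?w] wv by (simp add: C)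
    then have "nodes C * (width C + 1) \<le> (18 * volume C + 7) * (volume C + 1)"
      using wv by (intro mult_le_mono) (simp_all add: wC)
    then have "gcost C \<le> (18 * volume C + 7) * (volume C + 1)"
      using gcost_le_nodes[OF m] by linarith
    then show ?thesis
      by (simp add: power2_eq_square algebra_simps)
  qed
qed

text \<open>The output is cubic in \<open>gcost\<close>, which is quadratic in the volume, hence the
  degree 6. The constant covers \<open>510 * 8000\<close> for the time and \<open>50 * 8000\<close>
  for the size.\<close>

lemma computes_hidden_shift:
  assumes "hidden_shift_circuit m n \<pi> f\<^sub>0 s\<^sub>1 s\<^sub>2 C"
  shows "\<exists>t T. computes circuit_program (enc_circuit C) T t \<and>
    represents t (interp C \<circ>\<^sub>P ket (replicate (2 * n) 0)) \<and>
    T \<le> 5000000 * (volume C + 1) ^ 6 \<and> size t \<le> 5000000 * (volume C + 1) ^ 6"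
proof -
  note m = gcost_hidden_shift(1)[OF assms] and w = gcost_hidden_shift(2)[OF assms]
  obtain T where T: "computes circuit_program (enc_circuit C) T (result_tree C)"
    "T \<le> 310 * gcost C + 200 * width C + 300"
    using computes_result_tree[OF m] .
  have "(gcost C + 1) ^ 3 \<le> (20 * (volume C + 1) ^ 2) ^ 3"
    using gcost_hidden_shift(3)[OF assms] by (rule power_mono) simp
  also have "\<dots> = 8000 * (volume C + 1) ^ 6"
    by (simp add: power_mult_distrib flip: power_mult)
  finally have g: "(gcost C + 1) ^ 3 \<le> 8000 * (volume C + 1) ^ 6" .
  have "T \<le> 510 * (gcost C + 1)"
    using T(2) width_le_gcost[OF m] by simp
  also have "\<dots> \<le> 510 * (gcost C + 1) ^ 3"
    using self_le_power[of "gcost C + 1" 3] by (intro mult_le_mono2) simp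
  finally have "T \<le> 5000000 * (volume C + 1) ^ 6"
    using g by linarith
  moreover have "size (result_tree C) \<le> 5000000 * (volume C + 1) ^ 6"
    using size_result_tree_le[OF m] g by linarith
  ultimately show ?thesis
    using T(1) represents_result_tree[OF m] unfolding w by blast
qed

theorem proposition23:
  fixes m :: nat
  assumes "m \<ge> 1"
  shows
    "(\<exists>(prog :: program) (q :: nat poly).
        \<forall>n \<pi> f\<^sub>0 s\<^sub>1 s\<^sub>2 C. hidden_shift_circuit m n \<pi> f\<^sub>0 s\<^sub>1 s\<^sub>2 C \<longrightarrow>
          (\<exists>t T. computes prog (enc_circuit C) T t \<and>
             represents t (interp C \<circ>\<^sub>P ket (replicate (2 * n) 0)) \<and>
             T \<le> poly q (volume C) \<and> size t \<le> poly q (volume C)))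
     \<and> (\<exists>q :: nat poly.
        \<forall>n \<pi> f\<^sub>0 s\<^sub>1 s\<^sub>2 C. hidden_shift_circuit m n \<pi> f\<^sub>0 s\<^sub>1 s\<^sub>2 C \<longrightarrow>
          path_sum_size (interp C \<circ>\<^sub>P ket (replicate (2 * n) 0)) \<le> poly q (volume C))
     \<and> (\<forall>n \<pi> f\<^sub>0 s\<^sub>1 s\<^sub>2 C. hidden_shift_circuit m n \<pi> f\<^sub>0 s\<^sub>1 s\<^sub>2 C \<longrightarrow>
          rewrite\<^sup>*\<^sup>* (interp C \<circ>\<^sub>P ket (replicate (2 * n) 0)) (ket (s\<^sub>1 @ s\<^sub>2)))"
proof -
  \<comment> \<open>One polynomial bounds the running time, the output tree and the
    expression.\<close>
  let ?q = "[:5000000:] * [:1, 1:] ^ 6 :: nat poly"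
  have q: "poly ?q x = 5000000 * (x + 1) ^ 6" for x
    by (simp add: poly_power add.commute)
  have 1: "\<exists>t T. computes circuit_program (enc_circuit C) T t \<and>
      represents t (interp C \<circ>\<^sub>P ket (replicate (2 * n) 0)) \<and>
      T \<le> poly ?q (volume C) \<and> size t \<le> poly ?q (volume C)"
    if "hidden_shift_circuit m n \<pi> f\<^sub>0 s\<^sub>1 s\<^sub>2 C" for n \<pi> f\<^sub>0 s\<^sub>1 s\<^sub>2 C
    using computes_hidden_shift[OF that] unfolding q by blast
  have 2: "path_sum_size (interp C \<circ>\<^sub>P ket (replicate (2 * n) 0)) \<le> poly ?q (volume C)"
    if "hidden_shift_circuit m n \<pi> f\<^sub>0 s\<^sub>1 s\<^sub>2 C" for n \<pi> f\<^sub>0 s\<^sub>1 s\<^sub>2 C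
    using 1[OF that] path_sum_size_le_size_tree le_trans by blast
  show ?thesis
    using 1 2 hidden_shift_rewrites by blast
qed

end
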